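(* Let $(X_i,Y_i,Z_i)_{i\ge1}$ be i.i.d. with law $P$ on $\mathbb R\times\mathbb R\times\mathbb R^d$, $d\ge1$, let $\mathcal H$ be a separable reproducing kernel Hilbert space of functions $\mathbb R^d\to\mathbb R$ with kernel $K$, and let $\epsilon_X(Z),\epsilon_Y(Z)$, $f,g$, the regression estimators $\widehat f,\widehat g$ and the residuals $\widehat\epsilon_{X_i}(Z_i),\widehat\epsilon_{Y_i}(Z_i)$ be as in the context. Assume: (i) $A_f=\frac1n\sum_{i=1}^n(f(Z_i)-\widehat f(Z_i))^2=o_p(n^{-1/2})$ and $A_g=\frac1n\sum_{i=1}^n(g(Z_i)-\widehat g(Z_i))^2=o_p(n^{-1/2})$; (ii) $u_f(z,y)=\mathbb E(\epsilon_X(Z)^2\mid Z=z,Y=y)$ and $v_g(z,x)=\mathbb E(\epsilon_Y(Z)^2\mid Z=z,X=x)$ are uniformly bounded; (iii) $0<\mathbb E(\epsilon_X(Z)^2\epsilon_Y(Z)^2)$; (iv) there is a constant $C>0$ with $|K(z,z')|\le C$ for all $z,z'\in\mathbb R^d$. Let $W_1,W_2,\dots$ be i.i.d. random variables with mean $0$ and variance $1$, independent of the data, and let $$\Psi_n^W=\sup_{\omega\in\mathcal H:\|\omega\|_{\mathcal H}=1}S_n^W(\omega)^2,\qquad S_n^W(\omega)=\frac1{\sqrt n}\sum_{i=1}^nW_i\,\widehat\epsilon_{X_i}(Z_i)\,\widehat\epsilon_{Y_i}(Z_i)\,\omega(Z_i).$$ Then (whether or not $X$ and $Y$ are conditionally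 independent given $Z$), as $n\to\infty$, $$\Psi_n^W\overset{\mathcal D_D}{\to}\Psi^W:=\sum_{i=1}^\infty\lambda_iQ_i^2,$$ where $Q_1,Q_2,\dots$ are i.i.d. standard normal random variables (independent of the data) and $\lambda_1,\lambda_2,\dots$ are the eigenvalues (with multiplicity) of the operator $T_{\sigma^W}:\mathcal H\to\mathcal H$, $(T_{\sigma^W}\omega)(z)=\sigma^W(\omega,K(z,\cdot))$, with $$\sigma^W(\omega,\omega')=\int_{\mathbb R^d}\omega(z)\omega'(z)\,\mathbb E(\epsilon_X(Z)^2\epsilon_Y(Z)^2\mid Z=z)\,dF_Z(z).$$
   Context: $(X,Y,Z)\sim P$ with $X,Y$ integrable; $f(z)=\mathbb E(X\mid Z=z)$, $g(z)=\mathbb E(Y\mid Z=z)$, $\epsilon_X(Z)=X-f(Z)$, $\epsilon_Y(Z)=Y-g(Z)$; $F_Z$ is the law of $Z$. For each $n$, $\widehat f$ is an estimator of $f$ computed only from $(X_i,Z_i)_{i=1}^n$, and $\widehat g$ is an estimator of $g$ computed only from $(Y_i,Z_i)_{i=1}^n$. Residuals: $\widehat\epsilon_{X_i}(Z_i)=X_i-\widehat f(Z_i)$, $\widehat\epsilon_{Y_i}(Z_i)=Y_i-\widehat g(Z_i)$. All functions in $\mathcal H$ are Borel measurable. Convergence in distribution given the data: $\mathbb E_D$ denotes conditional expectation given the data points $D$ (the first $n$ observations). For random variables $R_n,R$ in a metric space, $R_n\overset{\mathcal D_D}{\to}R$ means that $|\mathbb E_D(h(R_n))-\mathbb E_D(h(R))|\to0$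 in probability as $n\to\infty$ for every bounded uniformly continuous real-valued $h$. *)

theory Defs
  imports "HOL-Probability.Probability"
begin

(* f is a version of u \<mapsto> E(V | U = u).  real_cond_exp only has its usual meaning for
   integrable V; cond_exp_fun is to be used for such V. *)
definition cond_exp_fun ::
  "'a measure \<Rightarrow> ('a \<Rightarrow> real) \<Rightarrow> ('a \<Rightarrow> 'b::topological_space) \<Rightarrow> ('b \<Rightarrow> real) \<Rightarrow> bool" where
  "cond_exp_fun M V U f \<longleftrightarrow>
     f \<in> borel_measurable borel \<and>
     (AE \<omega> in M. real_cond_exp M (vimage_algebra (space M) U borel) V \<omega> = f (U \<omega>))"

(* The same for a nonnegative V that is not known to be integrable, with values in [0,\<infinity>]. *)
definition nn_cond_exp_fun ::
  "'a measure \<Rightarrow> ('a \<Rightarrow> ennreal) \<Rightarrow> ('a \<Rightarrow> 'b::topological_space) \<Rightarrow> ('b \<Rightarrow> ennreal) \<Rightarrow> bool" where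
  "nn_cond_exp_fun M V U f \<longleftrightarrow>
     f \<in> borel_measurable borel \<and>
     (AE \<omega> in M. nn_cond_exp M (vimage_algebra (space M) U borel) V \<omega> = f (U \<omega>))"

definition tends_in_prob :: "'a measure \<Rightarrow> (nat \<Rightarrow> 'a \<Rightarrow> real) \<Rightarrow> real \<Rightarrow> bool" where
  "tends_in_prob M R c \<longleftrightarrow>
     (\<forall>e>0. (\<lambda>n. measure M {\<omega> \<in> space M. \<bar>R n \<omega> - c\<bar> > e}) \<longlonglongrightarrow> 0)"

definition small_o_p :: "'a measure \<Rightarrow> (nat \<Rightarrow> 'a \<Rightarrow> real) \<Rightarrow> (nat \<Rightarrow> real) \<Rightarrow> bool" where
  "small_o_p M R r \<longleftrightarrow> tends_in_prob M (\<lambda>n \<omega>. R n \<omega> / r n) 0"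

definition data_sigma :: "'a measure \<Rightarrow> (nat \<Rightarrow> 'a \<Rightarrow> 'b::topological_space) \<Rightarrow> nat \<Rightarrow> 'a measure" where
  "data_sigma M D n =
     vimage_algebra (space M) (\<lambda>\<omega>. \<lambda>i\<in>{..<n}. D i \<omega>) (Pi\<^sub>M {..<n} (\<lambda>_. borel))"

(* Independence of two random sequences as a whole; prob_space.indep_var requires both to have
   the same type. *)
definition indep_seqs ::
  "'a measure \<Rightarrow> (nat \<Rightarrow> 'a \<Rightarrow> 'b::topological_space) \<Rightarrow> (nat \<Rightarrow> 'a \<Rightarrow> 'c::topological_space) \<Rightarrow> bool" where
  "indep_seqs M D W \<longleftrightarrow>
     prob_space.indep_set M
       (sets (vimage_algebra (space M) (\<lambda>\<omega> i. D i \<omega>) (Pi\<^sub>M UNIV (\<lambda>_. borel))))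
       (sets (vimage_algebra (space M) (\<lambda>\<omega> i. W i \<omega>) (Pi\<^sub>M UNIV (\<lambda>_. borel))))"

(* Convergence in distribution given the data: the n-th conditional expectation is given the
   first n observations D 0, ..., D (n - 1). *)
definition conv_in_dist_given ::
  "'a measure \<Rightarrow> (nat \<Rightarrow> 'a \<Rightarrow> 'b::topological_space) \<Rightarrow>
   (nat \<Rightarrow> 'a \<Rightarrow> 'c::metric_space) \<Rightarrow> ('a \<Rightarrow> 'c) \<Rightarrow> bool" where
  "conv_in_dist_given M D R R' \<longleftrightarrow>
     (\<forall>n. R n \<in> borel_measurable M) \<and> R' \<in> borel_measurable M \<and>
     (\<forall>h :: 'c \<Rightarrow> real. bounded (range h) \<and> uniformly_continuous_on UNIV h \<longrightarrow>
        tends_in_prob M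
          (\<lambda>n \<omega>. \<bar>real_cond_exp M (data_sigma M D n) (\<lambda>\<omega>. h (R n \<omega>)) \<omega>
                 - real_cond_exp M (data_sigma M D n) (\<lambda>\<omega>. h (R' \<omega>)) \<omega>\<bar>) 0)"

(* A Hilbert space of functions 'z \<Rightarrow> real is a Hilbert space type 'h whose elements are
   identified with functions through the injective linear map fun_of. *)
definition rkhs :: "('h::{real_inner,complete_space} \<Rightarrow> 'z \<Rightarrow> real) \<Rightarrow> ('z \<Rightarrow> 'z \<Rightarrow> real) \<Rightarrow> bool" where
  "rkhs fun_of K \<longleftrightarrow>
     inj fun_of \<and> (\<forall>z. linear (\<lambda>w. fun_of w z)) \<and>
     (\<forall>z. \<exists>k. fun_of k = K z \<and> (\<forall>w. fun_of w z = w \<bullet> k))"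

(* est n maps the data points 0, ..., n - 1 to an estimated regression function.  The
   requirement is only that the fitted values at the data points are random variables. *)
definition estimator :: "(nat \<Rightarrow> (nat \<Rightarrow> real \<times> 'z::topological_space) \<Rightarrow> 'z \<Rightarrow> real) \<Rightarrow> bool" where
  "estimator est \<longleftrightarrow>
     (\<forall>n. \<forall>i<n. (\<lambda>d. est n d (snd (d i))) \<in> borel_measurable (Pi\<^sub>M {..<n} (\<lambda>_. borel)))"

definition fitted ::
  "(nat \<Rightarrow> (nat \<Rightarrow> real \<times> 'z) \<Rightarrow> 'z \<Rightarrow> real) \<Rightarrow> (nat \<Rightarrow> 'a \<Rightarrow> real) \<Rightarrow> (nat \<Rightarrow> 'a \<Rightarrow> 'z) \<Rightarrow>
   nat \<Rightarrow> 'a \<Rightarrow> 'z \<Rightarrow> real" where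
  "fitted est X Z n \<omega> = est n (\<lambda>i\<in>{..<n}. (X i \<omega>, Z i \<omega>))"

definition avg_sq_error ::
  "('z \<Rightarrow> real) \<Rightarrow> (nat \<Rightarrow> (nat \<Rightarrow> real \<times> 'z) \<Rightarrow> 'z \<Rightarrow> real) \<Rightarrow> (nat \<Rightarrow> 'a \<Rightarrow> real) \<Rightarrow>
   (nat \<Rightarrow> 'a \<Rightarrow> 'z) \<Rightarrow> nat \<Rightarrow> 'a \<Rightarrow> real" where
  "avg_sq_error f est X Z n \<omega> = 1 / real n * (\<Sum>i<n. (f (Z i \<omega>) - fitted est X Z n \<omega> (Z i \<omega>))\<^sup>2)"

definition resid ::
  "(nat \<Rightarrow> (nat \<Rightarrow> real \<times> 'z) \<Rightarrow> 'z \<Rightarrow> real) \<Rightarrow> (nat \<Rightarrow> 'a \<Rightarrow> real) \<Rightarrow> (nat \<Rightarrow> 'a \<Rightarrow> 'z) \<Rightarrow>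
   nat \<Rightarrow> nat \<Rightarrow> 'a \<Rightarrow> real" where
  "resid est X Z n i \<omega> = X i \<omega> - fitted est X Z n \<omega> (Z i \<omega>)"

definition S_stat ::
  "(nat \<Rightarrow> (nat \<Rightarrow> real \<times> 'z) \<Rightarrow> 'z \<Rightarrow> real) \<Rightarrow> (nat \<Rightarrow> (nat \<Rightarrow> real \<times> 'z) \<Rightarrow> 'z \<Rightarrow> real) \<Rightarrow>
   (nat \<Rightarrow> 'a \<Rightarrow> real) \<Rightarrow> (nat \<Rightarrow> 'a \<Rightarrow> real) \<Rightarrow> (nat \<Rightarrow> 'a \<Rightarrow> 'z) \<Rightarrow> (nat \<Rightarrow> 'a \<Rightarrow> real) \<Rightarrow>
   nat \<Rightarrow> ('z \<Rightarrow> real) \<Rightarrow> 'a \<Rightarrow> real" where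
  "S_stat fest gest X Y Z W n u \<omega> =
     1 / sqrt (real n) *
     (\<Sum>i<n. W i \<omega> * resid fest X Z n i \<omega> * resid gest Y Z n i \<omega> * u (Z i \<omega>))"

(* The supremum is taken in [0,\<infinity>], so that it is 0 when the space is trivial and there is no
   unit vector. *)
definition Psi_stat ::
  "('h::real_normed_vector \<Rightarrow> 'z \<Rightarrow> real) \<Rightarrow>
   (nat \<Rightarrow> (nat \<Rightarrow> real \<times> 'z) \<Rightarrow> 'z \<Rightarrow> real) \<Rightarrow> (nat \<Rightarrow> (nat \<Rightarrow> real \<times> 'z) \<Rightarrow> 'z \<Rightarrow> real) \<Rightarrow>
   (nat \<Rightarrow> 'a \<Rightarrow> real) \<Rightarrow> (nat \<Rightarrow> 'a \<Rightarrow> real) \<Rightarrow> (nat \<Rightarrow> 'a \<Rightarrow> 'z) \<Rightarrow> (nat \<Rightarrow> 'a \<Rightarrow> real) \<Rightarrow>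
   nat \<Rightarrow> 'a \<Rightarrow> real" where
  "Psi_stat fun_of fest gest X Y Z W n \<omega> =
     enn2real (SUP w\<in>{w. norm w = 1}. ennreal ((S_stat fest gest X Y Z W n (fun_of w) \<omega>)\<^sup>2))"

definition sigma_form :: "'z measure \<Rightarrow> ('z \<Rightarrow> real) \<Rightarrow> ('z \<Rightarrow> real) \<Rightarrow> ('z \<Rightarrow> real) \<Rightarrow> real" where
  "sigma_form F q u v = (\<integral>z. u z * v z * q z \<partial>F)"

definition T_op ::
  "('h \<Rightarrow> 'z \<Rightarrow> real) \<Rightarrow> ('z \<Rightarrow> 'z \<Rightarrow> real) \<Rightarrow> (('z \<Rightarrow> real) \<Rightarrow> ('z \<Rightarrow> real) \<Rightarrow> real) \<Rightarrow> 'h \<Rightarrow> 'h" where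
  "T_op fun_of K s w = (THE v. \<forall>z. fun_of v z = s (fun_of w) (K z))"

(* l lists the eigenvalues of T with multiplicity: every nonzero \<mu> occurs in l exactly
   (dimension of the \<mu>-eigenspace) times.  The number of zeros is left open, so that finitely
   many nonzero eigenvalues can be padded to an infinite sequence. *)
definition lists_eigenvalues :: "('h::real_vector \<Rightarrow> 'h) \<Rightarrow> (nat \<Rightarrow> real) \<Rightarrow> bool" where
  "lists_eigenvalues T l \<longleftrightarrow>
     (\<forall>\<mu>. \<mu> \<noteq> 0 \<longrightarrow>
        (\<exists>B b. independent B \<and> span B = {w. T w = \<mu> *\<^sub>R w} \<and> bij_betw b {i. l i = \<mu>} B))"

end

theory Submission
  imports Defs "HOL-Complex_Analysis.Great_Picard" "HOL-Real_Asymp.Real_Asymp"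
begin

text \<open>
  The supremum turns the statistic into the squared norm of a multiplier sum of vectors \<open>a\<^sub>i\<close>: the
  product of the \<open>i\<close>-th residuals times the kernel section at \<open>Z\<^sub>i\<close>. Residuals may be replaced by
  errors: the estimation error of one regression is a function of the other coordinates, so its
  squared product with the errors of the other regression can be integrated coordinatewise, and the
  product of the two estimation errors contributes at most \<open>n A\<^sub>f A\<^sub>g\<close>.

  Convergence is proved through conditional Laplace transforms. After projecting onto eigenvectors
  \<open>e\<^sub>1, \<dots>, e\<^sub>m\<close> of the covariance operator, \<open>exp (- t * (\<Sum>i<m. y\<^sub>i\<^sup>2))\<close> is written as a characteristic
  function in \<open>m\<close> standard normal variables. Its conditional expectation is then a Gaussian mixture of
  products of characteristic functions of the multipliers, which converge in mean square because
  their first two moments factorise over the sample. The limiting mixture is the Laplace transform of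
  \<open>\<Sum>i<m. \<lambda>\<^sub>i Q\<^sub>i\<^sup>2\<close>, and the mass lost by the projection is the tail of the trace.
\<close>

section \<open>Hilbert spaces\<close>

text \<open>Only the scalar law of a nonnegative statistic matters, so Laplace transforms suffice
  and no central limit theorem in the Hilbert space is proved: with x = exp (- s), finite sums of
  exp (- k * s), k a natural number, are the polynomials in x, dense in C[0,1] by Weierstrass.
  Conditioning is made concrete by reading data and multipliers at two sample points
  \<open>w\<close> and \<open>w'\<close>: by independence, the conditional expectation is the
  integral over \<open>w'\<close> with \<open>w\<close> fixed. Two obstacles shape the rest. The
  products of the errors have only second moments, so limits are taken by dominated convergence with
  quadratic bounds. And the eigenvalues come as a given list, possibly padded with zeros:
  eigenvectors must be fitted to this list, and the covariance form must be shown to vanish on their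
  orthogonal complement. The truncation level m is fixed before n tends to infinity, since the mean
  projection error is bounded uniformly in n.\<close>

lemma riesz_representation:
  fixes \<phi> :: "'h::{real_inner, complete_space} \<Rightarrow> real"
  assumes lin: "linear \<phi>" and bd: "\<And>u. \<bar>\<phi> u\<bar> \<le> c * norm u"
  obtains v where "\<And>u. \<phi> u = v \<bullet> u"
proof -
  have add: "\<phi> (x + y) = \<phi> x + \<phi> y" and scale: "\<phi> (r *\<^sub>R x) = r * \<phi> x" for x y r
    using lin by (simp_all add: linear_add linear_scale)
  \<comment> \<open>Variational proof: \<open>v\<close> will be the minimiser of \<open>J\<close>,
    because norm u ^ 2 - 2 * (v \<bullet> u) is the squared distance of u from v up to a
    constant.\<close>
  define J where "J u = (norm u)^2 - 2 * \<phi> u" for u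
  have J_lower: "- (c^2) \<le> J u" for u
  proof -
    have "2 * \<phi> u \<le> 2 * (c * norm u)" using bd[of u] by linarith
    also have "\<dots> \<le> (norm u)^2 + c^2" using sum_squares_bound[of c "norm u"] by (simp add: algebra_simps)
    finally show ?thesis unfolding J_def by simp
  qed
  define i where "i = Inf (range J)"
  have bdd: "bdd_below (range J)" using J_lower by (auto intro!: bdd_belowI)
  have i_le: "i \<le> J u" for u unfolding i_def by (rule cInf_lower[OF _ bdd]) simp
  have "\<exists>u. J u < i + inverse (real (Suc n))" for n
  proof (rule ccontr)
    assume "\<not> ?thesis"
    then have "i + inverse (real (Suc n)) \<le> i"
      unfolding i_def[symmetric] by (subst (2) i_def, intro cInf_greatest) (auto simp: not_less)
    then show False by simp
  qed
  then obtain u where u: "\<And>n. J (u n) < i + inverse (real (Suc n))" by metis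
  \<comment> \<open>Evaluating \<open>J\<close> at the midpoint, where it is at least the infimum,
    forces every minimising sequence to be Cauchy.\<close>
  have parallelogram: "(norm (x - y))^2 \<le> 2 * (J x - i) + 2 * (J y - i)" for x y
  proof -
    define m where "m = (1/2) *\<^sub>R (x + y)"
    have "(norm (x - y))^2 = 2 * J x + 2 * J y - 4 * J m"
      unfolding J_def m_def scale add by (simp add: power2_norm_eq_inner algebra_simps inner_commute)
    moreover have "i \<le> J m" by (rule i_le)
    ultimately show ?thesis by argo
  qed
  have "Cauchy u"
  proof (rule metric_CauchyI)
    fix e :: real assume e: "e > 0"
    then obtain N where N: "inverse (real (Suc N)) < e^2 / 4"
      using reals_Archimedean[of "e^2 / 4"] by auto
    have "dist (u m) (u n) < e" if "m \<ge> N" "n \<ge> N" for m n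
    proof -
      have *: "J (u k) - i < e^2 / 4" if "k \<ge> N" for k
      proof -
        have "inverse (real (Suc k)) \<le> inverse (real (Suc N))" using that by (simp add: field_simps)
        then show ?thesis using u[of k] N by linarith
      qed
      have "(norm (u m - u n))^2 < e^2"
        using parallelogram[of "u m" "u n"] *[OF that(1)] *[OF that(2)] by argo
      then show ?thesis using e by (simp add: dist_norm power_less_imp_less_base)
    qed
    then show "\<exists>M. \<forall>m\<ge>M. \<forall>n\<ge>M. dist (u m) (u n) < e" by blast
  qed
  then obtain v where v: "u \<longlonglongrightarrow> v" using Cauchy_convergent convergent_def by blast
  have bl: "bounded_linear \<phi>"
    using lin bd by (intro bounded_linear_intro[where K = c]) (auto simp: add scale mult.commute)
  have "(\<lambda>n. J (u n)) \<longlonglongrightarrow> J v"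
    unfolding J_def by (intro tendsto_intros v bounded_linear.tendsto[OF bl])
  moreover have "(\<lambda>n. i + inverse (real (Suc n))) \<longlonglongrightarrow> i + 0"
    by (intro tendsto_intros LIMSEQ_inverse_real_of_nat)
  ultimately have "J v \<le> i" using u by (intro LIMSEQ_le[of "\<lambda>n. J (u n)"]) (auto intro: less_imp_le)
  then have Jmin: "J v \<le> J w" for w using i_le[of w] by simp
  have "\<phi> w = v \<bullet> w" for w
  proof -
    \<comment> \<open>First variation: a quadratic in t that is nonnegative everywhere and vanishes
      at 0 has no linear term. Below, t is set to the minimiser
      \<open>- d / (w \<bullet> w)\<close>.\<close>
    have q: "0 \<le> 2 * t * (v \<bullet> w - \<phi> w) + t^2 * (w \<bullet> w)" for t
      using Jmin[of "v + t *\<^sub>R w"] unfolding J_def add scale power2_norm_eq_inner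
      by (simp add: algebra_simps inner_commute power2_eq_square)
    define d where "d = v \<bullet> w - \<phi> w"
    show ?thesis
    proof (cases "w = 0")
      case True then show ?thesis using linear_0[OF lin] by simp
    next
      case False
      then have p: "w \<bullet> w > 0" by simp
      have "0 \<le> - (d^2) / (w \<bullet> w)"
        using q[of "- d / (w \<bullet> w)"] p unfolding d_def[symmetric] by (simp add: power2_eq_square field_simps)
      then have "d^2 \<le> 0" using p by (simp add: field_simps)
      then show ?thesis unfolding d_def by simp
    qed
  qed
  then show ?thesis using that by blast
qed

text \<open>A diagonal subsequence handles a countable dense set of test vectors, the uniform norm
  bound extends convergence to all \<open>u\<close>, and Riesz representation turns the limit
  functional into a vector. This supplies the maximiser in the spectral argument.\<close>

lemma weak_sequential_compactness:
  fixes w :: "nat \<Rightarrow> 'h::{real_inner, complete_space, second_countable_topology}"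
  assumes w: "\<And>n. norm (w n) \<le> 1"
  obtains r v where "strict_mono r" "norm v \<le> 1" "\<And>u. (\<lambda>n. w (r n) \<bullet> u) \<longlonglongrightarrow> v \<bullet> u"
proof -
  obtain D :: "'h set" where D: "countable D" "\<And>X. open X \<Longrightarrow> X \<noteq> {} \<Longrightarrow> \<exists>d\<in>D. d \<in> X"
    using countable_dense_setE by metis
  have bd: "norm (w n \<bullet> sgn d) \<le> 1" for n d
  proof -
    have "norm (w n \<bullet> sgn d) \<le> norm (w n) * norm (sgn d)"
      using Cauchy_Schwarz_ineq2[of "w n" "sgn d"] by simp
    also have "\<dots> \<le> 1 * 1" by (intro mult_mono w) (auto simp: norm_sgn)
    finally show ?thesis by simp
  qed
  \<comment> \<open>The test vectors are normalised because the diagonal argument wants one bound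
    for all of them; the factor \<open>norm d\<close> is put back below.\<close>
  obtain r where r: "strict_mono (r::nat\<Rightarrow>nat)" and
    lim: "\<And>d. d \<in> D \<Longrightarrow> \<exists>l. (\<lambda>n. w (r n) \<bullet> sgn d) \<longlonglongrightarrow> l"
    using function_convergent_subsequence[of D "\<lambda>n d. w n \<bullet> sgn d" 1] D(1) bd by metis
  have conv: "convergent (\<lambda>n. w (r n) \<bullet> u)" for u
  proof (rule Cauchy_convergent, rule metric_CauchyI)
    fix e :: real assume e: "e > 0"
    obtain d where d: "d \<in> D" "dist u d < e / 3" using D(2)[of "ball u (e / 3)"] e by auto
    obtain l where l: "(\<lambda>n. w (r n) \<bullet> sgn d) \<longlonglongrightarrow> l" using lim d(1) by blast
    have "(\<lambda>n. norm d * (w (r n) \<bullet> sgn d)) \<longlonglongrightarrow> norm d * l" by (intro tendsto_intros l)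
    moreover have "norm d * (w (r n) \<bullet> sgn d) = w (r n) \<bullet> d" for n
      by (cases "d = 0") (simp_all add: sgn_div_norm)
    ultimately have "Cauchy (\<lambda>n. w (r n) \<bullet> d)" by (simp add: LIMSEQ_imp_Cauchy)
    then obtain N where N: "\<And>m n. m \<ge> N \<Longrightarrow> n \<ge> N \<Longrightarrow> dist (w (r m) \<bullet> d) (w (r n) \<bullet> d) < e / 3"
      using e metric_CauchyD[of _ "e / 3"] by (metis divide_pos_pos zero_less_numeral)
    have close: "\<bar>w k \<bullet> u - w k \<bullet> d\<bar> < e / 3" for k
    proof -
      have "\<bar>w k \<bullet> (u - d)\<bar> \<le> norm (w k) * norm (u - d)" by (rule Cauchy_Schwarz_ineq2)
      also have "\<dots> \<le> norm (u - d)" using w[of k] by (simp add: mult_left_le_one_le)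
      finally show ?thesis using d(2) by (simp add: dist_norm inner_diff_right)
    qed
    have "dist (w (r m) \<bullet> u) (w (r n) \<bullet> u) < e" if "m \<ge> N" "n \<ge> N" for m n
      using N[OF that] close[of "r m"] close[of "r n"] unfolding dist_real_def by linarith
    then show "\<exists>M. \<forall>m\<ge>M. \<forall>n\<ge>M. dist (w (r m) \<bullet> u) (w (r n) \<bullet> u) < e" by blast
  qed
  define \<phi> where "\<phi> u = lim (\<lambda>n. w (r n) \<bullet> u)" for u
  have \<phi>: "(\<lambda>n. w (r n) \<bullet> u) \<longlonglongrightarrow> \<phi> u" for u
    using conv[of u] unfolding \<phi>_def by (simp add: convergent_LIMSEQ_iff)
  have "linear \<phi>"
  proof (rule linearI)
    show "\<phi> (x + y) = \<phi> x + \<phi> y" for x y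
      using tendsto_add[OF \<phi>[of x] \<phi>[of y]] \<phi>[of "x + y"] by (intro LIMSEQ_unique) (simp_all add: inner_add_right)
    show "\<phi> (c *\<^sub>R x) = c *\<^sub>R \<phi> x" for c x
      using tendsto_mult[OF tendsto_const[of c] \<phi>[of x]] \<phi>[of "c *\<^sub>R x"] by (intro LIMSEQ_unique) simp_all
  qed
  moreover have bd\<phi>: "\<bar>\<phi> u\<bar> \<le> 1 * norm u" for u
  proof (rule LIMSEQ_le_const2[OF tendsto_rabs[OF \<phi>[of u]]], intro exI allI impI)
    fix n
    have "\<bar>w (r n) \<bullet> u\<bar> \<le> norm (w (r n)) * norm u" by (rule Cauchy_Schwarz_ineq2)
    also have "\<dots> \<le> 1 * norm u" by (intro mult_right_mono w) simp
    finally show "\<bar>w (r n) \<bullet> u\<bar> \<le> 1 * norm u" .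
  qed
  ultimately obtain v where v: "\<And>u. \<phi> u = v \<bullet> u" using riesz_representation by metis
  have "norm v * norm v \<le> 1 * norm v"
    using bd\<phi>[of v] v[of v] by (simp add: norm_eq_sqrt_inner)
  then have "norm v \<le> 1" by (cases "v = 0") auto
  then show ?thesis using that r \<phi> v by metis
qed

text \<open>An eigenspace comes with an arbitrary basis counted by the eigenvalue list; equal
  cardinality lets this count pass to an orthonormal basis. Zero vectors are discarded from the
  orthogonalised set before normalising.\<close>

lemma orthonormal_basis_of_finite:
  fixes B :: "'h::real_inner set"
  assumes fin: "finite B" and indep: "independent B"
  obtains E where "finite E" "card E = card B" "span E = span B" "pairwise orthogonal E"
    "\<And>x. x \<in> E \<Longrightarrow> norm x = 1"
proof -
  obtain C where C: "finite C" "span C = span B" "pairwise orthogonal C"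
    using basis_orthogonal[OF fin] by metis
  define E where "E = sgn ` (C - {0})"
  have "independent (C - {0})"
    by (rule pairwise_orthogonal_independent) (use C(3) in \<open>auto simp: pairwise_def\<close>)
  moreover have spC: "span (C - {0}) = span B" using C(2) by simp
  ultimately have card: "card (C - {0}) = card B"
    using indep by (metis dim_span_eq_card_independent)
  have orth: "orthogonal (sgn x) (sgn y)" if "x \<in> C" "y \<in> C" "x \<noteq> y" for x y
    using C(3) that by (auto simp: pairwise_def orthogonal_def sgn_div_norm)
  have norm1: "norm (sgn x) = 1" if "x \<in> C - {0}" for x using that by (simp add: norm_sgn)
  have inj: "inj_on sgn (C - {0})"
  proof (rule inj_onI, rule ccontr)
    fix x y assume "x \<in> C - {0}" "y \<in> C - {0}" and eq: "sgn x = sgn y" and "x \<noteq> y"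
    then have "sgn x \<bullet> sgn x = 0" using orth[of x y] by (simp add: orthogonal_def)
    then show False using norm1[OF \<open>x \<in> C - {0}\<close>] by simp
  qed
  have "span E = span B"
  proof -
    have "E \<subseteq> span (C - {0})" unfolding E_def sgn_div_norm by (intro image_subsetI span_scale span_base)
    moreover have "C - {0} \<subseteq> span E"
    proof
      fix x assume x: "x \<in> C - {0}"
      then have "x = norm x *\<^sub>R sgn x" by (simp add: sgn_div_norm)
      moreover have "norm x *\<^sub>R sgn x \<in> span E" unfolding E_def using x by (intro span_scale span_base) simp
      ultimately show "x \<in> span E" by simp
    qed
    ultimately show ?thesis using spC by (metis span_minimal subspace_span subset_antisym)
  qed
  moreover have "finite E" "card E = card B" unfolding E_def using C(1) card card_image[OF inj] by auto
  moreover have "pairwise orthogonal E" unfolding E_def pairwise_def using orth by auto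
  moreover have "norm x = 1" if "x \<in> E" for x using that norm1 unfolding E_def by auto
  ultimately show ?thesis using that by blast
qed

text \<open>The dense set has to lie inside \<open>V\<close>: \<open>V\<close> will be an orthogonal
  complement, where a property known almost surely for each single vector must be obtained on one
  common null set.\<close>

lemma countable_dense_subset:
  fixes V :: "'a::second_countable_topology set"
  obtains D where "countable D" "D \<subseteq> V" "V \<subseteq> closure D"
proof -
  obtain B :: "'a set set" where B: "countable B" "topological_basis B"
    using ex_countable_basis by blast
  define p where "p b = (SOME x. x \<in> b \<inter> V)" for b
  define D where "D = p ` {b \<in> B. b \<inter> V \<noteq> {}}"
  have p: "p b \<in> b \<inter> V" if "b \<inter> V \<noteq> {}" for b
    using that some_in_eq[of "b \<inter> V"] unfolding p_def by simp
  have "countable D" "D \<subseteq> V" using B(1) p by (auto simp: D_def)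
  moreover have "V \<subseteq> closure D"
  proof
    fix x assume x: "x \<in> V"
    have "\<exists>d\<in>D. d \<in> S" if "open S" "x \<in> S" for S
    proof -
      obtain b where b: "b \<in> B" "x \<in> b" "b \<subseteq> S" using topological_basisE[OF B(2) \<open>open S\<close> \<open>x \<in> S\<close>] by blast
      have ne: "b \<inter> V \<noteq> {}" using b x by auto
      then have "p b \<in> D" unfolding D_def using b by blast
      then show ?thesis using p[OF ne] b(3) by blast
    qed
    then show "x \<in> closure D" unfolding closure_iff_nhds_not_empty by (meson disjoint_iff subsetD)
  qed
  ultimately show ?thesis using that by blast
qed

text \<open>The norm is determined by countably many inner products, so preimages of closed balls
  are measurable, and an open set is a countable union of such balls. It is meant for kernel
  sections, whose inner products with elements of the space are measurable functions.\<close>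

lemma borel_measurable_weakly:
  fixes a :: "'b \<Rightarrow> 'h::{real_inner, second_countable_topology}"
  assumes weak: "\<And>u. (\<lambda>x. a x \<bullet> u) \<in> borel_measurable M"
  shows "a \<in> borel_measurable M"
proof -
  obtain D :: "'h set" where D: "countable D" "\<And>X. open X \<Longrightarrow> X \<noteq> {} \<Longrightarrow> \<exists>d\<in>D. d \<in> X"
    using countable_dense_setE by metis
  have norm_le: "norm v \<le> r \<longleftrightarrow> (\<forall>c\<in>D. v \<bullet> c \<le> r * norm c)" if r: "r \<ge> 0" for v :: 'h and r
  proof
    assume "norm v \<le> r"
    then show "\<forall>c\<in>D. v \<bullet> c \<le> r * norm c"
      by (meson Cauchy_Schwarz_ineq2 abs_le_D1 mult_right_mono norm_ge_zero order_trans)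
  next
    \<comment> \<open>The vectors satisfying this inequality form a closed set containing the dense
      set \<open>D\<close>, so \<open>v\<close> itself may be inserted.\<close>
    assume *: "\<forall>c\<in>D. v \<bullet> c \<le> r * norm c"
    have "closed {c. v \<bullet> c \<le> r * norm c}" by (intro closed_Collect_le continuous_intros)
    moreover have "v \<in> closure D" unfolding closure_iff_nhds_not_empty
      using D(2) by (metis disjoint_iff empty_iff subsetD)
    ultimately have "v \<bullet> v \<le> r * norm v" using * closure_minimal[of D "{c. v \<bullet> c \<le> r * norm c}"] by auto
    then show "norm v \<le> r"
      using r by (cases "v = 0") (auto simp: dot_square_norm power2_eq_square)
  qed
  have dist_le: "{x \<in> space M. dist (a x) d \<le> r} \<in> sets M" if r: "r \<ge> 0" for d r
  proof -
    have "D \<noteq> {}" using D(2)[of UNIV] by auto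
    then obtain c :: "nat \<Rightarrow> 'h" where c: "D = range c" using D(1) uncountable_def by blast
    have [measurable]: "(\<lambda>x. a x \<bullet> u) \<in> borel_measurable M" for u by (rule weak)
    have "{x \<in> space M. \<forall>c\<in>D. a x \<bullet> c - d \<bullet> c \<le> r * norm c} \<in> sets M"
      unfolding c ball_UNIV by simp measurable
    then show ?thesis by (simp add: dist_norm norm_le[OF r] inner_diff_left)
  qed
  show ?thesis
  proof (rule borel_measurableI)
    fix S :: "'h set" assume S: "open S"
    define I where "I = {(d, n). d \<in> D \<and> cball d (inverse (real (Suc n))) \<subseteq> S}"
    have I: "countable I" by (rule countable_subset[of _ "D \<times> UNIV"]) (auto simp: I_def D(1))
    have "S = (\<Union>(d, n)\<in>I. cball d (inverse (real (Suc n))))"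
    proof
      show "S \<subseteq> (\<Union>(d, n)\<in>I. cball d (inverse (real (Suc n))))"
      proof
        fix x assume "x \<in> S"
        then obtain e where e: "e > 0" "ball x e \<subseteq> S" using S openE by blast
        then obtain n where n: "inverse (real (Suc n)) < e / 2" using reals_Archimedean[of "e / 2"] by auto
        obtain d where d: "d \<in> D" "dist x d < inverse (real (Suc n))"
          using D(2)[of "ball x (inverse (real (Suc n)))"] by auto
        have "cball d (inverse (real (Suc n))) \<subseteq> ball x e"
        proof
          fix y assume "y \<in> cball d (inverse (real (Suc n)))"
          then have "dist x y < e" using dist_triangle[of x y d] d(2) n by auto
          then show "y \<in> ball x e" by simp
        qed
        then have "(d, n) \<in> I" using d e unfolding I_def by auto
        moreover have "x \<in> cball d (inverse (real (Suc n)))" using d by (simp add: dist_commute)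
        ultimately show "x \<in> (\<Union>(d, n)\<in>I. cball d (inverse (real (Suc n))))" by blast
      qed
    qed (auto simp: I_def)
    then have "y \<in> S \<longleftrightarrow> (\<exists>(d, n)\<in>I. dist y d \<le> inverse (real (Suc n)))" for y
      by (simp add: dist_commute case_prod_beta)
    then have "a -` S \<inter> space M = (\<Union>(d, n)\<in>I. {x \<in> space M. dist (a x) d \<le> inverse (real (Suc n))})"
      by auto
    then show "a -` S \<inter> space M \<in> sets M"
      using dist_le I by (auto intro!: sets.countable_UN'' dist_le)
  qed
qed

definition orthosystem :: "('i \<Rightarrow> 'h::real_inner) \<Rightarrow> bool" where
  "orthosystem e \<longleftrightarrow> (\<forall>i j. i \<noteq> j \<longrightarrow> e i \<bullet> e j = 0) \<and> (\<forall>i. e i = 0 \<or> norm (e i) = 1)"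

lemma orthosystem_inner_self: "orthosystem e \<Longrightarrow> (u \<bullet> e i)^2 * (e i \<bullet> e i) = (u \<bullet> e i)^2"
  unfolding orthosystem_def by (metis inner_zero_right dot_square_norm mult.right_neutral one_power2
      power_zero_numeral mult_zero_left)

lemma orthosystem_norm_sum:
  assumes e: "orthosystem e" and F: "finite F"
  shows "(norm (\<Sum>i\<in>F. (u \<bullet> e i) *\<^sub>R e i))^2 = (\<Sum>i\<in>F. (u \<bullet> e i)^2)"
proof -
  have "(norm (\<Sum>i\<in>F. (u \<bullet> e i) *\<^sub>R e i))^2 = (\<Sum>i\<in>F. \<Sum>j\<in>F. (u \<bullet> e i) * (u \<bullet> e j) * (e i \<bullet> e j))"
    by (simp add: power2_norm_eq_inner inner_sum_left inner_sum_right sum_distrib_left algebra_simps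
        inner_commute[of "e _" "e _"])
  also have "\<dots> = (\<Sum>i\<in>F. \<Sum>j\<in>F. if j = i then (u \<bullet> e i)^2 else 0)"
    using e orthosystem_inner_self[OF e, of u]
    by (intro sum.cong refl) (auto simp: orthosystem_def power2_eq_square)
  also have "\<dots> = (\<Sum>i\<in>F. (u \<bullet> e i)^2)" using F by simp
  finally show ?thesis .
qed

lemma orthosystem_norm_residual:
  assumes e: "orthosystem e" and F: "finite F"
  shows "(norm (u - (\<Sum>i\<in>F. (u \<bullet> e i) *\<^sub>R e i)))^2 = (norm u)^2 - (\<Sum>i\<in>F. (u \<bullet> e i)^2)"
proof -
  have "u \<bullet> (\<Sum>i\<in>F. (u \<bullet> e i) *\<^sub>R e i) = (\<Sum>i\<in>F. (u \<bullet> e i)^2)"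
    by (simp add: inner_sum_right power2_eq_square)
  then show ?thesis
    using orthosystem_norm_sum[OF assms, of u]
    by (simp add: power2_norm_eq_inner inner_diff_left inner_diff_right inner_commute)
qed

lemma bessel_inequality:
  assumes "orthosystem e" "finite F"
  shows "(\<Sum>i\<in>F. (u \<bullet> e i)^2) \<le> (norm u)^2"
  using orthosystem_norm_residual[OF assms, of u] by (metis diff_ge_0_iff_ge zero_le_power2)

text \<open>The hypothesis concerns the single vector \<open>x\<close>, since the system need not
  span the space. Bessel's inequality makes the partial sums Cauchy; their limit \<open>y\<close>
  has the coefficients of \<open>x\<close>, so \<open>x - y\<close> is orthogonal to the system,
  hence to the partial sums, to \<open>y\<close>, and by hypothesis to \<open>x\<close>. So it is
  0.\<close>

lemma orthosystem_expansion:
  fixes e :: "nat \<Rightarrow> 'h::{real_inner, complete_space}"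
  assumes e: "orthosystem e" and x: "\<And>w. (\<And>i. w \<bullet> e i = 0) \<Longrightarrow> x \<bullet> w = 0"
  shows "(\<lambda>m. \<Sum>i<m. (x \<bullet> e i) *\<^sub>R e i) \<longlonglongrightarrow> x"
proof -
  define p where "p m = (\<Sum>i<m. (x \<bullet> e i) *\<^sub>R e i)" for m
  have "summable (\<lambda>i. (x \<bullet> e i)^2)"
    using bessel_inequality[OF e, of "{..<_}" x] by (intro summableI_nonneg_bounded) auto
  then have cau: "Cauchy (\<lambda>m. \<Sum>i<m. (x \<bullet> e i)^2)" by (simp add: summable_iff_convergent convergent_Cauchy)
  have dist_p: "(dist (p m) (p n))^2 = dist (\<Sum>i<m. (x \<bullet> e i)^2) (\<Sum>i<n. (x \<bullet> e i)^2)" if "n \<le> m" for m n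
  proof -
    have "p m - p n = (\<Sum>i\<in>{n..<m}. (x \<bullet> e i) *\<^sub>R e i)"
      unfolding p_def using sum_diff_nat_ivl[of 0 n m "\<lambda>i. (x \<bullet> e i) *\<^sub>R e i"] that by (simp add: atLeast0LessThan)
    then have "(dist (p m) (p n))^2 = (\<Sum>i\<in>{n..<m}. (x \<bullet> e i)^2)"
      using orthosystem_norm_sum[OF e] by (simp add: dist_norm)
    also have "\<dots> = (\<Sum>i<m. (x \<bullet> e i)^2) - (\<Sum>i<n. (x \<bullet> e i)^2)"
      using sum_diff_nat_ivl[of 0 n m "\<lambda>i. (x \<bullet> e i)^2"] that by (simp add: atLeast0LessThan)
    also have "\<dots> = dist (\<Sum>i<m. (x \<bullet> e i)^2) (\<Sum>i<n. (x \<bullet> e i)^2)"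
      using calculation by (simp add: dist_real_def) (metis abs_of_nonneg sum_nonneg zero_le_power2)
    finally show ?thesis .
  qed
  have "Cauchy p"
  proof (rule metric_CauchyI)
    fix r :: real assume r: "r > 0"
    then obtain N where N: "\<And>m n. m \<ge> N \<Longrightarrow> n \<ge> N \<Longrightarrow>
        dist (\<Sum>i<m. (x \<bullet> e i)^2) (\<Sum>i<n. (x \<bullet> e i)^2) < r^2"
      using metric_CauchyD[OF cau, of "r^2"] by auto
    have "dist (p m) (p n) < r" if "m \<ge> N" "n \<ge> N" for m n
    proof -
      have "(dist (p m) (p n))^2 < r^2"
        using dist_p[of n m] dist_p[of m n] N[OF that] N[OF that(2,1)]
        by (cases "n \<le> m") (simp_all add: dist_commute)
      then show ?thesis using r by (simp add: power_less_imp_less_base)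
    qed
    then show "\<exists>M. \<forall>m\<ge>M. \<forall>n\<ge>M. dist (p m) (p n) < r" by blast
  qed
  then obtain y where y: "p \<longlonglongrightarrow> y" using Cauchy_convergent convergent_def by blast
  have p_e: "p m \<bullet> e i = (if i < m then x \<bullet> e i else 0)" for m i
  proof -
    have "p m \<bullet> e i = (\<Sum>j<m. if j = i then x \<bullet> e i else 0)"
      unfolding p_def inner_sum_left using e
      by (intro sum.cong refl) (auto simp: orthosystem_def dot_square_norm, metis inner_zero_right one_power2)
    then show ?thesis by simp
  qed
  have perp: "(x - y) \<bullet> e i = 0" for i
  proof -
    have "(\<lambda>m. p m \<bullet> e i) \<longlonglongrightarrow> y \<bullet> e i" by (intro tendsto_intros y)
    moreover have "(\<lambda>m. p m \<bullet> e i) \<longlonglongrightarrow> x \<bullet> e i"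
      by (rule tendsto_eventually, rule eventually_sequentiallyI[of "Suc i"]) (simp add: p_e)
    ultimately show ?thesis using LIMSEQ_unique by (fastforce simp: inner_diff_left)
  qed
  have "p m \<bullet> (x - y) = 0" for m
    using perp unfolding p_def inner_sum_left by (simp add: inner_commute[of "e _"])
  then have "y \<bullet> (x - y) = 0"
    using tendsto_inner[OF y tendsto_const[of "x - y"]] by (simp add: LIMSEQ_const_iff)
  then have "(x - y) \<bullet> (x - y) = 0" using x[of "x - y"] perp by (simp add: inner_diff_left)
  then show ?thesis using y unfolding p_def by simp
qed

section \<open>Spectral decomposition of a covariance form\<close>

text \<open>Uncentred second moments: the mean of \<open>a\<close> need not vanish without
  conditional independence, and the centring comes from the multipliers instead.\<close>

definition cov_form :: "'b measure \<Rightarrow> ('b \<Rightarrow> 'h::real_inner) \<Rightarrow> 'h \<Rightarrow> 'h \<Rightarrow> real" where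
  "cov_form P a u v = (\<integral>x. (a x \<bullet> u) * (a x \<bullet> v) \<partial>P)"

context
  fixes P :: "'b measure" and a :: "'b \<Rightarrow> 'h::{real_inner, complete_space, second_countable_topology}"
  assumes a [measurable]: "a \<in> borel_measurable P" and sq: "integrable P (\<lambda>x. (norm (a x))^2)"
begin

lemma cov_form_integrand_bound: "\<bar>(a x \<bullet> u) * (a x \<bullet> v)\<bar> \<le> (norm (a x))^2 * (norm u * norm v)"
proof -
  have "\<bar>a x \<bullet> u\<bar> * \<bar>a x \<bullet> v\<bar> \<le> (norm (a x) * norm u) * (norm (a x) * norm v)"
    by (intro mult_mono Cauchy_Schwarz_ineq2) auto
  then show ?thesis by (simp add: abs_mult power2_eq_square algebra_simps)
qed

lemma cov_form_integrable: "integrable P (\<lambda>x. (a x \<bullet> u) * (a x \<bullet> v))"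
  using cov_form_integrand_bound
  by (intro Bochner_Integration.integrable_bound[OF integrable_mult_left[OF sq, of "norm u * norm v"]]) auto

lemma cov_form_commute: "cov_form P a u v = cov_form P a v u"
  by (simp add: cov_form_def mult.commute)

lemma cov_form_add_left: "cov_form P a (u + v) w = cov_form P a u w + cov_form P a v w"
  unfolding cov_form_def inner_add_right ring_distribs
  by (rule Bochner_Integration.integral_add) (rule cov_form_integrable)+

lemma cov_form_scale_left: "cov_form P a (c *\<^sub>R u) w = c * cov_form P a u w"
  by (simp add: cov_form_def mult.assoc)

lemma cov_form_quadratic:
  "cov_form P a (u + c *\<^sub>R v) (u + c *\<^sub>R v) = cov_form P a u u + 2 * c * cov_form P a u v + c^2 * cov_form P a v v"
proof -
  have "cov_form P a w (u + c *\<^sub>R v) = cov_form P a w u + c * cov_form P a w v" for w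
    unfolding cov_form_commute[of w] by (simp add: cov_form_add_left cov_form_scale_left)
  then show ?thesis
    using cov_form_commute[of u v] by (simp add: cov_form_add_left cov_form_scale_left algebra_simps power2_eq_square)
qed

lemma cov_form_nonneg: "cov_form P a u u \<ge> 0"
  by (simp add: cov_form_def)

lemma cov_form_bound: "\<bar>cov_form P a u v\<bar> \<le> (\<integral>x. (norm (a x))^2 \<partial>P) * (norm u * norm v)"
proof -
  have "\<bar>cov_form P a u v\<bar> \<le> (\<integral>x. \<bar>(a x \<bullet> u) * (a x \<bullet> v)\<bar> \<partial>P)"
    unfolding cov_form_def by (rule integral_abs_bound)
  also have "\<dots> \<le> (\<integral>x. (norm (a x))^2 * (norm u * norm v) \<partial>P)"
    using sq cov_form_integrable cov_form_integrand_bound by (intro integral_mono) auto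
  finally show ?thesis by simp
qed

lemma cov_form_riesz:
  obtains T where "\<And>u v. cov_form P a u v = T u \<bullet> v"
proof -
  have "\<exists>t. \<forall>v. cov_form P a u v = t \<bullet> v" for u
  proof -
    have "linear (\<lambda>v. cov_form P a u v)"
      by (rule linearI) (simp_all add: cov_form_commute[of u] cov_form_add_left cov_form_scale_left)
    moreover have "\<bar>cov_form P a u v\<bar> \<le> ((\<integral>x. (norm (a x))^2 \<partial>P) * norm u) * norm v" for v
      using cov_form_bound[of u v] by (simp add: mult.assoc)
    ultimately show ?thesis using riesz_representation[of "\<lambda>v. cov_form P a u v"] by metis
  qed
  then show ?thesis using that by metis
qed

text \<open>Bessel's inequality, integrated. The trace bound yields both finite multiplicities and
  summability of the eigenvalues.\<close>

lemma cov_form_trace_bound: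
  assumes e: "orthosystem e" and F: "finite F"
  shows "(\<Sum>i\<in>F. cov_form P a (e i) (e i)) \<le> (\<integral>x. (norm (a x))^2 \<partial>P)"
proof -
  have "(\<Sum>i\<in>F. cov_form P a (e i) (e i)) = (\<integral>x. (\<Sum>i\<in>F. (a x \<bullet> e i)^2) \<partial>P)"
    unfolding cov_form_def power2_eq_square
    by (rule Bochner_Integration.integral_sum[symmetric]) (rule cov_form_integrable)
  also have "\<dots> \<le> (\<integral>x. (norm (a x))^2 \<partial>P)"
    using cov_form_integrable bessel_inequality[OF e F] sq unfolding power2_eq_square
    by (intro integral_mono Bochner_Integration.integrable_sum) auto
  finally show ?thesis .
qed

text \<open>Orthonormal eigenvectors for \<open>\<mu>\<close> each contribute \<open>\<mu>\<close>
  to the trace, which is bounded; so there cannot be arbitrarily many.\<close>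

lemma eigenvalue_multiplicity_finite:
  assumes T: "\<And>u v. cov_form P a u v = T u \<bullet> v" and \<mu>: "\<mu> \<noteq> 0"
    and B: "independent B" "B \<subseteq> {w. T w = \<mu> *\<^sub>R w}"
  shows "finite B"
proof (rule ccontr)
  assume inf: "infinite B"
  define t where "t = (\<integral>x. (norm (a x))^2 \<partial>P)"
  \<comment> \<open>Large enough for \<open>N * \<mu>\<close> to exceed the trace bound
    \<open>t\<close> once \<open>\<mu>\<close> is known to be positive.\<close>
  define N where "N = Suc (nat \<lceil>t / \<mu>\<rceil>)"
  obtain B' where B': "B' \<subseteq> B" "finite B'" "card B' = N"
    using inf by (meson infinite_arbitrarily_large)
  obtain E where E: "finite E" "card E = card B'" "span E = span B'" "pairwise orthogonal E"
      "\<And>x. x \<in> E \<Longrightarrow> norm x = 1"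
    using orthonormal_basis_of_finite[OF B'(2) independent_mono[OF B(1) B'(1)]] by metis
  \<comment> \<open>The eigenspace expressed through the form: bilinearity of the form makes it a
    subspace, so the orthonormalised vectors remain eigenvectors.\<close>
  define S where "S = {w. \<forall>v. cov_form P a w v = \<mu> * (w \<bullet> v)}"
  have "subspace S"
    unfolding subspace_def S_def
    by (auto simp: cov_form_add_left cov_form_scale_left inner_add_left algebra_simps)
       (simp add: cov_form_def)
  moreover have "B' \<subseteq> S" using B B' unfolding S_def by (auto simp: T)
  ultimately have "E \<subseteq> S" using E(3) by (metis span_minimal span_superset subset_trans)
  then have eq: "cov_form P a x x = \<mu>" if "x \<in> E" for x
    using that E(5)[OF that] unfolding S_def by (auto simp: dot_square_norm)
  \<comment> \<open>The finite set indexed by its own elements, with zeros elsewhere, becomes a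
    system on the whole type.\<close>
  define e where "e x = (if x \<in> E then x else 0)" for x
  have "orthosystem e"
    using E(4,5) unfolding orthosystem_def e_def by (auto simp: pairwise_def orthogonal_def)
  then have "(\<Sum>x\<in>E. cov_form P a (e x) (e x)) \<le> t" unfolding t_def by (rule cov_form_trace_bound[OF _ E(1)])
  then have le: "real N * \<mu> \<le> t" using eq E(2) B'(3) by (simp add: e_def)
  have "E \<noteq> {}" using E(2) B'(3) by (auto simp: N_def)
  then have "\<mu> > 0" using eq cov_form_nonneg \<mu> by (metis all_not_in_conv less_eq_real_def)
  moreover have "t / \<mu> < real N" unfolding N_def by linarith
  ultimately show False using le by (simp add: field_simps)
qed

text \<open>Orthonormal bases of the single eigenspaces are indexed by the positions of the
  eigenvalue in \<open>lam\<close> and glued together; symmetry of the form makes different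
  eigenspaces orthogonal. Finite multiplicity permits the transfer of positions to the orthonormal
  basis.\<close>

lemma orthonormal_eigenvectors:
  assumes T: "\<And>u v. cov_form P a u v = T u \<bullet> v" and lam: "lists_eigenvalues T lam"
  obtains e where "orthosystem e" "\<And>i u. cov_form P a (e i) u = lam i * (e i \<bullet> u)"
    "\<And>i. e i = 0 \<longleftrightarrow> lam i = 0"
    "\<And>\<mu> w. \<mu> \<noteq> 0 \<Longrightarrow> T w = \<mu> *\<^sub>R w \<Longrightarrow> w \<in> span (e ` {i. lam i = \<mu>})"
proof -
  \<comment> \<open>The first conjunct merely states that \<open>c\<close> is injective on the
    positions of \<open>\<mu>\<close>.\<close>
  define is_basis where "is_basis \<mu> c \<longleftrightarrow> bij_betw c {i. lam i = \<mu>} (c ` {i. lam i = \<mu>})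
      \<and> pairwise orthogonal (c ` {i. lam i = \<mu>}) \<and> (\<forall>i. lam i = \<mu> \<longrightarrow> norm (c i) = 1)
      \<and> span (c ` {i. lam i = \<mu>}) = {w. T w = \<mu> *\<^sub>R w}" for \<mu> and c :: "nat \<Rightarrow> 'h"
  have "\<exists>c. is_basis \<mu> c" if \<mu>: "\<mu> \<noteq> 0" for \<mu>
  proof -
    obtain B b where B: "independent B" "span B = {w. T w = \<mu> *\<^sub>R w}" "bij_betw b {i. lam i = \<mu>} B"
      using lam \<mu> unfolding lists_eigenvalues_def by blast
    have fin: "finite B"
      by (rule eigenvalue_multiplicity_finite[OF T \<mu> B(1)]) (use B(2) span_superset in blast)
    obtain E where E: "finite E" "card E = card B" "span E = span B" "pairwise orthogonal E"
        "\<And>x. x \<in> E \<Longrightarrow> norm x = 1"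
      using orthonormal_basis_of_finite[OF fin B(1)] by metis
    obtain h where "bij_betw h B E" using finite_same_card_bij[OF fin E(1)] E(2) by auto
    then have c: "bij_betw (h \<circ> b) {i. lam i = \<mu>} E" using B(3) bij_betw_trans by blast
    then have "(h \<circ> b) ` {i. lam i = \<mu>} = E" by (simp add: bij_betw_def)
    then have "is_basis \<mu> (h \<circ> b)" unfolding is_basis_def using c E B(2) by auto
    then show ?thesis by (intro exI[of _ "h \<circ> b"])
  qed
  then obtain c where "\<And>\<mu>. \<mu> \<noteq> 0 \<Longrightarrow> is_basis \<mu> (c \<mu>)" by metis
  then have c: "\<And>\<mu>. \<mu> \<noteq> 0 \<Longrightarrow> bij_betw (c \<mu>) {i. lam i = \<mu>} (c \<mu> ` {i. lam i = \<mu>})"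
      "\<And>\<mu>. \<mu> \<noteq> 0 \<Longrightarrow> pairwise orthogonal (c \<mu> ` {i. lam i = \<mu>})"
      "\<And>\<mu> i. \<mu> \<noteq> 0 \<Longrightarrow> lam i = \<mu> \<Longrightarrow> norm (c \<mu> i) = 1"
      "\<And>\<mu>. \<mu> \<noteq> 0 \<Longrightarrow> span (c \<mu> ` {i. lam i = \<mu>}) = {w. T w = \<mu> *\<^sub>R w}"
    unfolding is_basis_def by blast+
  define e where "e i = (if lam i = 0 then 0 else c (lam i) i)" for i
  have img: "e ` {i. lam i = \<mu>} = c \<mu> ` {i. lam i = \<mu>}" if "\<mu> \<noteq> 0" for \<mu>
    using that by (auto simp: e_def image_def)
  have eig: "T (e i) = lam i *\<^sub>R e i" if "lam i \<noteq> 0" for i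
  proof -
    have "e i \<in> span (e ` {j. lam j = lam i})" by (rule span_base) simp
    then show ?thesis using c(4)[OF that] img[OF that] by auto
  qed
  have cov_e: "cov_form P a (e i) u = lam i * (e i \<bullet> u)" for i u
  proof (cases "lam i = 0")
    case True then show ?thesis by (simp add: e_def cov_form_def)
  next
    case False then show ?thesis by (simp add: T eig)
  qed
  have orth: "e i \<bullet> e j = 0" if "i \<noteq> j" for i j
  proof (cases "lam i \<noteq> 0 \<and> lam j \<noteq> 0")
    case True
    show ?thesis
    proof (cases "lam i = lam j")
      case eq: True
      then have "c (lam i) i \<noteq> c (lam i) j"
        using c(1)[of "lam i"] True that by (auto simp: bij_betw_def inj_on_def)
      then show ?thesis using c(2)[of "lam i"] True eq
        by (auto simp: pairwise_def orthogonal_def e_def)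
    next
      case False
      have "lam i * (e i \<bullet> e j) = lam j * (e i \<bullet> e j)"
        using cov_e[of i "e j"] cov_e[of j "e i"] cov_form_commute[of "e i" "e j"]
        by (auto simp: inner_commute)
      then show ?thesis using False by simp
    qed
  next
    case False then show ?thesis by (auto simp: e_def)
  qed
  have norm_e: "norm (e i) = 1" if "lam i \<noteq> 0" for i using c(3)[OF that refl] that by (simp add: e_def)
  show ?thesis
  proof (rule that[of e])
    show "orthosystem e" unfolding orthosystem_def using orth norm_e by (metis e_def)
    show "cov_form P a (e i) u = lam i * (e i \<bullet> u)" for i u by (rule cov_e)
    show "e i = 0 \<longleftrightarrow> lam i = 0" for i using norm_e[of i] by (auto simp: e_def)
    show "w \<in> span (e ` {i. lam i = \<mu>})" if "\<mu> \<noteq> 0" "T w = \<mu> *\<^sub>R w" for \<mu> w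
      using c(4)[OF that(1)] img[OF that(1)] that(2) by auto
  qed
qed

text \<open>On the orthogonal complement of the eigenvectors a maximiser of the quadratic form over the
  unit ball (it exists by weak compactness) would be a further eigenvector.\<close>

lemma cov_form_vanishes_on_complement:
  assumes T: "\<And>u v. cov_form P a u v = T u \<bullet> v"
    and e: "\<And>i u. cov_form P a (e i) u = lam i * (e i \<bullet> u)"
    and complete: "\<And>\<mu> w. \<mu> \<noteq> 0 \<Longrightarrow> T w = \<mu> *\<^sub>R w \<Longrightarrow> w \<in> span (e ` {i. lam i = \<mu>})"
    and w0: "\<And>i. w0 \<bullet> e i = 0"
  shows "cov_form P a w0 w0 = 0"
proof (rule ccontr)
  assume ne: "cov_form P a w0 w0 \<noteq> 0"
  then have w0_pos: "cov_form P a w0 w0 > 0" using cov_form_nonneg[of w0] by linarith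
  define V where "V = {w. \<forall>i. w \<bullet> e i = 0}"
  define S where "S = (\<lambda>w. cov_form P a w w) ` {w \<in> V. norm w \<le> 1}"
  define t where "t = (\<integral>x. (norm (a x))^2 \<partial>P)"
  have bdd: "bdd_above S"
  proof (rule bdd_aboveI)
    fix y assume "y \<in> S"
    then obtain w where w: "norm w \<le> 1" "y = cov_form P a w w" by (auto simp: S_def)
    have "y \<le> t * (norm w * norm w)" using cov_form_bound[of w w] w(2) by (simp add: t_def)
    also have "\<dots> \<le> t * 1" using w(1) unfolding t_def by (intro mult_left_mono) (auto simp: mult_le_one)
    finally show "y \<le> t" by simp
  qed
  define s where "s = Sup S"
  have upper: "cov_form P a u u \<le> s * (norm u)^2" if u: "u \<in> V" for u
  proof (cases "u = 0")
    case True then show ?thesis by (simp add: cov_form_def)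
  next
    case False
    have "sgn u \<in> V" using u by (auto simp: V_def sgn_div_norm)
    then have "cov_form P a (sgn u) (sgn u) \<in> S" unfolding S_def by (auto simp: norm_sgn)
    then have "cov_form P a (sgn u) (sgn u) \<le> s" unfolding s_def by (rule cSup_upper[OF _ bdd])
    moreover have "cov_form P a (sgn u) (sgn u) = cov_form P a u u / (norm u)^2"
      unfolding sgn_div_norm cov_form_scale_left
      by (subst cov_form_commute, subst cov_form_scale_left) (simp add: power2_eq_square divide_inverse)
    ultimately show ?thesis using False by (simp add: pos_divide_le_eq)
  qed
  have "0 < s * (norm w0)^2"
    using upper[of w0] w0 w0_pos by (simp add: V_def)
  then have s_pos: "s > 0" by (simp add: zero_less_mult_iff)
  have Sne: "S \<noteq> {}" unfolding S_def by (auto simp: V_def intro!: exI[of _ 0])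
  have "\<exists>w. w \<in> V \<and> norm w \<le> 1 \<and> s - inverse (real (Suc n)) < cov_form P a w w" for n
  proof -
    have "s - inverse (real (Suc n)) < Sup S" unfolding s_def by simp
    then obtain y where "y \<in> S" "s - inverse (real (Suc n)) < y" using less_cSupE[OF _ Sne] by metis
    then show ?thesis unfolding S_def by auto
  qed
  then have "\<exists>w. \<forall>n. w n \<in> V \<and> norm (w n) \<le> 1 \<and> s - inverse (real (Suc n)) < cov_form P a (w n) (w n)"
    by (intro choice allI)
  then obtain w where w: "\<And>n. w n \<in> V" "\<And>n. norm (w n) \<le> 1"
      "\<And>n. s - inverse (real (Suc n)) < cov_form P a (w n) (w n)"
    by blast
  obtain r v where r: "strict_mono r" and nv: "norm v \<le> 1" and lim: "\<And>u. (\<lambda>n. w (r n) \<bullet> u) \<longlonglongrightarrow> v \<bullet> u"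
    using weak_sequential_compactness[of w] w(2) by blast
  have vV: "v \<in> V"
    unfolding V_def
  proof safe
    fix i
    have "(\<lambda>n. w (r n) \<bullet> e i) = (\<lambda>n. 0)" using w(1) by (auto simp: V_def)
    then show "v \<bullet> e i = 0" using lim[of "e i"] by (simp add: LIMSEQ_const_iff)
  qed
  \<comment> \<open>Weak continuity of the form on the unit ball, which does the work of compactness
    of the operator: the integrand converges pointwise and is dominated by
    \<open>(norm (a x))^2\<close>.\<close>
  have "(\<lambda>n. cov_form P a (w (r n)) (w (r n))) \<longlonglongrightarrow> cov_form P a v v"
    unfolding cov_form_def
  proof (rule integral_dominated_convergence[where w = "\<lambda>x. (norm (a x))^2"])
    show "AE x in P. (\<lambda>n. (a x \<bullet> w (r n)) * (a x \<bullet> w (r n))) \<longlonglongrightarrow> (a x \<bullet> v) * (a x \<bullet> v)"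
      by (intro AE_I2 tendsto_mult) (use lim in \<open>simp_all only: inner_commute[of "a _"]\<close>)
    show "AE x in P. norm ((a x \<bullet> w (r n)) * (a x \<bullet> w (r n))) \<le> (norm (a x))^2" for n
    proof (rule AE_I2)
      fix x
      have "norm ((a x \<bullet> w (r n)) * (a x \<bullet> w (r n))) \<le> (norm (a x))^2 * (norm (w (r n)) * norm (w (r n)))"
        using cov_form_integrand_bound[of x "w (r n)" "w (r n)"] by (simp only: real_norm_def)
      also have "\<dots> \<le> (norm (a x))^2 * 1"
        using w(2)[of "r n"] by (intro mult_left_mono) (auto simp: mult_le_one)
      finally show "norm ((a x \<bullet> w (r n)) * (a x \<bullet> w (r n))) \<le> (norm (a x))^2" by simp
    qed
  qed (use sq in auto)
  moreover have "(\<lambda>n. s - inverse (real (Suc (r n)))) \<longlonglongrightarrow> s - 0"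
    by (intro tendsto_diff tendsto_const LIMSEQ_subseq_LIMSEQ[OF LIMSEQ_inverse_real_of_nat r, unfolded comp_def])
  ultimately have s_le: "s \<le> cov_form P a v v"
    using w(3) by (intro LIMSEQ_le[of "\<lambda>n. s - inverse (real (Suc (r n)))" s]) (auto intro: less_imp_le)
  \<comment> \<open>The defect in the eigenvalue equation. Moving from \<open>v\<close> by
    \<open>c *\<^sub>R x\<close> with \<open>c = 1 / s\<close> adds
    \<open>2 * c * (x \<bullet> x)\<close> to the form but only \<open>c * (x \<bullet> x)\<close>
    to \<open>s\<close> times the squared norm, apart from a common term and a further nonnegative
    term in the form. Maximality then forces \<open>x = 0\<close>.\<close>
  define x where "x = T v - s *\<^sub>R v"
  have xV: "x \<in> V"
  proof -
    have "T v \<bullet> e i = 0" for i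
      using e[of i v] vV T[of v "e i"] cov_form_commute[of v "e i"] by (simp add: V_def inner_commute)
    then show ?thesis using vV by (simp add: x_def V_def inner_diff_left)
  qed
  define c where "c = 1 / s"
  have c: "s * c = 1" "c > 0" using s_pos by (simp_all add: c_def)
  have "v + c *\<^sub>R x \<in> V" using vV xV by (simp add: V_def inner_add_left)
  note upper[OF this]
  also have "(norm (v + c *\<^sub>R x))^2 = (norm v)^2 + 2 * c * (v \<bullet> x) + c^2 * (x \<bullet> x)"
    unfolding power2_norm_eq_inner
    by (simp add: inner_add_left inner_add_right inner_commute[of x v] power2_eq_square distrib_left)
  also have "s * \<dots> = s * (norm v)^2 + 2 * (s * c) * (v \<bullet> x) + (s * c) * c * (x \<bullet> x)"
    by (simp add: algebra_simps power2_eq_square)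
  finally have 1: "cov_form P a v v + 2 * c * cov_form P a v x + c^2 * cov_form P a x x
      \<le> s * (norm v)^2 + 2 * (v \<bullet> x) + c * (x \<bullet> x)"
    unfolding cov_form_quadratic c(1) by simp
  have "T v \<bullet> x = x \<bullet> x + s * (v \<bullet> x)"
    by (simp add: x_def inner_diff_left)
  then have "2 * c * cov_form P a v x = 2 * c * (x \<bullet> x) + 2 * (s * c) * (v \<bullet> x)"
    unfolding T by (simp add: algebra_simps)
  then have 2: "2 * c * cov_form P a v x = 2 * (c * (x \<bullet> x)) + 2 * (v \<bullet> x)" unfolding c(1) by simp
  have "s * (norm v)^2 \<le> s * 1" using nv s_pos by (intro mult_left_mono) (auto simp: power_le_one)
  moreover have "c^2 * cov_form P a x x \<ge> 0" using cov_form_nonneg by simp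
  ultimately have "c * (x \<bullet> x) \<le> 0" using s_le 1 2 by linarith
  then have "x \<bullet> x \<le> 0" using c(2) by (simp add: mult_le_0_iff)
  then have "x = 0" by (metis inner_eq_zero_iff inner_ge_zero order_antisym)
  then have "T v = s *\<^sub>R v" by (simp add: x_def)
  \<comment> \<open>Completeness puts \<open>v\<close> into the span of listed eigenvectors, to all
    of which it is orthogonal; so \<open>v\<close> is 0, although its form value is at least
    \<open>s > 0\<close>.\<close>
  then have "v \<in> span (e ` {i. lam i = s})" using complete[of s v] s_pos by simp
  moreover have "span (e ` {i. lam i = s}) \<subseteq> {u. v \<bullet> u = 0}"
    using vV by (intro span_minimal subspace_hyperplane) (auto simp: V_def)
  ultimately have "v = 0" by auto
  then show False using s_le s_pos by (simp add: cov_form_def)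
qed

text \<open>On the complement of the system the form vanishes, so \<open>a\<close> is almost surely
  orthogonal to each vector of a countable dense subset, hence to the whole complement. Then
  \<open>a\<close> equals its expansion almost surely, and \<open>(norm (a x))^2\<close> dominates
  the remainders.\<close>

lemma expectation_tail_vanishes:
  assumes e: "orthosystem e" and zero: "\<And>w. (\<And>i. w \<bullet> e i = 0) \<Longrightarrow> cov_form P a w w = 0"
  shows "(\<lambda>m::nat. \<integral>x. (norm (a x - (\<Sum>i<m. (a x \<bullet> e i) *\<^sub>R e i)))^2 \<partial>P) \<longlonglongrightarrow> 0"
proof -
  let ?p = "\<lambda>m x. \<Sum>i<m. (a x \<bullet> e i) *\<^sub>R e i"
  define V where "V = {w. \<forall>i. w \<bullet> e i = 0}"
  obtain D where D: "countable D" "D \<subseteq> V" "V \<subseteq> closure D" using countable_dense_subset .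
  have "AE x in P. a x \<bullet> d = 0" if "d \<in> D" for d
  proof -
    have "(\<integral>x. (a x \<bullet> d)^2 \<partial>P) = 0" using zero[of d] that D(2) by (auto simp: V_def cov_form_def power2_eq_square)
    moreover have "integrable P (\<lambda>x. (a x \<bullet> d)^2)" using cov_form_integrable by (simp add: power2_eq_square)
    ultimately show ?thesis using integral_nonneg_eq_0_iff_AE[of P "\<lambda>x. (a x \<bullet> d)^2"] by simp
  qed
  then have "AE x in P. \<forall>d\<in>D. a x \<bullet> d = 0" using D(1) by (simp add: AE_ball_countable)
  then have conv: "AE x in P. (\<lambda>m. \<Sum>i<m. (a x \<bullet> e i) *\<^sub>R e i) \<longlonglongrightarrow> a x"
  proof eventually_elim
    case (elim x)
    have "closed {u. a x \<bullet> u = 0}" by (rule closed_hyperplane)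
    then have "closure D \<subseteq> {u. a x \<bullet> u = 0}" using elim by (intro closure_minimal) auto
    then have "a x \<bullet> w = 0" if "\<And>i. w \<bullet> e i = 0" for w using D(3) that unfolding V_def by auto
    then show ?case by (rule orthosystem_expansion[OF e])
  qed
  have "(\<lambda>m::nat. \<integral>x. (norm (a x - ?p m x))^2 \<partial>P) \<longlonglongrightarrow> (\<integral>x. 0 \<partial>P)"
  proof (rule integral_dominated_convergence[where w = "\<lambda>x. (norm (a x))^2"])
    show "AE x in P. (\<lambda>m. (norm (a x - ?p m x))^2) \<longlonglongrightarrow> 0"
      using conv
    proof eventually_elim
      case (elim x)
      then have "(\<lambda>m. (norm (a x - ?p m x))^2) \<longlonglongrightarrow> (norm (a x - a x))^2"
        by (intro tendsto_intros)
      then show ?case by simp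
    qed
    show "AE x in P. norm ((norm (a x - ?p m x))^2) \<le> (norm (a x))^2" for m
    proof (rule AE_I2)
      fix x
      show "norm ((norm (a x - ?p m x))^2) \<le> (norm (a x))^2"
        using orthosystem_norm_residual[OF e, of "{..<m}" "a x"] bessel_inequality[OF e, of "{..<m}" "a x"]
          sum_nonneg[of "{..<m}" "\<lambda>i. (a x \<bullet> e i)^2"] by (simp add: abs_le_iff)
    qed
  qed (use sq in auto)
  then show ?thesis by simp
qed

theorem covariance_eigenexpansion:
  assumes T: "\<And>u v. cov_form P a u v = T u \<bullet> v" and lam: "lists_eigenvalues T lam"
  obtains e where "orthosystem e" "\<And>i u. cov_form P a (e i) u = lam i * (e i \<bullet> u)"
    "\<And>i. e i = 0 \<longleftrightarrow> lam i = 0" "\<And>i. lam i \<ge> 0" "summable lam"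
    "(\<lambda>m. \<integral>x. (norm (a x - (\<Sum>i<m. (a x \<bullet> e i) *\<^sub>R e i)))^2 \<partial>P) \<longlonglongrightarrow> 0"
proof -
  obtain e where e: "orthosystem e" and cov_e: "\<And>i u. cov_form P a (e i) u = lam i * (e i \<bullet> u)"
    and e0: "\<And>i. e i = 0 \<longleftrightarrow> lam i = 0"
    and complete: "\<And>\<mu> w. \<mu> \<noteq> 0 \<Longrightarrow> T w = \<mu> *\<^sub>R w \<Longrightarrow> w \<in> span (e ` {i. lam i = \<mu>})"
    using orthonormal_eigenvectors[OF T lam] by metis
  \<comment> \<open>At a zero eigenvalue the vector is 0 as well, so the equation holds at every
    index.\<close>
  have lam_eq: "lam i = cov_form P a (e i) (e i)" for i
    using e e0[of i] cov_e[of i "e i"] unfolding orthosystem_def by (auto simp: dot_square_norm)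
  then have nonneg: "lam i \<ge> 0" for i using cov_form_nonneg by simp
  have "summable lam"
    using nonneg cov_form_trace_bound[OF e, of "{..<_}"] lam_eq by (intro summableI_nonneg_bounded) auto
  moreover have "(\<lambda>m. \<integral>x. (norm (a x - (\<Sum>i<m. (a x \<bullet> e i) *\<^sub>R e i)))^2 \<partial>P) \<longlonglongrightarrow> 0"
    by (rule expectation_tail_vanishes[OF e], rule cov_form_vanishes_on_complement[OF T cov_e complete])
  ultimately show ?thesis by (intro that[OF e cov_e e0 nonneg])
qed

end

section \<open>Convergence in probability and conditional expectation\<close>

lemma real_squeeze_0:
  fixes f g :: "nat \<Rightarrow> real"
  assumes "g \<longlonglongrightarrow> 0" "\<And>n. f n \<le> g n" "\<And>n. 0 \<le> f n"
  shows "f \<longlonglongrightarrow> 0"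
  using tendsto_sandwich[of "\<lambda>_. 0" f sequentially g 0] assms by simp

lemma tends_in_probD:
  "tends_in_prob M R c \<Longrightarrow> e > 0 \<Longrightarrow> (\<lambda>n. measure M {w \<in> space M. \<bar>R n w - c\<bar> > e}) \<longlonglongrightarrow> 0"
  by (simp add: tends_in_prob_def)

text \<open>The error budget behind the proofs of convergence in probability: one part vanishes in
  probability, the other has small mean. \<open>S\<close> and \<open>T\<close> may depend on
  \<open>e\<close>, so a truncation level can be chosen before n grows. The nonnegative integral
  spares a proof of integrability of \<open>T\<close>.\<close>

definition nearly_bounded :: "'a measure \<Rightarrow> (nat \<Rightarrow> 'a \<Rightarrow> real) \<Rightarrow> real \<Rightarrow> bool" where
  "nearly_bounded M R e \<longleftrightarrow> (\<exists>S T. (\<forall>n. S n \<in> borel_measurable M) \<and> (\<forall>n. T n \<in> borel_measurable M) \<and>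
    tends_in_prob M S 0 \<and> (\<forall>\<^sub>F n in sequentially. (\<forall>w\<in>space M. \<bar>R n w\<bar> \<le> \<bar>S n w\<bar> + T n w) \<and>
      (\<integral>\<^sup>+w. ennreal (T n w) \<partial>M) \<le> ennreal e))"

lemma nearly_boundedI:
  assumes "\<And>n. S n \<in> borel_measurable M" "\<And>n. T n \<in> borel_measurable M" "tends_in_prob M S 0"
    and "\<forall>\<^sub>F n in sequentially. \<forall>w\<in>space M. \<bar>R n w\<bar> \<le> \<bar>S n w\<bar> + T n w"
    and "\<forall>\<^sub>F n in sequentially. (\<integral>\<^sup>+w. ennreal (T n w) \<partial>M) \<le> ennreal e"
  shows "nearly_bounded M R e"
  unfolding nearly_bounded_def using assms by (intro exI[of _ S] exI[of _ T]) (auto intro: eventually_conj)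

lemma (in prob_space) tends_in_probI:
  assumes *: "\<And>e. e > 0 \<Longrightarrow> nearly_bounded M (\<lambda>n w. R n w - c) e"
  shows "tends_in_prob M R c"
  unfolding tends_in_prob_def
proof (intro allI impI tendstoI)
  fix e d :: real assume e: "e > 0" and d: "d > 0"
  \<comment> \<open>Markov's inequality at level \<open>e / 2\<close> turns the mean bound
    \<open>d * e / 8\<close> into probability at most \<open>d / 4\<close>, leaving room for
    \<open>d / 2\<close> from \<open>S\<close>.\<close>
  obtain S T where [measurable]: "\<And>n. S n \<in> borel_measurable M" "\<And>n. T n \<in> borel_measurable M"
    and S: "tends_in_prob M S 0"
    and ev: "\<forall>\<^sub>F n in sequentially. (\<forall>w\<in>space M. \<bar>R n w - c\<bar> \<le> \<bar>S n w\<bar> + T n w) \<and>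
        (\<integral>\<^sup>+w. ennreal (T n w) \<partial>M) \<le> ennreal (d * e / 8)"
    using *[of "d * e / 8"] e d unfolding nearly_bounded_def by (auto simp del: ennreal_le_iff)
  have "(\<lambda>n. measure M {w \<in> space M. \<bar>S n w - 0\<bar> > e / 2}) \<longlonglongrightarrow> 0"
    using e by (intro tends_in_probD[OF S]) simp
  then have "\<forall>\<^sub>F n in sequentially. measure M {w \<in> space M. \<bar>S n w - 0\<bar> > e / 2} < d / 2"
    using d by (intro order_tendstoD(2)) auto
  with ev show "\<forall>\<^sub>F n in sequentially. dist (measure M {w \<in> space M. \<bar>R n w - c\<bar> > e}) 0 < d"
  proof eventually_elim
    case (elim n)
    let ?A = "{w \<in> space M. \<bar>S n w - 0\<bar> > e / 2}" and ?B = "{w \<in> space M. T n w \<ge> e / 2}"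
    have sub: "{w \<in> space M. \<bar>R n w - c\<bar> > e} \<subseteq> ?A \<union> ?B"
      using elim(1) by (auto dest!: bspec)
    have "emeasure M ({w \<in> space M. 1 \<le> ennreal (2 / e) * ennreal (T n w)})
        \<le> ennreal (2 / e) * (\<integral>\<^sup>+w. ennreal (T n w) * indicator (space M) w \<partial>M)"
      by (rule nn_integral_Markov_inequality) auto
    also have "(\<integral>\<^sup>+w. ennreal (T n w) * indicator (space M) w \<partial>M) = (\<integral>\<^sup>+w. ennreal (T n w) \<partial>M)"
      by (intro nn_integral_cong) (auto split: split_indicator)
    also have "ennreal (2 / e) * \<dots> \<le> ennreal (2 / e) * ennreal (d * e / 8)"
      using elim(1) by (intro mult_left_mono) auto
    also have "\<dots> = ennreal (d / 4)" using e d by (simp add: ennreal_mult[symmetric])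
    also have "{w \<in> space M. 1 \<le> ennreal (2 / e) * ennreal (T n w)} = ?B"
    proof (intro Collect_cong conj_cong refl)
      fix w
      have "ennreal (2 / e) * ennreal (T n w) = ennreal (2 / e * T n w)"
        using e by (simp add: ennreal_mult'[symmetric])
      then show "1 \<le> ennreal (2 / e) * ennreal (T n w) \<longleftrightarrow> e / 2 \<le> T n w"
        using e by (simp only: ennreal_ge_1) (simp add: field_simps)
    qed
    finally have "measure M ?B \<le> d / 4" using d by (simp add: emeasure_eq_measure)
    moreover have "measure M {w \<in> space M. \<bar>R n w - c\<bar> > e} \<le> measure M (?A \<union> ?B)"
      by (rule finite_measure_mono[OF sub]) measurable
    moreover have "measure M (?A \<union> ?B) \<le> measure M ?A + measure M ?B"
      by (rule measure_Un_le) measurable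
    ultimately show ?case using elim(2) d by simp
  qed
qed

lemma (in prob_space) tends_in_prob_dominated:
  assumes "\<And>n. S n \<in> borel_measurable M" "tends_in_prob M S 0"
    and "\<forall>\<^sub>F n in sequentially. \<forall>w\<in>space M. \<bar>R n w - c\<bar> \<le> \<bar>S n w\<bar>"
  shows "tends_in_prob M R c"
proof (rule tends_in_probI)
  show "nearly_bounded M (\<lambda>n w. R n w - c) e" if "e > 0" for e
    by (rule nearly_boundedI[of S M "\<lambda>_ _. 0"]) (use assms in simp_all)
qed

text \<open>Common pattern for sums and products: a large value of \<open>R\<close> forces a large
  value of \<open>S\<close> or \<open>T\<close>, with thresholds uniform in n and the sample point,
  and a union bound finishes.\<close>

lemma (in prob_space) tends_in_prob_combine:
  assumes [measurable]: "\<And>n. S n \<in> borel_measurable M" "\<And>n. T n \<in> borel_measurable M"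
    and S: "tends_in_prob M S 0" and T: "tends_in_prob M T 0"
    and R: "\<And>e. e > 0 \<Longrightarrow> \<exists>b>0. \<exists>d>0. \<forall>n w. \<bar>R n w\<bar> > e \<longrightarrow> \<bar>S n w\<bar> > b \<or> \<bar>T n w\<bar> > d"
  shows "tends_in_prob M R 0"
  unfolding tends_in_prob_def
proof (intro allI impI)
  fix e :: real assume "e > 0"
  then obtain b d where bd: "b > 0" "d > 0" "\<And>n w. \<bar>R n w\<bar> > e \<Longrightarrow> \<bar>S n w\<bar> > b \<or> \<bar>T n w\<bar> > d"
    using R by meson
  let ?A = "\<lambda>S b n. {w \<in> space M. \<bar>S n w - 0\<bar> > b}"
  have "(\<lambda>n. measure M (?A S b n) + measure M (?A T d n)) \<longlonglongrightarrow> 0"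
    using bd(1,2) by (intro tendsto_add_zero tends_in_probD[OF S] tends_in_probD[OF T])
  moreover have "measure M (?A R e n) \<le> measure M (?A S b n) + measure M (?A T d n)" for n
  proof -
    have "measure M (?A R e n) \<le> measure M (?A S b n \<union> ?A T d n)"
      using bd(3)[of n] by (intro finite_measure_mono) auto
    also have "\<dots> \<le> measure M (?A S b n) + measure M (?A T d n)" by (rule measure_Un_le) measurable
    finally show ?thesis .
  qed
  ultimately show "(\<lambda>n. measure M (?A R e n)) \<longlonglongrightarrow> 0"
    by (rule real_squeeze_0) simp
qed

lemma (in prob_space) tends_in_prob_add:
  assumes "\<And>n. S n \<in> borel_measurable M" "\<And>n. T n \<in> borel_measurable M"
    and "tends_in_prob M S 0" "tends_in_prob M T 0"
  shows "tends_in_prob M (\<lambda>n w. S n w + T n w) 0"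
proof (rule tends_in_prob_combine[OF assms])
  show "\<exists>b>0. \<exists>d>0. \<forall>n w. \<bar>S n w + T n w\<bar> > e \<longrightarrow> \<bar>S n w\<bar> > b \<or> \<bar>T n w\<bar> > d" if "e > 0" for e
    using that by (intro exI[of _ "e / 2"] conjI) auto
qed

lemma (in prob_space) tends_in_prob_mult:
  assumes "\<And>n. S n \<in> borel_measurable M" "\<And>n. T n \<in> borel_measurable M"
    and "tends_in_prob M S 0" "tends_in_prob M T 0"
  shows "tends_in_prob M (\<lambda>n w. S n w * T n w) 0"
proof (rule tends_in_prob_combine[OF assms])
  fix e :: real assume e: "e > 0"
  have "\<bar>S n w\<bar> > e" if "\<bar>S n w * T n w\<bar> > e" "\<not> \<bar>T n w\<bar> > 1" for n w
  proof -
    have "\<bar>S n w * T n w\<bar> \<le> \<bar>S n w\<bar> * 1" unfolding abs_mult using that(2) by (intro mult_left_mono) auto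
    then show ?thesis using that(1) by simp
  qed
  then show "\<exists>b>0. \<exists>d>0. \<forall>n w. \<bar>S n w * T n w\<bar> > e \<longrightarrow> \<bar>S n w\<bar> > b \<or> \<bar>T n w\<bar> > d"
    using e by (intro exI[of _ e] exI[of _ 1] conjI) auto
qed

lemma tends_in_prob_cmult:
  assumes "tends_in_prob M S c"
  shows "tends_in_prob M (\<lambda>n w. b * (S n w - c)) 0"
  unfolding tends_in_prob_def
proof (intro allI impI)
  fix e :: real assume e: "e > 0"
  show "(\<lambda>n. measure M {w \<in> space M. \<bar>b * (S n w - c) - 0\<bar> > e}) \<longlonglongrightarrow> 0"
  proof (cases "b = 0")
    case False
    then have "(\<bar>b * (S n w - c) - 0\<bar> > e) = (\<bar>S n w - c\<bar> > e / \<bar>b\<bar>)" for n w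
      by (simp add: abs_mult pos_divide_less_eq mult.commute)
    then show ?thesis using assms False e by (simp add: tends_in_prob_def)
  qed (use e in auto)
qed

lemma (in prob_space) tends_in_prob_sum:
  assumes "finite I" "\<And>i n. i \<in> I \<Longrightarrow> S i n \<in> borel_measurable M" "\<And>i. i \<in> I \<Longrightarrow> tends_in_prob M (S i) 0"
  shows "tends_in_prob M (\<lambda>n w. \<Sum>i\<in>I. S i n w) 0"
  using assms
proof (induction I rule: finite_induct)
  case empty show ?case by (simp add: tends_in_prob_def)
next
  case (insert i I)
  then show ?case by (simp add: tends_in_prob_add)
qed

section \<open>Conditional expectation given an independent family\<close>

lemma subalgebra_vimage_algebra:
  assumes "U \<in> M \<rightarrow>\<^sub>M N"
  shows "subalgebra M (vimage_algebra (space M) U N)"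
  unfolding subalgebra_def
  by (auto simp: sets_vimage_algebra2 measurable_space[OF assms] intro: measurable_sets[OF assms])

lemma (in prob_space) distr_pair_indep:
  assumes U [measurable]: "U \<in> M \<rightarrow>\<^sub>M N1" and V [measurable]: "V \<in> M \<rightarrow>\<^sub>M N2"
    and indep: "indep_set (sets (vimage_algebra (space M) U N1)) (sets (vimage_algebra (space M) V N2))"
  shows "distr M (N1 \<Otimes>\<^sub>M N2) (\<lambda>w. (U w, V w)) = distr M N1 U \<Otimes>\<^sub>M distr M N2 V"
proof (rule pair_measure_eqI[symmetric])
  interpret U: prob_space "distr M N1 U" by (rule prob_space_distr) simp
  interpret V: prob_space "distr M N2 V" by (rule prob_space_distr) simp
  show "sigma_finite_measure (distr M N1 U)" "sigma_finite_measure (distr M N2 V)" by unfold_locales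
  show "sets (distr M N1 U \<Otimes>\<^sub>M distr M N2 V) = sets (distr M (N1 \<Otimes>\<^sub>M N2) (\<lambda>w. (U w, V w)))" by simp
  fix A B assume "A \<in> sets (distr M N1 U)" "B \<in> sets (distr M N2 V)"
  then have [measurable]: "A \<in> sets N1" "B \<in> sets N2" by auto
  have "prob ((U -` A \<inter> space M) \<inter> (V -` B \<inter> space M)) = prob (U -` A \<inter> space M) * prob (V -` B \<inter> space M)"
    by (rule indep_setD[OF indep]) (auto intro!: in_vimage_algebra)
  moreover have "(\<lambda>w. (U w, V w)) -` (A \<times> B) \<inter> space M = (U -` A \<inter> space M) \<inter> (V -` B \<inter> space M)" by auto
  ultimately show "emeasure (distr M N1 U) A * emeasure (distr M N2 V) B =
      emeasure (distr M (N1 \<Otimes>\<^sub>M N2) (\<lambda>w. (U w, V w))) (A \<times> B)"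
    by (simp add: emeasure_distr emeasure_eq_measure ennreal_mult)
qed

text \<open>Freezing principle: by independence the joint law is a product, so \<open>V\<close> is
  integrated out by Fubini with \<open>U\<close> held fixed. This replaces conditional expectations
  by integrals over a second sample point.\<close>

lemma (in prob_space) real_cond_exp_indep:
  fixes f :: "'b \<Rightarrow> 'c \<Rightarrow> real"
  assumes U [measurable]: "U \<in> M \<rightarrow>\<^sub>M N1" and V [measurable]: "V \<in> M \<rightarrow>\<^sub>M N2"
    and indep: "indep_set (sets (vimage_algebra (space M) U N1)) (sets (vimage_algebra (space M) V N2))"
    and f [measurable]: "case_prod f \<in> borel_measurable (N1 \<Otimes>\<^sub>M N2)" and bound: "\<And>u v. \<bar>f u v\<bar> \<le> B"
  shows "AE w in M. real_cond_exp M (vimage_algebra (space M) U N1) (\<lambda>w. f (U w) (V w)) w =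
           (\<integral>w'. f (U w) (V w') \<partial>M)"
proof -
  let ?F = "vimage_algebra (space M) U N1"
  interpret U: prob_space "distr M N1 U" by (rule prob_space_distr) simp
  interpret V: prob_space "distr M N2 V" by (rule prob_space_distr) simp
  interpret UV: pair_prob_space "distr M N1 U" "distr M N2 V" ..
  have subalg: "subalgebra M ?F" by (rule subalgebra_vimage_algebra[OF U])
  interpret finite_measure_subalgebra M ?F by unfold_locales (rule subalg)
  have inner: "(\<integral>w'. f u (V w') \<partial>M) = (\<integral>v. f u v \<partial>distr M N2 V)" if "u \<in> space N1" for u
    using that by (subst integral_distr) auto
  have "(\<lambda>u. \<integral>v. f u v \<partial>distr M N2 V) \<in> borel_measurable N1"
    by (rule V.borel_measurable_lebesgue_integral) simp
  then have "(\<lambda>w. \<integral>v. f (U w) v \<partial>distr M N2 V) \<in> borel_measurable ?F"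
    by (intro measurable_compose[OF measurable_vimage_algebra1]) (auto simp: measurable_space[OF U])
  then have measF: "(\<lambda>w. \<integral>w'. f (U w) (V w') \<partial>M) \<in> borel_measurable ?F"
    by (subst measurable_cong[where g = "\<lambda>w. \<integral>v. f (U w) v \<partial>distr M N2 V"])
       (auto intro!: inner simp: measurable_space[OF U])
  have B: "B \<ge> 0" using bound[of undefined undefined] by linarith
  show ?thesis
  proof (rule real_cond_exp_charact)
    show "integrable M (\<lambda>w. f (U w) (V w))"
      by (rule integrable_const_bound[of _ B]) (auto simp: bound)
    show "integrable M (\<lambda>w. \<integral>w'. f (U w) (V w') \<partial>M)"
    proof (rule integrable_const_bound[of _ B])
      show "AE w in M. norm (\<integral>w'. f (U w) (V w') \<partial>M) \<le> B"
      proof (rule AE_I2)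
        fix w assume [measurable]: "w \<in> space M"
        have "norm (\<integral>w'. f (U w) (V w') \<partial>M) \<le> (\<integral>w'. norm (f (U w) (V w')) \<partial>M)"
          by (rule integral_norm_bound)
        also have "\<dots> \<le> (\<integral>w'. B \<partial>M)"
          by (rule integral_mono) (auto intro!: integrable_const_bound[of _ B] simp: bound measurable_space[OF U])
        finally show "norm (\<integral>w'. f (U w) (V w') \<partial>M) \<le> B" by (simp add: prob_space)
      qed
      show "(\<lambda>w. \<integral>w'. f (U w) (V w') \<partial>M) \<in> borel_measurable M"
        by (rule measurable_from_subalg[OF subalg measF])
    qed
    show "(\<lambda>w. \<integral>w'. f (U w) (V w') \<partial>M) \<in> borel_measurable ?F" by (rule measF)
    fix A assume "A \<in> sets ?F"
    then obtain A' where A' [measurable]: "A' \<in> sets N1" and A: "A = U -` A' \<inter> space M"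
      by (auto simp: sets_vimage_algebra2 measurable_space[OF U])
    have "(\<integral>w\<in>A. f (U w) (V w) \<partial>M) = (\<integral>w. indicator A' (U w) * f (U w) (V w) \<partial>M)"
      unfolding set_lebesgue_integral_def A by (intro Bochner_Integration.integral_cong) (auto split: split_indicator)
    also have "\<dots> = (\<integral>(u, v). indicator A' u * f u v \<partial>distr M (N1 \<Otimes>\<^sub>M N2) (\<lambda>w. (U w, V w)))"
      by (subst integral_distr) auto
    also have "\<dots> = (\<integral>(u, v). indicator A' u * f u v \<partial>(distr M N1 U \<Otimes>\<^sub>M distr M N2 V))"
      unfolding distr_pair_indep[OF U V indep] ..
    also have "\<dots> = (\<integral>u. \<integral>v. indicator A' u * f u v \<partial>distr M N2 V \<partial>distr M N1 U)"
    proof (rule UV.integral_fst[symmetric])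
      show "integrable (distr M N1 U \<Otimes>\<^sub>M distr M N2 V) (\<lambda>(u, v). indicator A' u * f u v)"
        using B bound
        by (intro UV.integrable_const_bound[of _ B]) (auto intro!: AE_I2 simp: indicator_def)
    qed
    also have "\<dots> = (\<integral>w. \<integral>v. indicator A' (U w) * f (U w) v \<partial>distr M N2 V \<partial>M)"
      by (subst integral_distr) auto
    also have "\<dots> = (\<integral>w\<in>A. (\<integral>w'. f (U w) (V w') \<partial>M) \<partial>M)"
      unfolding set_lebesgue_integral_def A
      by (intro Bochner_Integration.integral_cong) (auto split: split_indicator simp: inner measurable_space[OF U])
    finally show "(\<integral>w\<in>A. f (U w) (V w) \<partial>M) = (\<integral>w\<in>A. (\<integral>w'. f (U w) (V w') \<partial>M) \<partial>M)" .
  qed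
qed

text \<open>The substitution x = exp (- s) carries the half line to (0,1]. Since
  \<open>\<psi>\<close> vanishes for large s, the transported function extends by 0 to x = 0 and
  Weierstrass applies; monomials in x become exponentials in s.\<close>

lemma exponential_approximation:
  fixes \<psi> :: "real \<Rightarrow> real"
  assumes cont: "continuous_on UNIV \<psi>" and supp: "\<And>s. s \<ge> R \<Longrightarrow> \<psi> s = 0" and e: "e > 0"
  obtains c :: "nat \<Rightarrow> real" and N :: nat
  where "\<And>s. s \<ge> 0 \<Longrightarrow> \<bar>\<psi> s - (\<Sum>k\<le>N. c k * exp (- real k * s))\<bar> < e"
proof -
  define G where "G x = (if x \<le> 0 then 0 else \<psi> (- ln x))" for x :: real
  \<comment> \<open>For x between 0 and \<open>a\<close>, - ln x is at least \<bar>R\<bar> + 1, so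
    \<open>G\<close> is 0 on [0,a] and continuity is glued from two closed intervals.\<close>
  define a where "a = exp (- \<bar>R\<bar> - 1)"
  have a: "0 < a" "a \<le> 1" by (simp_all add: a_def)
  have "continuous_on {0..1} G"
  proof -
    have "continuous_on {a..1} (\<lambda>x. \<psi> (- ln x))"
      using a by (intro continuous_on_compose2[OF cont] continuous_intros) auto
    moreover have "G x = \<psi> (- ln x)" if "x \<in> {a..1}" for x using that a by (simp add: G_def)
    ultimately have "continuous_on {a..1} G" by (metis (no_types, lifting) continuous_on_cong)
    moreover have "G x = 0" if x: "x \<in> {0..a}" for x
    proof (cases "x > 0")
      case True
      then have "ln x \<le> ln a" using x by simp
      then have "R \<le> - ln x" by (simp add: a_def)
      then show ?thesis using supp by (simp add: G_def)
    qed (simp add: G_def)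
    then have "continuous_on {0..a} G" by (metis (no_types, lifting) continuous_on_cong continuous_on_const)
    moreover have "{0..1} = {0..a} \<union> {a..1}" using a by auto
    ultimately show ?thesis by (metis closed_atLeastAtMost continuous_on_closed_Un)
  qed
  then obtain p where p: "real_polynomial_function p" "\<And>x. x \<in> {0..1} \<Longrightarrow> \<bar>G x - p x\<bar> < e"
    using Stone_Weierstrass_real_polynomial_function[of "{0..1}" G e] e by auto
  then obtain c N where c: "p = (\<lambda>x. \<Sum>k\<le>N. c k * x ^ k)" using real_polynomial_function_iff_sum by blast
  have "\<bar>\<psi> s - (\<Sum>k\<le>N. c k * exp (- real k * s))\<bar> < e" if "s \<ge> 0" for s
    using p(2)[of "exp (- s)"] that by (simp add: G_def c exp_of_nat_mult[symmetric])
  then show ?thesis using that by blast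
qed

text \<open>In \<open>S n w w'\<close> the point \<open>w\<close> carries the data and
  \<open>w'\<close> the multipliers, so the law of \<open>S n w\<close> is a random law, while that
  of \<open>S'\<close> is fixed. \<open>S'\<close> is nonnegative only almost everywhere because a
  divergent series has an unspecified sum.\<close>

locale random_limit = prob_space M for M :: "'a measure" +
  fixes S :: "nat \<Rightarrow> 'a \<Rightarrow> 'a \<Rightarrow> real" and S' :: "'a \<Rightarrow> real"
  assumes S_meas [measurable]: "\<And>n. case_prod (S n) \<in> borel_measurable (M \<Otimes>\<^sub>M M)"
    and S'_meas [measurable]: "S' \<in> borel_measurable M"
    and S_nonneg: "\<And>n w w'. S n w w' \<ge> 0" and S'_nonneg: "AE w in M. S' w \<ge> 0"
    and laplace: "\<And>k::nat. tends_in_prob M (\<lambda>n w. \<integral>w'. exp (- real k * S n w w') \<partial>M) (\<integral>w'. exp (- real k * S' w') \<partial>M)"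
begin

lemma integral_measurable [measurable]:
  "\<phi> \<in> borel_measurable borel \<Longrightarrow> (\<lambda>w. \<integral>w'. \<phi> (S n w w') \<partial>M) \<in> borel_measurable M"
  for \<phi> :: "real \<Rightarrow> real"
  by (rule borel_measurable_lebesgue_integral) (simp add: split_beta')

lemma S_slice [measurable]: "w \<in> space M \<Longrightarrow> S n w \<in> borel_measurable M"
  using measurable_compose[OF measurable_Pair1' S_meas, of w n] by simp

lemma compact_support:
  fixes \<psi> :: "real \<Rightarrow> real"
  assumes cont: "continuous_on UNIV \<psi>" and bound: "\<And>s. \<bar>\<psi> s\<bar> \<le> B" and supp: "\<And>s. s \<ge> R \<Longrightarrow> \<psi> s = 0"
  shows "tends_in_prob M (\<lambda>n w. \<integral>w'. \<psi> (S n w w') \<partial>M) (\<integral>w'. \<psi> (S' w') \<partial>M)"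
proof (rule tends_in_probI)
  fix e :: real assume e: "e > 0"
  obtain c :: "nat \<Rightarrow> real" and N :: nat
    where c: "\<And>s. s \<ge> 0 \<Longrightarrow> \<bar>\<psi> s - (\<Sum>k\<le>N. c k * exp (- real k * s))\<bar> < e / 2"
    using exponential_approximation[of \<psi> R "e / 2"] cont supp e by (metis half_gt_zero)
  have [measurable]: "\<psi> \<in> borel_measurable borel" by (rule borel_measurable_continuous_onI[OF cont])
  define A where "A n w = (\<Sum>k\<le>N. c k * ((\<integral>w'. exp (- real k * S n w w') \<partial>M) - (\<integral>w'. exp (- real k * S' w') \<partial>M)))" for n w
  \<comment> \<open>Applied both to \<open>S n w\<close> and to \<open>S'\<close>: two approximation
    errors of e / 2 leave only the difference \<open>A n w\<close> of the Laplace
    transforms.\<close>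
  have approx: "\<bar>(\<integral>w. \<psi> (X w) \<partial>M) - (\<Sum>k\<le>N. c k * (\<integral>w. exp (- real k * X w) \<partial>M))\<bar> \<le> e / 2"
    if [measurable]: "X \<in> borel_measurable M" and X: "AE w in M. X w \<ge> 0" for X
  proof -
    have int: "integrable M (\<lambda>w. \<psi> (X w))" "integrable M (\<lambda>w. c k * exp (- real k * X w))" for k
    proof -
      show "integrable M (\<lambda>w. \<psi> (X w))" using bound by (intro integrable_const_bound[of _ B]) auto
      have "integrable M (\<lambda>w. exp (- real k * X w))"
        using X by (intro integrable_const_bound[of _ 1]) (auto elim!: eventually_mono)
      then show "integrable M (\<lambda>w. c k * exp (- real k * X w))" by (rule integrable_mult_right)
    qed
    have "(\<integral>w. \<psi> (X w) \<partial>M) - (\<Sum>k\<le>N. c k * (\<integral>w. exp (- real k * X w) \<partial>M)) =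
        (\<integral>w. \<psi> (X w) - (\<Sum>k\<le>N. c k * exp (- real k * X w)) \<partial>M)"
    proof (subst Bochner_Integration.integral_diff)
      show "integrable M (\<lambda>w. \<Sum>k\<le>N. c k * exp (- real k * X w))"
        by (rule Bochner_Integration.integrable_sum) (rule int)
      have "(\<integral>w. (\<Sum>k\<le>N. c k * exp (- real k * X w)) \<partial>M) = (\<Sum>k\<le>N. \<integral>w. c k * exp (- real k * X w) \<partial>M)"
        by (rule Bochner_Integration.integral_sum) (rule int)
      then show "(\<integral>w. \<psi> (X w) \<partial>M) - (\<Sum>k\<le>N. c k * (\<integral>w. exp (- real k * X w) \<partial>M)) =
          (\<integral>w. \<psi> (X w) \<partial>M) - (\<integral>w. (\<Sum>k\<le>N. c k * exp (- real k * X w)) \<partial>M)"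
        by simp
    qed (rule int)
    also have "\<bar>\<dots>\<bar> \<le> (\<integral>w. \<bar>\<psi> (X w) - (\<Sum>k\<le>N. c k * exp (- real k * X w))\<bar> \<partial>M)"
      by (rule integral_abs_bound)
    also have "\<dots> \<le> (\<integral>w. e / 2 \<partial>M)"
    proof (rule integral_mono_AE)
      show "AE w in M. \<bar>\<psi> (X w) - (\<Sum>k\<le>N. c k * exp (- real k * X w))\<bar> \<le> e / 2"
        using X by eventually_elim (rule less_imp_le[OF c])
      show "integrable M (\<lambda>w. \<bar>\<psi> (X w) - (\<Sum>k\<le>N. c k * exp (- real k * X w))\<bar>)"
        by (intro Bochner_Integration.integrable_abs Bochner_Integration.integrable_diff
            Bochner_Integration.integrable_sum int)
    qed simp
    finally show ?thesis by (simp add: prob_space)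
  qed
  have "\<bar>(\<integral>w'. \<psi> (S n w w') \<partial>M) - (\<integral>w'. \<psi> (S' w') \<partial>M)\<bar> \<le> \<bar>A n w\<bar> + e" if "w \<in> space M" for n w
  proof -
    have "A n w = (\<Sum>k\<le>N. c k * (\<integral>w'. exp (- real k * S n w w') \<partial>M)) - (\<Sum>k\<le>N. c k * (\<integral>w'. exp (- real k * S' w') \<partial>M))"
      by (simp add: A_def right_diff_distrib sum_subtractf)
    moreover have "AE w' in M. S n w w' \<ge> 0" using S_nonneg by simp
    note approx[OF S_slice[OF that, of n] this] approx[OF S'_meas S'_nonneg]
    ultimately show ?thesis by linarith
  qed
  moreover have "tends_in_prob M A 0"
    unfolding A_def by (intro tends_in_prob_sum tends_in_prob_cmult laplace) auto
  moreover have "A n \<in> borel_measurable M" for n unfolding A_def by measurable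
  ultimately show "nearly_bounded M (\<lambda>n w. (\<integral>w'. \<psi> (S n w w') \<partial>M) - (\<integral>w'. \<psi> (S' w') \<partial>M)) e"
    by (intro nearly_boundedI[of A M "\<lambda>_ _. e"]) (simp_all add: emeasure_space_1)
qed

text \<open>No separate tightness is needed: the mass of \<open>S n w\<close> beyond a cut-off is
  measured by the integral of the cut-off function, itself compactly supported on the right, so it
  converges to the mass of the limit.\<close>

theorem bounded_continuous:
  fixes h :: "real \<Rightarrow> real"
  assumes cont: "continuous_on UNIV h" and bound: "\<And>s. \<bar>h s\<bar> \<le> B"
  shows "tends_in_prob M (\<lambda>n w. \<integral>w'. h (S n w w') \<partial>M) (\<integral>w'. h (S' w') \<partial>M)"
proof (rule tends_in_probI)
  fix e :: real assume e: "e > 0"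
  have B: "B \<ge> 0" using bound[of 0] by linarith
  define cut where "cut R s = max 0 (min 1 (R + 1 - s))" for R s :: real
  have cut_bounds: "0 \<le> cut R s" "cut R s \<le> 1" for R s by (auto simp: cut_def)
  have cut_cont: "continuous_on UNIV (cut R)" for R unfolding cut_def by (intro continuous_intros)
  have [measurable]: "h \<in> borel_measurable borel" "cut R \<in> borel_measurable borel" for R
    by (intro borel_measurable_continuous_onI cont cut_cont)+
  have hcut: "\<bar>h s * cut R s\<bar> \<le> B" for R s
    using bound[of s] cut_bounds[of R s] mult_mono[of "\<bar>h s\<bar>" B "cut R s" 1] B by (simp add: abs_mult)
  have int_cut: "integrable M (\<lambda>w. cut R (X w))" if [measurable]: "X \<in> borel_measurable M" for X R
    using cut_bounds by (intro integrable_const_bound[of _ 1]) auto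
  have "(\<lambda>n. \<integral>w. cut (real n) (S' w) \<partial>M) \<longlonglongrightarrow> (\<integral>w. 1 \<partial>M)"
  proof (rule integral_dominated_convergence[where w = "\<lambda>_. 1"])
    show "AE w in M. (\<lambda>n. cut (real n) (S' w)) \<longlonglongrightarrow> 1"
    proof (rule AE_I2)
      fix w
      obtain N where N: "S' w \<le> real N" using real_arch_simple by blast
      show "(\<lambda>n. cut (real n) (S' w)) \<longlonglongrightarrow> 1"
      proof (rule tendsto_eventually, rule eventually_sequentiallyI[of N])
        fix n assume "N \<le> n"
        then have "S' w \<le> real n" using N by (meson of_nat_mono order_trans)
        then show "cut (real n) (S' w) = 1" by (auto simp: cut_def)
      qed
    qed
  qed (use cut_bounds in auto)
  then have "(\<lambda>n. \<integral>w. cut (real n) (S' w) \<partial>M) \<longlonglongrightarrow> 1" by (simp add: prob_space)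
  \<comment> \<open>The two tails, of \<open>S n w\<close> and of \<open>S'\<close>, cost
    \<open>2 * B * (1 - m)\<close> besides terms that vanish in probability; this level makes it at
    most \<open>e\<close>. The denominator has \<open>B + 1\<close> because \<open>B\<close> may be
    0.\<close>
  then have "\<forall>\<^sub>F n in sequentially. (\<integral>w. cut (real n) (S' w) \<partial>M) > 1 - e / (2 * (B + 1))"
    using e B by (intro order_tendstoD(1)) auto
  then obtain R where R: "(\<integral>w. cut R (S' w) \<partial>M) > 1 - e / (2 * (B + 1))"
    by (auto simp: eventually_sequentially)
  define m where "m = (\<integral>w. cut R (S' w) \<partial>M)"
  have "2 * B * (1 - m) \<le> 2 * B * (e / (2 * (B + 1)))"
    using R B by (intro mult_left_mono) (auto simp: m_def)
  also have "\<dots> \<le> e" using B e by (simp add: field_simps)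
  finally have m: "2 * B * (1 - m) \<le> e" .
  define A1 where "A1 n w = (\<integral>w'. h (S n w w') * cut R (S n w w') \<partial>M) - (\<integral>w'. h (S' w') * cut R (S' w') \<partial>M)" for n w
  define A2 where "A2 n w = (\<integral>w'. cut R (S n w w') \<partial>M) - m" for n w
  define A where "A n w = \<bar>A1 n w\<bar> + B * \<bar>A2 n w\<bar>" for n w
  have A_meas [measurable]: "A1 n \<in> borel_measurable M" "A2 n \<in> borel_measurable M" for n
    unfolding A1_def A2_def by measurable
  have tail: "\<bar>(\<integral>w. h (X w) \<partial>M) - (\<integral>w. h (X w) * cut R (X w) \<partial>M)\<bar> \<le> B * (1 - (\<integral>w. cut R (X w) \<partial>M))"
    if [measurable]: "X \<in> borel_measurable M" for X
  proof -
    have int: "integrable M (\<lambda>w. h (X w))" "integrable M (\<lambda>w. h (X w) * cut R (X w))"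
      using bound hcut by (auto intro!: integrable_const_bound[of _ B] AE_I2)
    have "(\<integral>w. h (X w) \<partial>M) - (\<integral>w. h (X w) * cut R (X w) \<partial>M) = (\<integral>w. h (X w) * (1 - cut R (X w)) \<partial>M)"
      using int by (subst Bochner_Integration.integral_diff[symmetric]) (auto simp: algebra_simps)
    also have "\<bar>\<dots>\<bar> \<le> (\<integral>w. \<bar>h (X w) * (1 - cut R (X w))\<bar> \<partial>M)" by (rule integral_abs_bound)
    also have "\<dots> \<le> (\<integral>w. B * (1 - cut R (X w)) \<partial>M)"
    proof (rule integral_mono)
      show "\<bar>h (X w) * (1 - cut R (X w))\<bar> \<le> B * (1 - cut R (X w))" for w
        using bound[of "X w"] cut_bounds[of R "X w"] by (simp add: abs_mult mult_right_mono)
    qed (use int int_cut[of X R] in \<open>simp_all add: right_diff_distrib\<close>)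
    also have "\<dots> = B * (1 - (\<integral>w. cut R (X w) \<partial>M))"
      using int_cut[of X R] by (simp add: prob_space)
    finally show ?thesis .
  qed
  have "\<bar>(\<integral>w'. h (S n w w') \<partial>M) - (\<integral>w'. h (S' w') \<partial>M)\<bar> \<le> \<bar>A n w\<bar> + e" if "w \<in> space M" for n w
  proof -
    have "B * (1 - (\<integral>w'. cut R (S n w w') \<partial>M)) \<le> B * (1 - m) + B * \<bar>A2 n w\<bar>"
      unfolding distrib_left[symmetric] using B by (intro mult_left_mono) (auto simp: A2_def)
    moreover have "\<bar>A n w\<bar> = \<bar>A1 n w\<bar> + B * \<bar>A2 n w\<bar>" using B by (simp add: A_def)
    ultimately show ?thesis
      using tail[OF S_slice[OF that, of n]] tail[OF S'_meas] m unfolding A1_def m_def[symmetric] by argo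
  qed
  moreover have "tends_in_prob M A 0"
  proof (rule tends_in_prob_dominated)
    have supp: "cut R s = 0" if "s \<ge> R + 1" for s using that by (simp add: cut_def)
    have t1: "tends_in_prob M A1 0"
      unfolding A1_def
    proof (rule tends_in_prob_cmult[where b = 1, simplified])
      show "tends_in_prob M (\<lambda>n w. \<integral>w'. h (S n w w') * cut R (S n w w') \<partial>M) (\<integral>w'. h (S' w') * cut R (S' w') \<partial>M)"
      proof (rule compact_support)
        show "\<bar>h s * cut R s\<bar> \<le> B" for s by (rule hcut)
      qed (use supp in \<open>auto intro!: continuous_on_mult cont cut_cont\<close>)
    qed
    have t2: "tends_in_prob M (\<lambda>n w. B * A2 n w) 0"
      unfolding A2_def m_def
      by (rule tends_in_prob_cmult, rule compact_support[OF cut_cont, of _ 1 "R + 1"]) (use cut_bounds supp in auto)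
    have abs: "tends_in_prob M (\<lambda>n w. \<bar>U n w\<bar>) 0" if "tends_in_prob M U 0" for U
      using that by (simp add: tends_in_prob_def)
    show "tends_in_prob M (\<lambda>n w. \<bar>A1 n w\<bar> + \<bar>B * A2 n w\<bar>) 0"
      by (intro tends_in_prob_add abs t1 t2) measurable
  qed (use B in \<open>auto simp: A_def abs_mult\<close>)
  moreover have "A n \<in> borel_measurable M" for n unfolding A_def by measurable
  ultimately show "nearly_bounded M (\<lambda>n w. (\<integral>w'. h (S n w w') \<partial>M) - (\<integral>w'. h (S' w') \<partial>M)) e"
    by (intro nearly_boundedI[of A M "\<lambda>_ _. e"]) (simp_all add: emeasure_space_1)
qed

end

section \<open>Products of characteristic functions\<close>

text \<open>Complex logarithms are avoided by comparison with exp (- m / n), whose n-th power is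
  exactly exp (- m): in the unit disc the n-th powers differ by at most n times the difference of
  the bases, and that product vanishes by the hypothesis.\<close>

lemma power_tendsto_exp:
  fixes z :: "nat \<Rightarrow> complex" and m :: real
  assumes z: "\<And>n. norm (z n) \<le> 1" and m: "m \<ge> 0" and lim: "(\<lambda>n. of_nat n * (1 - z n)) \<longlonglongrightarrow> of_real m"
  shows "(\<lambda>n. z n ^ n) \<longlonglongrightarrow> of_real (exp (- m))"
proof -
  define w where "w n = complex_of_real (exp (- m / real n))" for n
  have w: "norm (w n) \<le> 1" for n using m by (simp add: w_def)
  have "(\<lambda>n. real n * (1 - exp (- m / real n))) \<longlonglongrightarrow> m" by real_asymp
  then have "(\<lambda>n. complex_of_real (real n * (1 - exp (- m / real n)))) \<longlonglongrightarrow> of_real m" by (rule tendsto_of_real)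
  then have "(\<lambda>n. of_nat n * (1 - w n) - of_nat n * (1 - z n)) \<longlonglongrightarrow> of_real m - of_real m"
    using lim by (intro tendsto_diff) (simp_all add: w_def)
  then have "(\<lambda>n. norm (of_nat n * (1 - w n) - of_nat n * (1 - z n))) \<longlonglongrightarrow> 0"
    by (simp add: tendsto_norm_zero)
  moreover have "norm (z n ^ n - w n ^ n) \<le> norm (of_nat n * (1 - w n) - of_nat n * (1 - z n))" for n
  proof -
    have "norm (z n ^ n - w n ^ n) \<le> real n * norm (z n - w n)" by (rule norm_power_diff[OF z w])
    also have "\<dots> = norm (of_nat n * (z n - w n))" by (simp add: norm_mult)
    also have "of_nat n * (z n - w n) = of_nat n * (1 - w n) - of_nat n * (1 - z n)" by (simp add: algebra_simps)
    finally show ?thesis .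
  qed
  ultimately have "(\<lambda>n. norm (z n ^ n - w n ^ n)) \<longlonglongrightarrow> 0" by (rule real_squeeze_0) simp
  then have diff: "(\<lambda>n. z n ^ n - w n ^ n) \<longlonglongrightarrow> 0" by (rule tendsto_norm_zero_cancel)
  have "(\<lambda>n. w n ^ n) \<longlonglongrightarrow> of_real (exp (- m))"
  proof (rule tendsto_eventually, rule eventually_sequentiallyI[of 1])
    fix n :: nat assume "1 \<le> n"
    then have "exp (- m / real n) ^ n = exp (- m)" by (simp add: exp_of_nat_mult[symmetric])
    then show "w n ^ n = of_real (exp (- m))" by (simp add: w_def flip: of_real_power)
  qed
  from tendsto_add[OF diff this] show ?thesis by simp
qed

locale standardized_distribution = real_distribution \<mu> for \<mu> :: "real measure" +
  assumes integrable_id: "integrable \<mu> (\<lambda>x. x)" and mean: "(\<integral>x. x \<partial>\<mu>) = 0"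
    and integrable_sq: "integrable \<mu> (\<lambda>x. x^2)" and second_moment: "(\<integral>x. x^2 \<partial>\<mu>) = 1"
begin

text \<open>The minimum in the remainder makes two moments enough: it is dominated by 6 * x^2 and
  tends to 0 pointwise with t.\<close>

lemma char_expansion:
  "cmod (char \<mu> t - (1 - t^2 / 2)) \<le> t^2 / 6 * (\<integral>x. min (6 * x^2) (\<bar>t\<bar> * \<bar>x\<bar> ^ 3) \<partial>\<mu>)"
proof -
  have "variance (\<lambda>x. x) = 1" using second_moment by (simp add: mean)
  from char_approx3[OF integrable_id mean integrable_sq this, of t] show ?thesis by simp
qed

text \<open>3 / 2 = 1 + 1 / 2: the remainder contributes at most t^2 and the quadratic term t^2 / 2.
  This is the dominating bound for the limits below.\<close>

lemma char_quadratic_bound: "cmod (1 - char \<mu> t) \<le> 3 / 2 * t^2"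
proof -
  have "(\<integral>x. min (6 * x^2) (\<bar>t\<bar> * \<bar>x\<bar> ^ 3) \<partial>\<mu>) \<le> (\<integral>x. 6 * x^2 \<partial>\<mu>)"
    using integrable_sq
    by (intro integral_mono Bochner_Integration.integrable_bound[OF integrable_mult_right[OF integrable_sq, of 6]]) auto
  then have "t^2 / 6 * (\<integral>x. min (6 * x^2) (\<bar>t\<bar> * \<bar>x\<bar> ^ 3) \<partial>\<mu>) \<le> t^2 / 6 * 6"
    using second_moment by (intro mult_left_mono) auto
  then have "cmod (char \<mu> t - (1 - t^2 / 2)) \<le> t^2" using char_expansion[of t] by simp
  moreover have "cmod (1 - char \<mu> t) \<le> cmod (char \<mu> t - (1 - t^2 / 2)) + cmod (of_real (t^2 / 2))"
    using norm_triangle_ineq4[of "of_real (t^2 / 2)" "char \<mu> t - (1 - t^2 / 2)"] by simp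
  ultimately show ?thesis by (simp add: norm_power norm_divide)
qed

lemma char_quadratic_limit: "(\<lambda>n. of_nat n * (1 - char \<mu> (c / sqrt (real n)))) \<longlonglongrightarrow> of_real (c^2 / 2)"
proof -
  let ?I = "\<lambda>n. \<integral>x. min (6 * x^2) (\<bar>c / sqrt (real n)\<bar> * \<bar>x\<bar> ^ 3) \<partial>\<mu>"
  have "(\<lambda>n. min (6 * x^2) (\<bar>c / sqrt (real n)\<bar> * \<bar>x\<bar> ^ 3)) \<longlonglongrightarrow> 0" for x
  proof (rule real_squeeze_0)
    have "(\<lambda>n. \<bar>c\<bar> / sqrt (real n)) \<longlonglongrightarrow> 0" by real_asymp
    then show "(\<lambda>n. \<bar>c\<bar> / sqrt (real n) * \<bar>x\<bar> ^ 3) \<longlonglongrightarrow> 0" by (intro tendsto_mult_left_zero)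
  qed auto
  then have "?I \<longlonglongrightarrow> (\<integral>x. 0 \<partial>\<mu>)"
    using integrable_sq by (intro integral_dominated_convergence[where w = "\<lambda>x. 6 * x^2"]) auto
  then have I: "(\<lambda>n. c^2 / 6 * ?I n) \<longlonglongrightarrow> 0" by (simp add: tendsto_mult_right_zero)
  have "cmod (of_nat n * (1 - char \<mu> (c / sqrt (real n))) - of_real (c^2 / 2)) \<le> c^2 / 6 * ?I n" if n: "n \<ge> 1" for n
  proof -
    let ?t = "c / sqrt (real n)"
    have t: "real n * ?t^2 = c^2" using n by (simp add: power_divide)
    then have t': "of_nat n * complex_of_real (?t^2) = of_real (c^2)" by (metis of_real_mult of_real_of_nat_eq)
    have "of_nat n * (1 - char \<mu> ?t) - of_real (c^2 / 2) = - (of_nat n * (char \<mu> ?t - (1 - ?t^2 / 2)))"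
      using t' by (simp add: algebra_simps)
    then have "cmod (of_nat n * (1 - char \<mu> ?t) - of_real (c^2 / 2)) = real n * cmod (char \<mu> ?t - (1 - ?t^2 / 2))"
      by (simp only: norm_minus_cancel norm_mult norm_of_nat)
    also have "\<dots> \<le> real n * (?t^2 / 6 * ?I n)" by (intro mult_left_mono char_expansion) auto
    also have "\<dots> = (real n * ?t^2) / 6 * ?I n" by simp
    finally show ?thesis unfolding t .
  qed
  then have "(\<lambda>n. of_nat n * (1 - char \<mu> (c / sqrt (real n))) - of_real (c^2 / 2)) \<longlonglongrightarrow> 0"
    by (intro Lim_null_comparison[OF eventually_sequentiallyI[of 1] I])
  then show ?thesis by (rule LIM_zero_cancel)
qed

lemma char_scaled_bound: "cmod (of_nat n * (1 - char \<mu> (c / sqrt (real n)))) \<le> 3 / 2 * c^2"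
proof (cases "n = 0")
  case False
  have "cmod (of_nat n * (1 - char \<mu> (c / sqrt (real n)))) \<le> real n * (3 / 2 * (c / sqrt (real n))^2)"
    unfolding norm_mult norm_of_nat by (intro mult_left_mono char_quadratic_bound) auto
  also have "\<dots> = 3 / 2 * c^2" using False by (simp add: power_divide)
  finally show ?thesis .
qed simp

lemma expectation_char_limit:
  assumes "c \<in> borel_measurable P" and sq: "integrable P (\<lambda>x. (c x)^2)"
  shows "(\<lambda>n. \<integral>x. of_nat n * (1 - char \<mu> (c x / sqrt (real n))) \<partial>P) \<longlonglongrightarrow> of_real ((\<integral>x. (c x)^2 \<partial>P) / 2)"
proof -
  have [measurable]: "c \<in> borel_measurable P" by fact
  have "(\<lambda>n. \<integral>x. of_nat n * (1 - char \<mu> (c x / sqrt (real n))) \<partial>P) \<longlonglongrightarrow> (\<integral>x. complex_of_real ((c x)^2 / 2) \<partial>P)"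
    using sq char_quadratic_limit char_scaled_bound
    by (intro integral_dominated_convergence[where w = "\<lambda>x. 3 / 2 * (c x)^2"]) auto
  also have "(\<integral>x. complex_of_real ((c x)^2 / 2) \<partial>P) = of_real (\<integral>x. (c x)^2 / 2 \<partial>P)"
    by (rule integral_complex_of_real)
  also have "(\<integral>x. (c x)^2 / 2 \<partial>P) = (\<integral>x. (c x)^2 \<partial>P) / 2" by (rule integral_divide_zero)
  finally show ?thesis .
qed

text \<open>Second-moment counterpart of the previous limit; doubling the real part turns the limit
  c^2 / 2 into c^2, which later makes the second moment converge to the square of the limiting
  mean.\<close>

lemma expectation_norm_char_limit:
  assumes "c \<in> borel_measurable P" and sq: "integrable P (\<lambda>x. (c x)^2)"
  shows "(\<lambda>n. \<integral>x. real n * (1 - (cmod (char \<mu> (c x / sqrt (real n))))^2) \<partial>P) \<longlonglongrightarrow> (\<integral>x. (c x)^2 \<partial>P)"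
proof (rule integral_dominated_convergence[where w = "\<lambda>x. 3 * (c x)^2"])
  have [measurable]: "c \<in> borel_measurable P" by fact
  show "(\<lambda>x. (c x)^2) \<in> borel_measurable P" by measurable
  show "(\<lambda>x. real n * (1 - (cmod (char \<mu> (c x / sqrt (real n))))^2)) \<in> borel_measurable P" for n by measurable
  show "integrable P (\<lambda>x. 3 * (c x)^2)" using sq by simp
  show "AE x in P. (\<lambda>n. real n * (1 - (cmod (char \<mu> (c x / sqrt (real n))))^2)) \<longlonglongrightarrow> (c x)^2"
  proof (rule AE_I2)
    fix x
    let ?z = "\<lambda>n. char \<mu> (c x / sqrt (real n))"
    \<comment> \<open>After multiplication by n the quadratic correction is a convergent factor
      times \<open>cmod (1 - ?z n)\<close>, which tends to 0.\<close>
    have eq: "real n * (1 - (cmod (?z n))^2) = 2 * Re (of_nat n * (1 - ?z n)) - cmod (of_nat n * (1 - ?z n)) * cmod (1 - ?z n)" for n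
    proof -
      have "1 - (cmod (?z n))^2 = 2 * Re (1 - ?z n) - (cmod (1 - ?z n))^2"
        unfolding cmod_power2 by (simp add: power2_eq_square algebra_simps)
      then have "real n * (1 - (cmod (?z n))^2) = real n * (2 * Re (1 - ?z n) - (cmod (1 - ?z n))^2)" by (rule arg_cong)
      moreover have "cmod (of_nat n * (1 - ?z n)) = real n * cmod (1 - ?z n)" by (simp only: norm_mult norm_of_nat)
      moreover have "Re (of_nat n * (1 - ?z n)) = real n * Re (1 - ?z n)" by simp
      ultimately show ?thesis by (simp only:) (simp add: power2_eq_square algebra_simps)
    qed
    have lim0: "(\<lambda>n. 1 - ?z n) \<longlonglongrightarrow> 0"
    proof (rule Lim_null_comparison[of _ "\<lambda>n. 3 / 2 * (c x / sqrt (real n))^2"])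
      have "(\<lambda>n. a / sqrt (real n)) \<longlonglongrightarrow> 0" for a :: real by real_asymp
      from tendsto_power[OF this, of _ 2] show "(\<lambda>n. 3 / 2 * (c x / sqrt (real n))^2) \<longlonglongrightarrow> 0"
        by (intro tendsto_mult_right_zero) simp
      show "\<forall>\<^sub>F n in sequentially. norm (1 - ?z n) \<le> 3 / 2 * (c x / sqrt (real n))^2"
        by (intro always_eventually allI char_quadratic_bound)
    qed
    have "(\<lambda>n. 2 * Re (of_nat n * (1 - ?z n)) - cmod (of_nat n * (1 - ?z n)) * cmod (1 - ?z n))
        \<longlonglongrightarrow> 2 * Re (of_real ((c x)^2 / 2)) - cmod (of_real ((c x)^2 / 2)) * cmod 0"
      by (rule tendsto_diff[OF tendsto_mult[OF tendsto_const tendsto_Re[OF char_quadratic_limit]]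
          tendsto_mult[OF tendsto_norm[OF char_quadratic_limit] tendsto_norm[OF lim0]]])
    then show "(\<lambda>n. real n * (1 - (cmod (?z n))^2)) \<longlonglongrightarrow> (c x)^2" unfolding eq by simp
  qed
  \<comment> \<open>The constant 3 arises from 1 - \<bar>z\<bar>^2 \<le> 2 * \<bar>1 - z\<bar> on
    the unit disc, combined with the bound 3 / 2.\<close>
  show "AE x in P. norm (real n * (1 - (cmod (char \<mu> (c x / sqrt (real n))))^2)) \<le> 3 * (c x)^2" for n
  proof (rule AE_I2)
    fix x
    let ?z = "char \<mu> (c x / sqrt (real n))"
    have z1: "cmod ?z \<le> 1" by (rule cmod_char_le_1)
    have "1 - cmod ?z \<le> cmod (1 - ?z)" using norm_triangle_ineq2[of 1 ?z] by simp
    then have "(1 - cmod ?z) * (1 + cmod ?z) \<le> cmod (1 - ?z) * 2"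
      using z1 by (intro mult_mono) auto
    then have "1 - (cmod ?z)^2 \<le> 2 * cmod (1 - ?z)" by (simp add: power2_eq_square algebra_simps)
    then have "real n * (1 - (cmod ?z)^2) \<le> real n * (2 * cmod (1 - ?z))" by (intro mult_left_mono) auto
    also have "\<dots> = 2 * cmod (of_nat n * (1 - ?z))" by (simp add: norm_mult)
    also have "\<dots> \<le> 3 * (c x)^2" using char_scaled_bound[of n "c x"] by simp
    finally have "real n * (1 - (cmod ?z)^2) \<le> 3 * (c x)^2" .
    moreover have "0 \<le> real n * (1 - (cmod ?z)^2)" using z1 by (simp add: power_le_one)
    ultimately show "norm (real n * (1 - (cmod ?z)^2)) \<le> 3 * (c x)^2" by simp
  qed
qed

text \<open>The limit is proved by computing first and second moments, which factorise over the sample;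
  no law of large numbers for the squares is needed.\<close>

lemma char_product_limit:
  fixes D :: "nat \<Rightarrow> 'a \<Rightarrow> 'e::{second_countable_topology, topological_space}"
  assumes M: "prob_space M" and indep: "prob_space.indep_vars M (\<lambda>_. borel) D UNIV"
    and law: "\<And>i. distr M borel (D i) = P"
    and c [measurable]: "c \<in> borel_measurable borel" and sq: "integrable P (\<lambda>x. (c x)^2)"
  shows "(\<lambda>n. \<integral>w. cmod ((\<Prod>j<n. char \<mu> (c (D j w) / sqrt (real n))) - of_real (exp (- (\<integral>x. (c x)^2 \<partial>P) / 2))) \<partial>M) \<longlonglongrightarrow> 0"
proof -
  interpret M: prob_space M by fact
  have D [measurable]: "D i \<in> borel_measurable M" for i using indep unfolding M.indep_vars_def by simp
  interpret P: prob_space P unfolding law[of 0, symmetric] by (rule M.prob_space_distr) simp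
  have sets_P [measurable_cong]: "sets P = sets borel" unfolding law[of 0, symmetric] by simp
  have c_P [measurable]: "c \<in> borel_measurable P" by simp
  define m where "m = (\<integral>x. (c x)^2 \<partial>P)"
  have m: "m \<ge> 0" by (simp add: m_def)
  define z where "z n x = char \<mu> (c x / sqrt (real n))" for n x
  have [measurable]: "z n \<in> borel_measurable borel" for n unfolding z_def by measurable
  have z1: "cmod (z n x) \<le> 1" for n x unfolding z_def by (rule cmod_char_le_1)
  have int_P: "integrable P (z n)" "integrable P (\<lambda>x. (cmod (z n x))^2)" for n
    using z1 by (auto intro!: P.integrable_const_bound[of _ 1] simp: power_le_one)
  define p where "p n w = (\<Prod>j<n. z n (D j w))" for n w
  have [measurable]: "p n \<in> borel_measurable M" for n unfolding p_def by measurable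
  have p1: "cmod (p n w) \<le> 1" for n w unfolding p_def prod_norm[symmetric] using z1 by (intro prod_le_1) auto
  \<comment> \<open>Used twice: for the complex factors, giving the mean of the product, and for
    their squared moduli, giving its mean square.\<close>
  have prod_moment: "(\<integral>w. (\<Prod>j<n. f (D j w)) \<partial>M) = (\<integral>x. f x \<partial>P) ^ n"
    if [measurable]: "f \<in> borel_measurable borel" and bd: "\<And>x. norm (f x) \<le> 1"
    for f :: "'e \<Rightarrow> 'f::{real_normed_field, banach, second_countable_topology}" and n
  proof -
    have "M.indep_vars (\<lambda>_. borel) (\<lambda>j w. f (D j w)) {..<n}"
      by (rule M.indep_vars_compose2[OF M.indep_vars_subset[OF indep]]) auto
    then have "(\<integral>w. (\<Prod>j<n. f (D j w)) \<partial>M) = (\<Prod>j<n. \<integral>w. f (D j w) \<partial>M)"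
      by (intro M.indep_vars_lebesgue_integral) (auto intro!: M.integrable_const_bound[of _ 1] simp: bd)
    moreover have "(\<integral>w. f (D j w) \<partial>M) = (\<integral>x. f x \<partial>P)" for j
      unfolding law[of j, symmetric] by (subst integral_distr) auto
    ultimately show ?thesis by simp
  qed
  have lim1: "(\<lambda>n. \<integral>w. p n w \<partial>M) \<longlonglongrightarrow> of_real (exp (- (m / 2)))"
  proof -
    have "(\<lambda>n. (\<integral>x. z n x \<partial>P) ^ n) \<longlonglongrightarrow> of_real (exp (- (m / 2)))"
    proof (rule power_tendsto_exp)
      show "norm (\<integral>x. z n x \<partial>P) \<le> 1" for n
      proof -
        have "norm (\<integral>x. z n x \<partial>P) \<le> (\<integral>x. norm (z n x) \<partial>P)" by (rule integral_norm_bound)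
        also have "\<dots> \<le> (\<integral>x. 1 \<partial>P)" using z1 int_P by (intro integral_mono) auto
        finally show ?thesis by (simp add: P.prob_space)
      qed
      have "of_nat n * (1 - (\<integral>x. z n x \<partial>P)) = (\<integral>x. of_nat n * (1 - z n x) \<partial>P)" for n
        using int_P by (simp add: Bochner_Integration.integral_diff P.prob_space)
      then show "(\<lambda>n. of_nat n * (1 - (\<integral>x. z n x \<partial>P))) \<longlonglongrightarrow> of_real (m / 2)"
        using expectation_char_limit[OF c_P sq] by (simp only: z_def m_def)
    qed (use m in simp)
    then show ?thesis unfolding p_def using z1 by (subst prod_moment) auto
  qed
  have lim2: "(\<lambda>n. \<integral>w. (cmod (p n w))^2 \<partial>M) \<longlonglongrightarrow> exp (- m)"
  proof -
    have int_le: "0 \<le> (\<integral>x. (cmod (z n x))^2 \<partial>P)" "(\<integral>x. (cmod (z n x))^2 \<partial>P) \<le> 1" for n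
      using integral_mono[OF int_P(2)[of n], of "\<lambda>_. 1"] z1 by (auto simp: power_le_one P.prob_space)
    have "(\<lambda>n. complex_of_real (\<integral>x. (cmod (z n x))^2 \<partial>P) ^ n) \<longlonglongrightarrow> of_real (exp (- m))"
    proof (rule power_tendsto_exp)
      show "norm (complex_of_real (\<integral>x. (cmod (z n x))^2 \<partial>P)) \<le> 1" for n
        using int_le[of n] by (simp only: norm_of_real abs_of_nonneg)
      have "real n * (1 - (\<integral>x. (cmod (z n x))^2 \<partial>P)) = (\<integral>x. real n * (1 - (cmod (z n x))^2) \<partial>P)" for n
        using int_P by (simp add: Bochner_Integration.integral_diff P.prob_space)
      then have "(\<lambda>n. real n * (1 - (\<integral>x. (cmod (z n x))^2 \<partial>P))) \<longlonglongrightarrow> m"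
        using expectation_norm_char_limit[OF c_P sq] by (simp only: z_def m_def)
      from tendsto_of_real[OF this, where 'a = complex]
      show "(\<lambda>n. of_nat n * (1 - complex_of_real (\<integral>x. (cmod (z n x))^2 \<partial>P))) \<longlonglongrightarrow> of_real m"
        by simp
    qed (rule m)
    then have "(\<lambda>n. (\<integral>x. (cmod (z n x))^2 \<partial>P) ^ n) \<longlonglongrightarrow> exp (- m)"
      by (simp only: of_real_power[symmetric] tendsto_of_real_iff)
    moreover have "(cmod (p n w))^2 = (\<Prod>j<n. (cmod (z n (D j w)))^2)" for n w
      unfolding p_def prod_norm[symmetric] by (rule prod_power_distrib)
    moreover have "(\<integral>w. (\<Prod>j<n. (cmod (z n (D j w)))^2) \<partial>M) = (\<integral>x. (cmod (z n x))^2 \<partial>P) ^ n" for n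
      using z1 by (intro prod_moment) (auto simp: power_le_one)
    ultimately show ?thesis by simp
  qed
  \<comment> \<open>The mean tends to \<open>b\<close> and the mean square to exp (- m) = b^2, so
    the mean square distance from the constant \<open>b\<close> tends to b^2 - 2 * b * b + b^2 =
    0.\<close>
  define b where "b = exp (- (m / 2))"
  have b: "0 \<le> b" "b \<le> 1" using m by (simp_all add: b_def)
  have b2: "b^2 = exp (- m)" by (simp add: b_def power2_eq_square flip: exp_add)
  have "(\<integral>w. (cmod (p n w - of_real b))^2 \<partial>M) = (\<integral>w. (cmod (p n w))^2 \<partial>M) - 2 * b * Re (\<integral>w. p n w \<partial>M) + b^2" for n
  proof -
    have int: "integrable M (p n)" "integrable M (\<lambda>w. (cmod (p n w))^2)"
      using p1 by (auto intro!: M.integrable_const_bound[of _ 1] simp: power_le_one)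
    have "(cmod (p n w - of_real b))^2 = (cmod (p n w))^2 - 2 * b * Re (p n w) + b^2" for w
      unfolding cmod_power2 by (simp add: power2_eq_square algebra_simps)
    then show ?thesis using int by (simp add: M.prob_space)
  qed
  moreover have "(\<lambda>n. (\<integral>w. (cmod (p n w))^2 \<partial>M) - 2 * b * Re (\<integral>w. p n w \<partial>M) + b^2)
      \<longlonglongrightarrow> exp (- m) - 2 * b * Re (of_real b) + b^2"
    by (intro tendsto_intros lim1[folded b_def] lim2)
  ultimately have sq_lim: "(\<lambda>n. \<integral>w. (cmod (p n w - of_real b))^2 \<partial>M) \<longlonglongrightarrow> 0"
    using b2 by (simp add: power2_eq_square)
  \<comment> \<open>Convergence in mean square gives convergence in mean, read off from
    nonnegativity of the variance of the distance.\<close>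
  have le: "(\<integral>w. cmod (p n w - of_real b) \<partial>M) \<le> sqrt (\<integral>w. (cmod (p n w - of_real b))^2 \<partial>M)" for n
  proof -
    have bd: "cmod (p n w - of_real b) \<le> 2" for w
      using norm_triangle_ineq4[of "p n w" "of_real b"] p1[of n w] b by simp
    have "0 \<le> M.variance (\<lambda>w. cmod (p n w - of_real b))" by (rule M.variance_positive)
    also have "\<dots> = (\<integral>w. (cmod (p n w - of_real b))^2 \<partial>M) - (\<integral>w. cmod (p n w - of_real b) \<partial>M)^2"
    proof (rule M.variance_eq)
      show "integrable M (\<lambda>w. cmod (p n w - of_real b))"
        using bd by (intro M.integrable_const_bound[of _ 2]) auto
      show "integrable M (\<lambda>w. (cmod (p n w - of_real b))^2)"
        using power_mono[OF bd norm_ge_zero, where n = 2] by (intro M.integrable_const_bound[of _ 4]) auto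
    qed
    finally show ?thesis by (intro real_le_rsqrt) simp
  qed
  have "(\<lambda>n. sqrt (\<integral>w. (cmod (p n w - of_real b))^2 \<partial>M)) \<longlonglongrightarrow> 0"
    using tendsto_real_sqrt[OF sq_lim] by simp
  then have "(\<lambda>n. \<integral>w. cmod (p n w - of_real b) \<partial>M) \<longlonglongrightarrow> 0"
    by (rule real_squeeze_0[OF _ le]) simp
  then show ?thesis unfolding p_def z_def b_def m_def by simp
qed

end

section \<open>Multiplier sums\<close>

lemma (in prob_space) expectation_iexp_weighted_sum:
  fixes W :: "nat \<Rightarrow> 'a \<Rightarrow> real"
  assumes indep: "indep_vars (\<lambda>_. borel) W UNIV" and law: "\<And>i. distr M borel (W i) = \<mu>"
  shows "(\<integral>w. iexp (\<Sum>j<n. W j w * c j) \<partial>M) = (\<Prod>j<n. char \<mu> (c j))"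
proof -
  have [measurable]: "W i \<in> borel_measurable M" for i using indep unfolding indep_vars_def by simp
  have "iexp (\<Sum>j<n. W j w * c j) = (\<Prod>j<n. iexp (c j * W j w))" for w
    by (simp add: exp_sum[symmetric] sum_distrib_left mult_ac)
  moreover have "indep_vars (\<lambda>_. borel) (\<lambda>j w. iexp (c j * W j w)) {..<n}"
    by (rule indep_vars_compose2[OF indep_vars_subset[OF indep]]) auto
  then have "(\<integral>w. (\<Prod>j<n. iexp (c j * W j w)) \<partial>M) = (\<Prod>j<n. \<integral>w. iexp (c j * W j w) \<partial>M)"
    by (intro indep_vars_lebesgue_integral) (auto intro!: integrable_const_bound[of _ 1])
  moreover have "(\<integral>w. iexp (c j * W j w) \<partial>M) = char \<mu> (c j)" for j
    unfolding char_def law[of j, symmetric] by (subst integral_distr) auto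
  ultimately show ?thesis by simp
qed

lemma (in prob_space) expectation_iexp_gaussian_sum:
  fixes Q :: "nat \<Rightarrow> 'a \<Rightarrow> real"
  assumes "indep_vars (\<lambda>_. borel) Q UNIV" "\<And>i. distr M borel (Q i) = std_normal_distribution"
  shows "(\<integral>w. iexp (\<Sum>i<m. Q i w * y i) \<partial>M) = of_real (exp (- (\<Sum>i<m. (y i)^2) / 2))"
proof -
  have "(\<integral>w. iexp (\<Sum>i<m. Q i w * y i) \<partial>M) = (\<Prod>i<m. complex_of_real (exp (- ((y i)^2) / 2)))"
    using expectation_iexp_weighted_sum[OF assms] by (simp add: char_std_normal_distribution)
  also have "\<dots> = of_real (exp (\<Sum>i<m. - ((y i)^2) / 2))" by (simp add: exp_sum)
  finally show ?thesis by (simp add: sum_negf sum_divide_distrib)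
qed

text \<open>Makes Laplace transforms of squared norms comparable through the norm of a difference,
  with no bound on the norms themselves.\<close>

lemma exp_neg_square_lipschitz: "\<bar>exp (- (x^2)) - exp (- (y^2))\<bar> \<le> \<bar>x - y\<bar>" for x y :: real
proof -
  have "norm (exp (- (x^2)) - exp (- (y^2))) \<le> 1 * norm (x - y)"
  proof (rule field_differentiable_bound[of UNIV])
    show "((\<lambda>x. exp (- (x^2))) has_field_derivative - 2 * z * exp (- (z^2))) (at z within UNIV)" for z :: real
      by (auto intro!: derivative_eq_intros)
    show "norm (- 2 * z * exp (- (z^2))) \<le> 1" for z :: real
    proof -
      have "2 * \<bar>z\<bar> \<le> 1 + z^2" using sum_squares_bound[of 1 "\<bar>z\<bar>"] by simp
      also have "\<dots> \<le> exp (z^2)" by (rule exp_ge_add_one_self)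
      finally have "2 * \<bar>z\<bar> * exp (- (z^2)) \<le> exp (z^2) * exp (- (z^2))" by (rule mult_right_mono) simp
      then show ?thesis by (simp add: abs_mult flip: exp_add)
    qed
  qed auto
  then show ?thesis by simp
qed

text \<open>The norm is traded for its square, at the price of a small constant
  \<open>\<delta>\<close>, because the conditional mean square of a multiplier sum is available
  exactly.\<close>

lemma exp_neg_norm_square_diff:
  fixes v w :: "'h::real_normed_vector"
  assumes t: "t \<ge> 0" and \<delta>: "\<delta> > 0"
  shows "\<bar>exp (- t * (norm v)^2) - exp (- t * (norm w)^2)\<bar> \<le> sqrt t * (\<delta> + (norm (v - w))^2 / \<delta>)"
proof -
  have "\<bar>exp (- t * (norm v)^2) - exp (- t * (norm w)^2)\<bar> \<le> \<bar>sqrt t * norm v - sqrt t * norm w\<bar>"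
    using exp_neg_square_lipschitz[of "sqrt t * norm v" "sqrt t * norm w"] t by (simp add: power_mult_distrib)
  also have "\<dots> = sqrt t * \<bar>norm v - norm w\<bar>" using t by (simp add: abs_mult flip: right_diff_distrib)
  also have "\<dots> \<le> sqrt t * norm (v - w)" using t by (intro mult_left_mono norm_triangle_ineq3) simp
  also have "norm (v - w) \<le> \<delta> + (norm (v - w))^2 / \<delta>"
  proof -
    have "norm (v - w) * \<delta> \<le> \<delta>^2 + (norm (v - w))^2"
    proof -
      have "0 \<le> norm (v - w) * \<delta>" using \<delta> by simp
      then show ?thesis using sum_squares_bound[of "norm (v - w)" \<delta>] by linarith
    qed
    then show ?thesis using \<delta> by (simp add: field_simps power2_eq_square)
  qed
  finally show ?thesis using t by (simp add: mult_left_mono)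
qed

locale iid_multipliers = M: prob_space M + standardized_distribution \<mu>
  for M :: "'a measure" and \<mu> :: "real measure" +
  fixes W :: "nat \<Rightarrow> 'a \<Rightarrow> real"
  assumes W_indep: "M.indep_vars (\<lambda>_. borel) W UNIV" and W_law: "\<And>i. distr M borel (W i) = \<mu>"
begin

lemma W_measurable [measurable]: "W i \<in> borel_measurable M"
  using W_indep unfolding M.indep_vars_def by simp

lemma W_integrable: "integrable M (W i)" "integrable M (\<lambda>w. (W i w)^2)"
  using integrable_id integrable_sq unfolding W_law[of i, symmetric] by (simp_all add: integrable_distr_eq)

lemma W_moments: "(\<integral>w. W i w \<partial>M) = 0" "(\<integral>w. (W i w)^2 \<partial>M) = 1"
  using mean second_moment unfolding W_law[of i, symmetric] by (simp_all add: integral_distr)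

lemma W_product:
  shows "integrable M (\<lambda>w. W i w * W j w)" (is ?int)
    and "(\<integral>w. W i w * W j w \<partial>M) = (if i = j then 1 else 0)" (is ?eq)
proof -
  have "?int \<and> ?eq"
  proof (cases "i = j")
    case True then show ?thesis using W_integrable(2)[of j] W_moments(2)[of j] by (simp add: power2_eq_square)
  next
    case False
    have ind: "M.indep_vars (\<lambda>_. borel) W {i, j}" by (rule M.indep_vars_subset[OF W_indep]) simp
    show ?thesis
      using M.indep_vars_lebesgue_integral[OF _ ind W_integrable(1)] M.indep_vars_integrable[OF _ ind W_integrable(1)]
        False W_moments(1) by simp
  qed
  then show ?int ?eq by auto
qed

text \<open>The multipliers are orthonormal in mean square, so all cross terms vanish. The vectors
  \<open>b j\<close> are fixed here; later they are functions of the data at a frozen sample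
  point.\<close>

lemma expectation_norm_weighted_sum:
  fixes b :: "nat \<Rightarrow> 'h::real_inner"
  shows "integrable M (\<lambda>w. (norm (\<Sum>j<n. W j w *\<^sub>R b j))^2)" (is ?int)
    and "(\<integral>w. (norm (\<Sum>j<n. W j w *\<^sub>R b j))^2 \<partial>M) = (\<Sum>j<n. (norm (b j))^2)" (is ?eq)
proof -
  have expand: "(norm (\<Sum>j<n. W j w *\<^sub>R b j))^2 = (\<Sum>i<n. \<Sum>j<n. (W i w * W j w) * (b i \<bullet> b j))" for w
    unfolding power2_norm_eq_inner inner_sum_left inner_sum_right
    by (subst sum.swap) (simp add: inner_commute[of "b _" "b _"] mult_ac)
  show ?int unfolding expand
    by (intro Bochner_Integration.integrable_sum integrable_mult_left W_product)
  have "(\<integral>w. (norm (\<Sum>j<n. W j w *\<^sub>R b j))^2 \<partial>M) = (\<Sum>i<n. \<Sum>j<n. (\<integral>w. W i w * W j w \<partial>M) * (b i \<bullet> b j))"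
    unfolding expand
    by (subst Bochner_Integration.integral_sum, intro Bochner_Integration.integrable_sum integrable_mult_left W_product,
        intro sum.cong refl, subst Bochner_Integration.integral_sum, intro integrable_mult_left W_product) simp
  also have "\<dots> = (\<Sum>j<n. (norm (b j))^2)"
    by (simp add: W_product power2_norm_eq_inner if_distrib[of "\<lambda>x. x * _"] cong: if_cong)
  finally show ?eq .
qed

text \<open>Writing the Gaussian kernel as a characteristic function in an independent Gaussian vector makes the
  exponent linear in the multipliers, so that their characteristic functions factorise.\<close>

lemma laplace_transform_linearization:
  fixes Q :: "nat \<Rightarrow> 'a \<Rightarrow> real" and c :: "nat \<Rightarrow> nat \<Rightarrow> real"
  assumes Q: "M.indep_vars (\<lambda>_. borel) Q UNIV" "\<And>i. distr M borel (Q i) = std_normal_distribution" and t: "t \<ge> 0"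
  shows "complex_of_real (\<integral>w. exp (- t * (\<Sum>i<m. (\<Sum>j<n. W j w * c i j)^2)) \<partial>M) =
    (\<integral>w. (\<Prod>j<n. char \<mu> (\<Sum>i<m. sqrt (2 * t) * Q i w * c i j)) \<partial>M)"
proof -
  interpret MM: pair_prob_space M M ..
  have [measurable]: "Q i \<in> borel_measurable M" for i using Q(1) unfolding M.indep_vars_def by simp
  \<comment> \<open>The standard normal characteristic function exp (- y^2 / 2), taken at
    \<open>s * y\<close>, equals exp (- t * y^2).\<close>
  define s where "s = sqrt (2 * t)"
  have s: "s^2 = 2 * t" using t by (simp add: s_def)
  have "complex_of_real (\<integral>w. exp (- t * (\<Sum>i<m. (\<Sum>j<n. W j w * c i j)^2)) \<partial>M) =
      (\<integral>w. complex_of_real (exp (- t * (\<Sum>i<m. (\<Sum>j<n. W j w * c i j)^2))) \<partial>M)" by simp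
  \<comment> \<open>\<open>Q\<close> is read at a second point \<open>w'\<close>, so on the product
    space it is independent of \<open>W\<close> by construction and Fubini may exchange the two
    integrations.\<close>
  also have "\<dots> = (\<integral>w. (\<integral>w'. iexp (\<Sum>i<m. Q i w' * (s * (\<Sum>j<n. W j w * c i j))) \<partial>M) \<partial>M)"
    unfolding M.expectation_iexp_gaussian_sum[OF Q] power_mult_distrib s
    by (simp add: sum_distrib_left[symmetric])
  also have "\<dots> = (\<integral>w'. (\<integral>w. iexp (\<Sum>i<m. Q i w' * (s * (\<Sum>j<n. W j w * c i j))) \<partial>M) \<partial>M)"
    by (rule MM.Fubini_integral[symmetric], rule MM.integrable_const_bound[of _ 1]) auto
  also have "\<dots> = (\<integral>w'. (\<integral>w. iexp (\<Sum>j<n. W j w * (\<Sum>i<m. s * Q i w' * c i j)) \<partial>M) \<partial>M)"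
  proof -
    have "(\<Sum>i<m. Q i w' * (s * (\<Sum>j<n. W j w * c i j))) = (\<Sum>j<n. W j w * (\<Sum>i<m. s * Q i w' * c i j))" for w w'
      unfolding sum_distrib_left by (subst sum.swap) (simp add: mult_ac)
    then show ?thesis by simp
  qed
  also have "\<dots> = (\<integral>w'. (\<Prod>j<n. char \<mu> (\<Sum>i<m. s * Q i w' * c i j)) \<partial>M)"
    by (simp only: M.expectation_iexp_weighted_sum[OF W_indep W_law])
  finally show ?thesis unfolding s_def .
qed

end

context iid_multipliers
begin

text \<open>For a frozen \<open>w'\<close> the vector \<open>u w'\<close> is deterministic and the
  product limit applies to \<open>c x = a x \<bullet> u w'\<close>. Since all integrands are bounded
  by 2, dominated convergence and Fubini integrate the result over \<open>w'\<close>.\<close>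

lemma gaussian_mixture_limit:
  fixes D :: "nat \<Rightarrow> 'a \<Rightarrow> 'e::second_countable_topology"
    and a :: "'e \<Rightarrow> 'h::{real_inner, complete_space, second_countable_topology}"
  assumes D_indep: "M.indep_vars (\<lambda>_. borel) D UNIV" and D_law: "\<And>i. distr M borel (D i) = P"
    and a [measurable]: "a \<in> borel_measurable borel" and sq: "integrable P (\<lambda>x. (norm (a x))^2)"
    and u [measurable]: "u \<in> borel_measurable M"
  shows "(\<lambda>n. \<integral>w. cmod ((\<integral>w'. (\<Prod>j<n. char \<mu> ((a (D j w) \<bullet> u w') / sqrt (real n))) \<partial>M) -
      (\<integral>w'. complex_of_real (exp (- cov_form P a (u w') (u w') / 2)) \<partial>M)) \<partial>M) \<longlonglongrightarrow> 0"
proof -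
  interpret MM: pair_prob_space M M ..
  have [measurable]: "D i \<in> borel_measurable M" for i using D_indep unfolding M.indep_vars_def by simp
  interpret P: prob_space P unfolding D_law[of 0, symmetric] by (rule M.prob_space_distr) simp
  have sets_P [measurable_cong]: "sets P = sets borel" unfolding D_law[of 0, symmetric] by simp
  have a_P: "a \<in> borel_measurable P" by simp
  define B where "B w' = cov_form P a (u w') (u w')" for w'
  have [measurable]: "B \<in> borel_measurable M" unfolding B_def cov_form_def by measurable
  have B_nonneg: "B w' \<ge> 0" for w' unfolding B_def by (rule cov_form_nonneg[OF a_P sq])
  define p where "p n w w' = (\<Prod>j<n. char \<mu> ((a (D j w) \<bullet> u w') / sqrt (real n)))" for n w w'
  have p_meas [measurable]: "case_prod (p n) \<in> borel_measurable (M \<Otimes>\<^sub>M M)" for n unfolding p_def by measurable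
  have p1: "cmod (p n w w') \<le> 1" for n w w'
    unfolding p_def prod_norm[symmetric] by (intro prod_le_1) (simp add: cmod_char_le_1)
  define F where "F n w w' = p n w w' - complex_of_real (exp (- B w' / 2))" for n w w'
  have F_meas [measurable]: "case_prod (F n) \<in> borel_measurable (M \<Otimes>\<^sub>M M)" for n unfolding F_def by measurable
  have F2: "cmod (F n w w') \<le> 2" for n w w'
  proof -
    have "cmod (F n w w') \<le> cmod (p n w w') + cmod (complex_of_real (exp (- B w' / 2)))"
      unfolding F_def by (rule norm_triangle_ineq4)
    also have "cmod (complex_of_real (exp (- B w' / 2))) \<le> 1" using B_nonneg[of w'] by simp
    finally show ?thesis using p1[of n w w'] by simp
  qed
  have F_slice1: "(\<lambda>w'. F n w w') \<in> borel_measurable M" if [measurable]: "w \<in> space M" for n w by measurable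
  have F_slice2: "(\<lambda>w. F n w w') \<in> borel_measurable M" if [measurable]: "w' \<in> space M" for n w' by measurable
  define g where "g n w' = (\<integral>w. cmod (F n w w') \<partial>M)" for n w'
  have g_meas [measurable]: "g n \<in> borel_measurable M" for n unfolding g_def by measurable
  have "(\<lambda>n. \<integral>w'. g n w' \<partial>M) \<longlonglongrightarrow> (\<integral>w'. 0 \<partial>M)"
  proof (rule integral_dominated_convergence[where w = "\<lambda>_. 2"])
    show "AE w' in M. (\<lambda>n. g n w') \<longlonglongrightarrow> 0"
    proof (rule AE_I2)
      fix w' assume "w' \<in> space M"
      have "integrable P (\<lambda>x. (a x \<bullet> u w')^2)"
        using cov_form_integrable[OF a_P sq, of "u w'" "u w'"] by (simp add: power2_eq_square)
      from char_product_limit[OF M.prob_space_axioms D_indep D_law _ this]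
      show "(\<lambda>n. g n w') \<longlonglongrightarrow> 0"
        by (simp add: g_def F_def p_def B_def cov_form_def power2_eq_square)
    qed
    show "AE w' in M. norm (g n w') \<le> 2" for n
    proof (rule AE_I2)
      fix w' assume "w' \<in> space M"
      then have "(\<integral>w. cmod (F n w w') \<partial>M) \<le> (\<integral>w. 2 \<partial>M)"
        using F2 F_slice2 by (intro integral_mono) (auto intro!: M.integrable_const_bound[of _ 2])
      then show "norm (g n w') \<le> 2" by (simp add: g_def M.prob_space)
    qed
  qed simp_all
  then have g_lim: "(\<lambda>n. \<integral>w'. g n w' \<partial>M) \<longlonglongrightarrow> 0" by simp
  let ?d = "\<lambda>n w. (\<integral>w'. p n w w' \<partial>M) - (\<integral>w'. complex_of_real (exp (- B w' / 2)) \<partial>M)"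
  have le: "(\<integral>w. cmod (?d n w) \<partial>M) \<le> (\<integral>w'. g n w' \<partial>M)" for n
  proof -
    have int: "integrable (M \<Otimes>\<^sub>M M) (\<lambda>(w, w'). cmod (F n w w'))"
      using F2 by (intro MM.integrable_const_bound[of _ 2]) auto
    have "(\<integral>w. cmod (?d n w) \<partial>M)
        = (\<integral>w. cmod (\<integral>w'. F n w w' \<partial>M) \<partial>M)"
    proof (rule Bochner_Integration.integral_cong[OF refl])
      fix w assume [measurable]: "w \<in> space M"
      have "integrable M (\<lambda>w'. p n w w')" using p1 by (intro M.integrable_const_bound[of _ 1]) auto
      moreover have "integrable M (\<lambda>w'. complex_of_real (exp (- B w' / 2)))"
        using B_nonneg by (intro M.integrable_const_bound[of _ 1]) auto
      ultimately show "cmod (?d n w) = cmod (\<integral>w'. F n w w' \<partial>M)"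
        unfolding F_def by (subst Bochner_Integration.integral_diff) auto
    qed
    also have "\<dots> \<le> (\<integral>w. \<integral>w'. cmod (F n w w') \<partial>M \<partial>M)"
    proof (rule integral_mono)
      show "integrable M (\<lambda>w. \<integral>w'. cmod (F n w w') \<partial>M)"
        using MM.integrable_fst'[OF int] by simp
      have bound: "cmod (\<integral>w'. F n w w' \<partial>M) \<le> 2" if "w \<in> space M" for w
      proof -
        have "cmod (\<integral>w'. F n w w' \<partial>M) \<le> (\<integral>w'. cmod (F n w w') \<partial>M)" by (rule integral_norm_bound)
        also have "\<dots> \<le> (\<integral>w'. 2 \<partial>M)"
          using F2 F_slice1[OF that] by (intro integral_mono) (auto intro!: M.integrable_const_bound[of _ 2])
        finally show ?thesis by (simp add: M.prob_space)
      qed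
      show "integrable M (\<lambda>w. cmod (\<integral>w'. F n w w' \<partial>M))"
        using bound by (intro M.integrable_const_bound[of _ 2]) auto
    qed (rule integral_norm_bound)
    also have "\<dots> = (\<integral>w'. g n w' \<partial>M)"
      unfolding g_def by (rule MM.Fubini_integral[symmetric]) (rule int)
    finally show ?thesis .
  qed
  show ?thesis
    by (rule real_squeeze_0[OF g_lim, unfolded g_def]) (use le in \<open>simp_all add: p_def B_def g_def\<close>)
qed

end

section \<open>Limit of the conditional Laplace transforms\<close>

lemma cov_form_sum_left:
  fixes a :: "'b \<Rightarrow> 'h::{real_inner, complete_space, second_countable_topology}"
  assumes a: "a \<in> borel_measurable P" "integrable P (\<lambda>x. (norm (a x))^2)"
  shows "cov_form P a (\<Sum>i\<in>I. c i *\<^sub>R e i) v = (\<Sum>i\<in>I. c i * cov_form P a (e i) v)"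
proof (induction I rule: infinite_finite_induct)
  case (insert i I)
  then show ?case by (simp add: cov_form_add_left[OF a] cov_form_scale_left[OF a])
qed (simp_all add: cov_form_def)

text \<open>Each squared normal has mean 1, so the nonnegative series has expectation equal to the
  sum of \<open>lam\<close>, which is finite.\<close>

lemma weighted_chi_square_summable:
  fixes Q :: "nat \<Rightarrow> 'a \<Rightarrow> real"
  assumes Q [measurable]: "\<And>i. Q i \<in> borel_measurable M" and law: "\<And>i. distr M borel (Q i) = std_normal_distribution"
    and lam: "\<And>i. lam i \<ge> 0" "summable lam"
  shows "AE w in M. summable (\<lambda>i. lam i * (Q i w)^2)"
proof -
  have "(\<integral>\<^sup>+x. ennreal (x^2) \<partial>std_normal_distribution) = ennreal (\<integral>x. x^2 \<partial>std_normal_distribution)"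
    using std_normal_distribution_even_moments[of 1] by (intro nn_integral_eq_integral) auto
  then have "(\<integral>\<^sup>+x. ennreal (x^2) \<partial>std_normal_distribution) = 1"
    using std_normal_distribution_even_moments[of 1] by simp
  then have moment: "(\<integral>\<^sup>+w. ennreal ((Q i w)^2) \<partial>M) = 1" for i
    unfolding law[of i, symmetric] by (subst (asm) nn_integral_distr) auto
  have "(\<integral>\<^sup>+w. (\<Sum>i. ennreal (lam i * (Q i w)^2)) \<partial>M) = (\<Sum>i. \<integral>\<^sup>+w. ennreal (lam i * (Q i w)^2) \<partial>M)"
    by (rule nn_integral_suminf) simp
  also have "\<dots> = (\<Sum>i. ennreal (lam i))"
    using lam(1) by (simp add: ennreal_mult nn_integral_cmult moment)
  also have "\<dots> \<noteq> \<infinity>" using lam by (simp add: suminf_ennreal2)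
  finally have "AE w in M. (\<Sum>i. ennreal (lam i * (Q i w)^2)) \<noteq> \<infinity>"
    by (intro nn_integral_PInf_AE) auto
  then show ?thesis
    by eventually_elim (rule summable_suminf_not_top, use lam(1) in auto)
qed

context iid_multipliers
begin

text \<open>Three transforms are compared: \<open>L\<close> for the sum with coefficients
  \<open>r\<close>, \<open>Lm m\<close> for the sum with coefficients \<open>a (D j)\<close>
  projected on the first \<open>m\<close> eigenvectors, and \<open>G m\<close> for the truncated
  limit. Only average squared closeness of \<open>r\<close> to \<open>a (D j)\<close> is asked for,
  which keeps the regression out of this argument.\<close>

theorem multiplier_laplace_limit:
  fixes D :: "nat \<Rightarrow> 'a \<Rightarrow> 'e::second_countable_topology"
    and a :: "'e \<Rightarrow> 'h::{real_inner, complete_space, second_countable_topology}"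
    and r :: "nat \<Rightarrow> nat \<Rightarrow> 'a \<Rightarrow> 'h" and Q :: "nat \<Rightarrow> 'a \<Rightarrow> real"
  assumes D_indep: "M.indep_vars (\<lambda>_. borel) D UNIV" and D_law: "\<And>i. distr M borel (D i) = P"
    and Q: "M.indep_vars (\<lambda>_. borel) Q UNIV" "\<And>i. distr M borel (Q i) = std_normal_distribution"
    and a [measurable]: "a \<in> borel_measurable borel" and sq: "integrable P (\<lambda>x. (norm (a x))^2)"
    and T: "\<And>u v. cov_form P a u v = T u \<bullet> v" and lam: "lists_eigenvalues T lam"
    and r [measurable]: "\<And>n j. j < n \<Longrightarrow> r n j \<in> borel_measurable M"
    and close: "tends_in_prob M (\<lambda>n w. 1 / real n * (\<Sum>j<n. (norm (r n j w - a (D j w)))^2)) 0"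
    and t: "t \<ge> 0"
  shows "tends_in_prob M
    (\<lambda>n w. \<integral>w'. exp (- t * (norm ((1 / sqrt (real n)) *\<^sub>R (\<Sum>j<n. W j w' *\<^sub>R r n j w)))^2) \<partial>M)
    (\<integral>w'. exp (- t * (\<Sum>i. lam i * (Q i w')^2)) \<partial>M)"
proof -
  have D_meas [measurable]: "D i \<in> borel_measurable M" for i using D_indep unfolding M.indep_vars_def by simp
  have Q_meas [measurable]: "Q i \<in> borel_measurable M" for i using Q(1) unfolding M.indep_vars_def by simp
  interpret P: prob_space P unfolding D_law[of 0, symmetric] by (rule M.prob_space_distr) simp
  have sets_P [measurable_cong]: "sets P = sets borel" unfolding D_law[of 0, symmetric] by simp
  have a_P: "a \<in> borel_measurable P" by simp
  obtain e where e: "orthosystem e" and cov_e: "\<And>i u. cov_form P a (e i) u = lam i * (e i \<bullet> u)"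
    and e0: "\<And>i. e i = 0 \<longleftrightarrow> lam i = 0" and lam_nonneg: "\<And>i. lam i \<ge> 0" and lam_summable: "summable lam"
    and tail: "(\<lambda>m. \<integral>x. (norm (a x - (\<Sum>i<m. (a x \<bullet> e i) *\<^sub>R e i)))^2 \<partial>P) \<longlonglongrightarrow> 0"
    by (rule covariance_eigenexpansion[OF a_P sq T lam]) blast
  define proj where "proj m x = (\<Sum>i<m. (x \<bullet> e i) *\<^sub>R e i)" for m x
  have [measurable]: "proj m \<in> borel_measurable borel" for m unfolding proj_def by measurable
  have proj_linear: "proj m (c *\<^sub>R x) = c *\<^sub>R proj m x" "proj m (\<Sum>j\<in>J. f j) = (\<Sum>j\<in>J. proj m (f j))"
    for m c x f and J :: "nat set"
  proof -
    show "proj m (c *\<^sub>R x) = c *\<^sub>R proj m x" by (simp add: proj_def scaleR_sum_right)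
    show "proj m (\<Sum>j\<in>J. f j) = (\<Sum>j\<in>J. proj m (f j))"
      unfolding proj_def inner_sum_left scaleR_sum_left by (rule sum.swap)
  qed
  define V where "V n w w' = (1 / sqrt (real n)) *\<^sub>R (\<Sum>j<n. W j w' *\<^sub>R r n j w)" for n w w'
  define V0 where "V0 n w w' = (1 / sqrt (real n)) *\<^sub>R (\<Sum>j<n. W j w' *\<^sub>R a (D j w))" for n w w'
  have [measurable]: "case_prod (V n) \<in> borel_measurable (M \<Otimes>\<^sub>M M)" "case_prod (V0 n) \<in> borel_measurable (M \<Otimes>\<^sub>M M)" for n
    unfolding V_def V0_def by measurable
  define L where "L n w = (\<integral>w'. exp (- t * (norm (V n w w'))^2) \<partial>M)" for n w
  define Lm where "Lm m n w = (\<integral>w'. exp (- t * (norm (proj m (V0 n w w')))^2) \<partial>M)" for m n w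
  define G where "G m = (\<integral>w'. exp (- t * (\<Sum>i<m. lam i * (Q i w')^2)) \<partial>M)" for m
  have [measurable]: "Lm m n \<in> borel_measurable M" for m n unfolding Lm_def by measurable
  have exp_int: "integrable M (\<lambda>w. exp (- t * (norm (X w))^2))" if [measurable]: "X \<in> borel_measurable M" for X :: "'a \<Rightarrow> 'h"
    using t by (intro M.integrable_const_bound[of _ 1]) auto
  have slices: "V n w \<in> borel_measurable M" "V0 n w \<in> borel_measurable M" for n w
    unfolding V_def V0_def by measurable
  have exp_ints: "integrable M (\<lambda>w'. exp (- t * (norm (V n w w'))^2))"
    "integrable M (\<lambda>w'. exp (- t * (norm (proj m (V0 n w w')))^2))" for m n w
    by (intro exp_int slices measurable_compose[OF slices(2)]; measurable)+
  define \<tau> where "\<tau> m = (\<integral>x. (norm (a x - proj m (a x)))^2 \<partial>P)" for m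
  have \<tau>_lim: "\<tau> \<longlonglongrightarrow> 0" using tail unfolding \<tau>_def proj_def .
  have proj_le: "(norm (x - proj m x))^2 \<le> (norm x)^2" for m x
    using orthosystem_norm_residual[OF e, of "{..<m}" x] sum_nonneg[of "{..<m}" "\<lambda>i. (x \<bullet> e i)^2"]
    unfolding proj_def by simp
  have int_tail_P: "integrable P (\<lambda>x. (norm (a x - proj m (a x)))^2)" for m
    by (rule Bochner_Integration.integrable_bound[OF sq]) (use proj_le in auto)
  have int_tail: "integrable M (\<lambda>w. (norm (a (D j w) - proj m (a (D j w))))^2)" for j m
    using int_tail_P[of m] unfolding D_law[of j, symmetric] by (simp add: integrable_distr_eq)
  have mean_tail: "(\<integral>w. (norm (a (D j w) - proj m (a (D j w))))^2 \<partial>M) = \<tau> m" for j m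
    unfolding \<tau>_def D_law[of j, symmetric] by (subst integral_distr) auto
  let ?x = "\<lambda>n j w. (norm (r n j w - a (D j w)))^2" and ?y = "\<lambda>m j w. (norm (a (D j w) - proj m (a (D j w))))^2"
  define \<rho> where "\<rho> n w = 1 / real n * (\<Sum>j<n. ?x n j w)" for n w
  define s where "s m n w = 1 / real n * (\<Sum>j<n. ?y m j w)" for m n w
  have [measurable]: "\<rho> n \<in> borel_measurable M" "s m n \<in> borel_measurable M" for m n unfolding \<rho>_def s_def by measurable
  \<comment> \<open>With the data frozen, the two sums differ by a multiplier sum whose mean square
    is the average squared difference of coefficients. \<open>\<rho>\<close> accounts for replacing
    \<open>r\<close> by \<open>a (D j)\<close>, \<open>s m\<close> for the projection; the factor 2
    comes from squaring the sum of both.\<close>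
  have L_diff: "\<bar>L n w - Lm m n w\<bar> \<le> sqrt t * (\<delta> + 2 / \<delta> * (\<rho> n w + s m n w))" if \<delta>: "\<delta> > 0" for n w m \<delta>
  proof -
    define b where "b j = (1 / sqrt (real n)) *\<^sub>R (r n j w - proj m (a (D j w)))" for j
    have diff: "V n w w' - proj m (V0 n w w') = (\<Sum>j<n. W j w' *\<^sub>R b j)" for w'
      unfolding V_def V0_def b_def proj_linear scaleR_diff_right[symmetric] sum_subtractf[symmetric]
      by (simp add: scaleR_sum_right scaleR_diff_right mult.commute)
    have int: "integrable M (\<lambda>w'. (norm (V n w w' - proj m (V0 n w w')))^2)"
      unfolding diff by (rule expectation_norm_weighted_sum)
    have "\<bar>L n w - Lm m n w\<bar> = \<bar>\<integral>w'. exp (- t * (norm (V n w w'))^2) - exp (- t * (norm (proj m (V0 n w w')))^2) \<partial>M\<bar>"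
      unfolding L_def Lm_def by (simp only: Bochner_Integration.integral_diff[OF exp_ints])
    also have "\<dots> \<le> (\<integral>w'. \<bar>exp (- t * (norm (V n w w'))^2) - exp (- t * (norm (proj m (V0 n w w')))^2)\<bar> \<partial>M)"
      by (rule integral_abs_bound)
    also have "\<dots> \<le> (\<integral>w'. sqrt t * (\<delta> + (norm (V n w w' - proj m (V0 n w w')))^2 / \<delta>) \<partial>M)"
    proof (rule integral_mono)
      show "integrable M (\<lambda>w'. \<bar>exp (- t * (norm (V n w w'))^2) - exp (- t * (norm (proj m (V0 n w w')))^2)\<bar>)"
        by (intro Bochner_Integration.integrable_abs Bochner_Integration.integrable_diff exp_ints)
      show "integrable M (\<lambda>w'. sqrt t * (\<delta> + (norm (V n w w' - proj m (V0 n w w')))^2 / \<delta>))"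
        using int by simp
    qed (rule exp_neg_norm_square_diff[OF t \<delta>])
    also have "\<dots> = sqrt t * (\<delta> + (\<Sum>j<n. (norm (b j))^2) / \<delta>)"
      using int by (simp add: M.prob_space) (simp add: diff expectation_norm_weighted_sum)
    also have "\<dots> \<le> sqrt t * (\<delta> + 2 / \<delta> * (\<rho> n w + s m n w))"
    proof -
      have "(norm (b j))^2 \<le> 1 / real n * (2 * ?x n j w + 2 * ?y m j w)" for j
      proof -
        let ?u = "r n j w - a (D j w)" and ?v = "a (D j w) - proj m (a (D j w))"
        have "(norm (?u + ?v))^2 \<le> (norm ?u + norm ?v)^2" by (intro power_mono norm_triangle_ineq) simp
        also have "\<dots> \<le> 2 * (norm ?u)^2 + 2 * (norm ?v)^2"
          using sum_squares_bound[of "norm ?u" "norm ?v"] by (simp add: power2_sum)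
        finally show ?thesis
          unfolding b_def by (simp add: power_mult_distrib power_divide divide_right_mono)
      qed
      then have "(\<Sum>j<n. (norm (b j))^2) \<le> (\<Sum>j<n. 1 / real n * (2 * ?x n j w + 2 * ?y m j w))"
        by (rule sum_mono)
      also have "\<dots> = 2 * (\<rho> n w + s m n w)"
        unfolding \<rho>_def s_def by (simp only: sum_distrib_left[symmetric] sum.distrib) (simp add: algebra_simps)
      finally have "(\<Sum>j<n. (norm (b j))^2) / \<delta> \<le> 2 * (\<rho> n w + s m n w) / \<delta>"
        using \<delta> by (intro divide_right_mono) auto
      then show ?thesis using t by (intro mult_left_mono) auto
    qed
    finally show ?thesis .
  qed
  have Lm_lim: "(\<lambda>n. \<integral>w. \<bar>Lm m n w - G m\<bar> \<partial>M) \<longlonglongrightarrow> 0" for m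
  proof -
    \<comment> \<open>A Gaussian combination of eigenvectors: its inner product with
      \<open>a\<close> is the exponent of the linearised transform, and half its covariance form is
      \<open>t\<close> times the truncated weighted chi-square sum.\<close>
    define u where "u w' = (\<Sum>i<m. (sqrt (2 * t) * Q i w') *\<^sub>R e i)" for w'
    have [measurable]: "u \<in> borel_measurable M" unfolding u_def by measurable
    \<comment> \<open>Where \<open>lam i = 0\<close> also \<open>e i = 0\<close>, so
      \<open>e i \<bullet> u w'\<close> does not recover the coefficient; multiplying by
      \<open>lam i\<close> covers this case.\<close>
    have e_u: "lam i * (e i \<bullet> u w') = lam i * (sqrt (2 * t) * Q i w')" if "i < m" for i w'
    proof -
      have "e i \<bullet> u w' = (\<Sum>k<m. if k = i then (sqrt (2 * t) * Q i w') * (e i \<bullet> e i) else 0)"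
        unfolding u_def inner_sum_right using e by (intro sum.cong refl) (auto simp: orthosystem_def)
      also have "\<dots> = (sqrt (2 * t) * Q i w') * (e i \<bullet> e i)" using that by simp
      finally show ?thesis using e e0[of i] by (auto simp: orthosystem_def dot_square_norm)
    qed
    have cov_u: "cov_form P a (u w') (u w') / 2 = t * (\<Sum>i<m. lam i * (Q i w')^2)" for w'
    proof -
      have "cov_form P a (u w') (u w') = (\<Sum>i<m. (sqrt (2 * t) * Q i w') * (lam i * (e i \<bullet> u w')))"
        by (subst u_def) (simp add: cov_form_sum_left[OF a_P sq] cov_e)
      also have "\<dots> = (\<Sum>i<m. 2 * t * (lam i * (Q i w')^2))"
      proof (intro sum.cong refl)
        fix i assume "i \<in> {..<m}"
        then have "(sqrt (2 * t) * Q i w') * (lam i * (e i \<bullet> u w')) = (sqrt (2 * t))^2 * (lam i * (Q i w')^2)"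
          by (simp add: e_u power2_eq_square)
        then show "(sqrt (2 * t) * Q i w') * (lam i * (e i \<bullet> u w')) = 2 * t * (lam i * (Q i w')^2)" using t by simp
      qed
      finally show ?thesis by (simp add: sum_distrib_left[symmetric])
    qed
    have "complex_of_real (Lm m n w) = (\<integral>w'. (\<Prod>j<n. char \<mu> ((a (D j w) \<bullet> u w') / sqrt (real n))) \<partial>M)" for n w
    proof -
      define c where "c i j = (a (D j w) \<bullet> e i) / sqrt (real n)" for i j
      have "(norm (proj m (V0 n w w')))^2 = (\<Sum>i<m. (\<Sum>j<n. W j w' * c i j)^2)" for w'
      proof -
        have "V0 n w w' \<bullet> e i = (\<Sum>j<n. W j w' * c i j)" for i
          unfolding V0_def c_def by (simp add: inner_sum_left sum_divide_distrib)
        then show ?thesis unfolding proj_def orthosystem_norm_sum[OF e finite_lessThan] by simp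
      qed
      then have "complex_of_real (Lm m n w) = (\<integral>w'. (\<Prod>j<n. char \<mu> (\<Sum>i<m. sqrt (2 * t) * Q i w' * c i j)) \<partial>M)"
        unfolding Lm_def using laplace_transform_linearization[OF Q t] by simp
      moreover have "(\<Sum>i<m. sqrt (2 * t) * Q i w' * c i j) = (a (D j w) \<bullet> u w') / sqrt (real n)" for j w'
        unfolding u_def c_def by (simp add: inner_sum_right sum_divide_distrib)
      ultimately show ?thesis by simp
    qed
    moreover have "complex_of_real (G m) = (\<integral>w'. complex_of_real (exp (- cov_form P a (u w') (u w') / 2)) \<partial>M)"
      unfolding G_def integral_complex_of_real using cov_u by simp
    ultimately have "(\<lambda>n. \<integral>w. cmod (complex_of_real (Lm m n w) - complex_of_real (G m)) \<partial>M) \<longlonglongrightarrow> 0"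
      using gaussian_mixture_limit[OF D_indep D_law a sq, of u] by simp
    then show ?thesis by (simp flip: of_real_diff)
  qed
  have G_lim: "G \<longlonglongrightarrow> (\<integral>w'. exp (- t * (\<Sum>i. lam i * (Q i w')^2)) \<partial>M)"
    unfolding G_def
  proof (rule integral_dominated_convergence[where w = "\<lambda>_. 1"])
    show "AE w' in M. (\<lambda>m. exp (- t * (\<Sum>i<m. lam i * (Q i w')^2))) \<longlonglongrightarrow> exp (- t * (\<Sum>i. lam i * (Q i w')^2))"
      using weighted_chi_square_summable[OF Q_meas Q(2) lam_nonneg lam_summable]
      by eventually_elim (intro tendsto_intros summable_LIMSEQ)
    show "AE w' in M. norm (exp (- t * (\<Sum>i<m. lam i * (Q i w')^2))) \<le> 1" for m
      using t lam_nonneg by (auto intro!: mult_nonneg_nonneg sum_nonneg)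
  qed auto
  define Ginf where "Ginf = (\<integral>w'. exp (- t * (\<Sum>i. lam i * (Q i w')^2)) \<partial>M)"
  have "tends_in_prob M L Ginf"
  proof (rule M.tends_in_probI)
    fix eps :: real assume eps: "eps > 0"
    \<comment> \<open>\<open>\<beta>\<close> replaces \<open>sqrt t\<close>, which may be 0, in the
      definition of \<open>\<delta>\<close>. Four errors get eps / 4 each:
      \<open>sqrt t * \<delta>\<close>, the projection tail, the truncation of the limit, and the
      mean distance of \<open>Lm m n\<close> from \<open>G m\<close>. The first and third form the
      constant eps / 2 in \<open>B\<close>; \<open>A\<close> takes the part that vanishes in
      probability.\<close>
    define \<beta> where "\<beta> = sqrt t + 1"
    have \<beta>: "\<beta> > 0" "sqrt t \<le> \<beta>" using t by (simp_all add: \<beta>_def add_nonneg_pos)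
    define \<delta> where "\<delta> = eps / (4 * \<beta>)"
    have \<delta>: "\<delta> > 0" "\<beta> * \<delta> = eps / 4" using eps \<beta> by (simp_all add: \<delta>_def)
    define q where "q = sqrt t * (2 / \<delta>)"
    have q: "q \<ge> 0" using t \<delta> by (simp add: q_def)
    have "\<forall>\<^sub>F m in sequentially. q * \<tau> m < eps / 4"
      using eps by (intro order_tendstoD(2)[of _ 0] tendsto_mult_right_zero \<tau>_lim) auto
    moreover have "\<forall>\<^sub>F m in sequentially. \<bar>G m - Ginf\<bar> < eps / 4"
      using tendstoD[OF G_lim, of "eps / 4"] eps by (simp add: Ginf_def dist_real_def)
    ultimately have "\<forall>\<^sub>F m in sequentially. q * \<tau> m < eps / 4 \<and> \<bar>G m - Ginf\<bar> < eps / 4"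
      by (rule eventually_conj)
    then obtain m where m: "q * \<tau> m < eps / 4" "\<bar>G m - Ginf\<bar> < eps / 4"
      using eventually_happens'[OF sequentially_bot] by blast
    define A where "A n w = q * (\<rho> n w - 0)" for n w
    define B where "B n w = q * s m n w + \<bar>Lm m n w - G m\<bar> + eps / 2" for n w
    have [measurable]: "A n \<in> borel_measurable M" "B n \<in> borel_measurable M" for n unfolding A_def B_def by measurable
    have "tends_in_prob M A 0" unfolding A_def using close by (intro tends_in_prob_cmult) (simp add: \<rho>_def)
    moreover have "\<bar>L n w - Ginf\<bar> \<le> \<bar>A n w\<bar> + B n w" for n w
    proof -
      have "\<rho> n w \<ge> 0" unfolding \<rho>_def by (simp add: sum_nonneg)
      then have "\<bar>A n w\<bar> = q * \<rho> n w" using q by (simp add: A_def)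
      moreover have "sqrt t * (\<delta> + 2 / \<delta> * (\<rho> n w + s m n w)) = sqrt t * \<delta> + q * \<rho> n w + q * s m n w"
        by (simp add: q_def algebra_simps add_divide_distrib)
      moreover have "sqrt t * \<delta> \<le> eps / 4" using \<beta>(2) \<delta> by (metis less_imp_le mult_right_mono)
      ultimately show ?thesis using L_diff[OF \<delta>(1), of n w m] m(2) unfolding B_def by linarith
    qed
    moreover have "\<forall>\<^sub>F n in sequentially. (\<integral>\<^sup>+w. ennreal (B n w) \<partial>M) \<le> ennreal eps"
    proof -
      have "\<forall>\<^sub>F n in sequentially. (\<integral>w. \<bar>Lm m n w - G m\<bar> \<partial>M) < eps / 4"
        using eps by (intro order_tendstoD(2)[OF Lm_lim]) auto
      moreover have "\<forall>\<^sub>F n in sequentially. n \<ge> (1::nat)" by (rule eventually_ge_at_top)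
      ultimately show ?thesis
      proof eventually_elim
        case (elim n)
        have s_int: "integrable M (s m n)" unfolding s_def
          by (intro integrable_mult_right Bochner_Integration.integrable_sum int_tail)
        have "(\<integral>w. s m n w \<partial>M) = 1 / real n * (\<Sum>j<n. \<tau> m)"
          unfolding s_def integral_mult_right_zero
          by (subst Bochner_Integration.integral_sum) (simp_all add: int_tail mean_tail)
        then have s_mean: "(\<integral>w. s m n w \<partial>M) = \<tau> m" using elim(2) by simp
        have Lm1: "0 \<le> Lm m n w" "Lm m n w \<le> 1" for w
        proof -
          show "0 \<le> Lm m n w" unfolding Lm_def by simp
          have "Lm m n w \<le> (\<integral>w'. 1 \<partial>M)"
            unfolding Lm_def using t by (intro integral_mono exp_ints) auto
          then show "Lm m n w \<le> 1" by (simp add: M.prob_space)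
        qed
        have Lm_int: "integrable M (\<lambda>w. \<bar>Lm m n w - G m\<bar>)"
          using Lm1 by (intro Bochner_Integration.integrable_abs Bochner_Integration.integrable_diff
              M.integrable_const_bound[of "Lm m n" 1]) auto
        have B_int: "integrable M (B n)" unfolding B_def using s_int Lm_int by simp
        have "(\<integral>w. B n w \<partial>M) = q * \<tau> m + (\<integral>w. \<bar>Lm m n w - G m\<bar> \<partial>M) + eps / 2"
          unfolding B_def using s_int Lm_int s_mean by (simp add: M.prob_space)
        also have "\<dots> \<le> eps" using elim(1) m(1) by linarith
        finally have "(\<integral>w. B n w \<partial>M) \<le> eps" .
        moreover have "s m n w \<ge> 0" for w unfolding s_def by (simp add: sum_nonneg)
        then have "B n w \<ge> 0" for w unfolding B_def using q eps by (intro add_nonneg_nonneg mult_nonneg_nonneg) auto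
        ultimately show ?case using nn_integral_eq_integral[OF B_int] by (simp add: ennreal_leI)
      qed
    qed
    ultimately show "nearly_bounded M (\<lambda>n w. L n w - Ginf) eps"
      by (intro nearly_boundedI[of A M B]) simp_all
  qed
  then show ?thesis unfolding L_def V_def Ginf_def .
qed

end

section \<open>Regression residuals\<close>

text \<open>Against a function of \<open>U\<close> alone, \<open>V\<close> may be replaced by its
  conditional expectation. In this integrated form the boundedness of the conditional second moments
  of the errors enters.\<close>

lemma (in prob_space) nn_cond_exp_fun_bound:
  assumes U [measurable]: "U \<in> borel_measurable M" and V [measurable]: "V \<in> borel_measurable M"
    and u: "nn_cond_exp_fun M V U u" and bound: "\<And>c. u c \<le> B"
    and \<phi> [measurable]: "\<phi> \<in> borel_measurable borel"
  shows "(\<integral>\<^sup>+x. V x * \<phi> (U x) \<partial>M) \<le> B * (\<integral>\<^sup>+x. \<phi> (U x) \<partial>M)"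
proof -
  let ?F = "vimage_algebra (space M) U borel"
  have sub: "subalgebra M ?F" by (rule subalgebra_vimage_algebra[OF U])
  interpret finite_measure_subalgebra M ?F by unfold_locales (rule sub)
  have "(\<lambda>x. \<phi> (U x)) \<in> borel_measurable ?F"
    by (rule measurable_compose[OF measurable_vimage_algebra1]) auto
  then have "(\<integral>\<^sup>+x. \<phi> (U x) * V x \<partial>M) = (\<integral>\<^sup>+x. \<phi> (U x) * nn_cond_exp M ?F V x \<partial>M)"
    by (intro nn_cond_exp_intg[symmetric]) auto
  also have "\<dots> = (\<integral>\<^sup>+x. \<phi> (U x) * u (U x) \<partial>M)"
    using u unfolding nn_cond_exp_fun_def by (intro nn_integral_cong_AE) (auto elim!: eventually_mono)
  also have "\<dots> \<le> (\<integral>\<^sup>+x. B * \<phi> (U x) \<partial>M)"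
    by (intro nn_integral_mono) (metis bound mult.commute mult_right_mono zero_le)
  also have "\<dots> = B * (\<integral>\<^sup>+x. \<phi> (U x) \<partial>M)" by (rule nn_integral_cmult) simp
  finally show ?thesis by (simp add: mult.commute)
qed

lemma (in prob_space) cond_exp_fun_integral:
  assumes U [measurable]: "U \<in> borel_measurable M" and V [measurable]: "V \<in> borel_measurable M"
    and q: "cond_exp_fun M V U q" and \<phi> [measurable]: "\<phi> \<in> borel_measurable borel"
    and int: "integrable M (\<lambda>x. \<phi> (U x) * V x)"
  shows "(\<integral>x. \<phi> (U x) * V x \<partial>M) = (\<integral>x. \<phi> (U x) * q (U x) \<partial>M)"
proof -
  let ?F = "vimage_algebra (space M) U borel"
  have sub: "subalgebra M ?F" by (rule subalgebra_vimage_algebra[OF U])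
  interpret finite_measure_subalgebra M ?F by unfold_locales (rule sub)
  have q_meas [measurable]: "q \<in> borel_measurable borel" using q unfolding cond_exp_fun_def by simp
  have \<phi>F: "(\<lambda>x. \<phi> (U x)) \<in> borel_measurable ?F"
    by (rule measurable_compose[OF measurable_vimage_algebra1]) auto
  have "(\<integral>x. \<phi> (U x) * V x \<partial>M) = (\<integral>x. \<phi> (U x) * real_cond_exp M ?F V x \<partial>M)"
    by (rule real_cond_exp_intg(2)[OF int \<phi>F, symmetric]) simp
  also have "\<dots> = (\<integral>x. \<phi> (U x) * q (U x) \<partial>M)"
  proof (rule integral_cong_AE)
    show "AE x in M. \<phi> (U x) * real_cond_exp M ?F V x = \<phi> (U x) * q (U x)"
      using q unfolding cond_exp_fun_def by (auto elim!: eventually_mono)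
    show "(\<lambda>x. \<phi> (U x) * real_cond_exp M ?F V x) \<in> borel_measurable M"
      using borel_measurable_cond_exp[of M ?F V] measurable_from_subalg[OF sub] by (intro borel_measurable_times) auto
  qed measurable
  finally show ?thesis .
qed

text \<open>Cauchy-Schwarz, with equality at \<open>sgn v\<close>. In a trivial space there is no
  unit vector, but then \<open>v = 0\<close> and the empty supremum in [0,\<infinity>] is 0
  too.\<close>

lemma SUP_unit_inner_squared:
  fixes v :: "'h::real_inner"
  shows "enn2real (SUP w\<in>{w. norm w = 1}. ennreal ((w \<bullet> v)^2)) = (norm v)^2"
proof -
  have "(SUP w\<in>{w. norm w = 1}. ennreal ((w \<bullet> v)^2)) = ennreal ((norm v)^2)"
  proof (rule antisym)
    show "(SUP w\<in>{w. norm w = 1}. ennreal ((w \<bullet> v)^2)) \<le> ennreal ((norm v)^2)"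
    proof (rule SUP_least, rule ennreal_leI)
      fix w :: 'h assume "w \<in> {w. norm w = 1}"
      then show "(w \<bullet> v)^2 \<le> (norm v)^2"
        using Cauchy_Schwarz_ineq[of w v] by (simp add: dot_square_norm)
    qed
    show "ennreal ((norm v)^2) \<le> (SUP w\<in>{w. norm w = 1}. ennreal ((w \<bullet> v)^2))"
    proof (cases "v = 0")
      case False
      have "sgn v \<bullet> v = norm v" using False by (simp add: sgn_div_norm dot_square_norm power2_eq_square)
      then have "ennreal ((norm v)^2) = ennreal ((sgn v \<bullet> v)^2)" by simp
      also have "\<dots> \<le> (SUP w\<in>{w. norm w = 1}. ennreal ((w \<bullet> v)^2))"
        using False by (intro SUP_upper) (simp add: norm_sgn)
      finally show ?thesis .
    qed simp
  qed
  then show ?thesis by simp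
qed

lemma Psi_stat_eq_norm:
  assumes k: "\<And>w z. fun_of w z = w \<bullet> k z"
  shows "Psi_stat fun_of fest gest X Y Z W n \<omega> =
    (norm ((1 / sqrt (real n)) *\<^sub>R (\<Sum>i<n. W i \<omega> *\<^sub>R ((resid fest X Z n i \<omega> * resid gest Y Z n i \<omega>) *\<^sub>R k (Z i \<omega>)))))^2"
proof -
  let ?r = "\<lambda>i. (resid fest X Z n i \<omega> * resid gest Y Z n i \<omega>) *\<^sub>R k (Z i \<omega>)"
  have "S_stat fest gest X Y Z W n (fun_of w) \<omega> =
    w \<bullet> ((1 / sqrt (real n)) *\<^sub>R (\<Sum>i<n. W i \<omega> *\<^sub>R ?r i))" for w
    by (simp add: S_stat_def k inner_sum_right mult_ac)
  then show ?thesis unfolding Psi_stat_def by (simp only: SUP_unit_inner_squared)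
qed

text \<open>Observation \<open>j\<close> is integrated first, with the others frozen.
  \<open>\<psi>\<close> may involve observation \<open>j\<close>, but only through \<open>p\<close>,
  and \<open>bound\<close> controls the weight \<open>l\<close> against every function of
  \<open>p\<close>. This takes the place of sample splitting: the estimator may have been fitted on
  the very point at which it is evaluated.\<close>

lemma (in prob_space) nn_integral_sample_bound:
  fixes D :: "nat \<Rightarrow> 'a \<Rightarrow> 'e::second_countable_topology" and p :: "'e \<Rightarrow> 'c::topological_space"
  assumes D_indep: "indep_vars (\<lambda>_. borel) D UNIV" and D_law: "\<And>i. distr M borel (D i) = P"
    and l [measurable]: "l \<in> borel_measurable borel" and p [measurable]: "p \<in> borel_measurable borel"
    and bound: "\<And>\<phi>. \<phi> \<in> borel_measurable borel \<Longrightarrow> (\<integral>\<^sup>+x. l x * \<phi> (p x) \<partial>P) \<le> B * (\<integral>\<^sup>+x. \<phi> (p x) \<partial>P)"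
    and \<psi> [measurable]: "\<psi> \<in> borel_measurable (Pi\<^sub>M {..<n} (\<lambda>_. borel))" and j: "j < n"
  shows "(\<integral>\<^sup>+w. l (D j w) * \<psi> (\<lambda>i\<in>{..<n}. p (D i w)) \<partial>M) \<le> B * (\<integral>\<^sup>+w. \<psi> (\<lambda>i\<in>{..<n}. p (D i w)) \<partial>M)"
proof -
  have D_meas [measurable]: "D i \<in> borel_measurable M" for i using D_indep unfolding indep_vars_def by simp
  interpret P: prob_space P unfolding D_law[of 0, symmetric] by (rule prob_space_distr) simp
  have sets_P [measurable_cong]: "sets P = sets borel" unfolding D_law[of 0, symmetric] by simp
  interpret product_sigma_finite "\<lambda>_::nat. P" ..
  define J where "J = {..<n} - {j}"
  have J: "finite J" "j \<notin> J" "{..<n} = insert j J" using j by (auto simp: J_def)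
  have "distr M (\<Pi>\<^sub>M i\<in>{..<n}. borel) (\<lambda>w. \<lambda>i\<in>{..<n}. D i w) = (\<Pi>\<^sub>M i\<in>{..<n}. distr M borel (D i))"
    using j by (intro indep_vars_iff_distr_eq_PiM[THEN iffD1] indep_vars_subset[OF D_indep]) auto
  then have law: "distr M (\<Pi>\<^sub>M i\<in>{..<n}. borel) (\<lambda>w. \<lambda>i\<in>{..<n}. D i w) = (\<Pi>\<^sub>M i\<in>{..<n}. P)"
    by (simp only: D_law)
  let ?u = "\<lambda>x y. \<lambda>i\<in>{..<n}. p ((x(j := y)) i)"
  have transfer: "(\<integral>\<^sup>+w. F (D j w) * \<psi> (\<lambda>i\<in>{..<n}. p (D i w)) \<partial>M) =
      (\<integral>\<^sup>+x. \<integral>\<^sup>+y. F y * \<psi> (?u x y) \<partial>P \<partial>Pi\<^sub>M J (\<lambda>_. P))"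
    if [measurable]: "F \<in> borel_measurable borel" for F
  proof -
    have G: "(\<lambda>d. F (d j) * \<psi> (\<lambda>i\<in>{..<n}. p (d i))) \<in> borel_measurable (\<Pi>\<^sub>M i\<in>{..<n}. borel)"
    proof -
      have [measurable]: "(\<lambda>d. \<lambda>i\<in>{..<n}. p (d i)) \<in> (\<Pi>\<^sub>M i\<in>{..<n}. borel) \<rightarrow>\<^sub>M (\<Pi>\<^sub>M i\<in>{..<n}. borel)"
        by (intro measurable_restrict measurable_compose[OF measurable_component_singleton[of _ "{..<n}" "\<lambda>_. borel"] p])
      have [measurable]: "(\<lambda>d. d j) \<in> (\<Pi>\<^sub>M i\<in>{..<n}. borel) \<rightarrow>\<^sub>M borel"
        using j by (intro measurable_component_singleton) simp
      show ?thesis by measurable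
    qed
    have "(\<integral>\<^sup>+w. F (D j w) * \<psi> (\<lambda>i\<in>{..<n}. p (D i w)) \<partial>M) =
        (\<integral>\<^sup>+w. F ((\<lambda>i\<in>{..<n}. D i w) j) * \<psi> (\<lambda>i\<in>{..<n}. p ((\<lambda>i\<in>{..<n}. D i w) i)) \<partial>M)"
      using j by (intro nn_integral_cong) (simp cong: restrict_cong)
    also have "\<dots> = (\<integral>\<^sup>+d. F (d j) * \<psi> (\<lambda>i\<in>{..<n}. p (d i)) \<partial>(\<Pi>\<^sub>M i\<in>{..<n}. P))"
      unfolding law[symmetric] by (subst nn_integral_distr) (use G in auto)
    also have "\<dots> = (\<integral>\<^sup>+x. \<integral>\<^sup>+y. F ((x(j := y)) j) * \<psi> (?u x y) \<partial>P \<partial>Pi\<^sub>M J (\<lambda>_. P))"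
      unfolding J(3)
    proof (rule product_nn_integral_insert[OF J(1,2)])
      show "(\<lambda>d. F (d j) * \<psi> (\<lambda>i\<in>insert j J. p (d i))) \<in> borel_measurable (\<Pi>\<^sub>M i\<in>insert j J. P)"
        using G unfolding J(3) by (simp cong: measurable_cong_sets sets_PiM_cong add: sets_P)
    qed
    finally show ?thesis by simp
  qed
  have ineq: "(\<integral>\<^sup>+y. l y * \<psi> (?u x y) \<partial>P) \<le> (\<integral>\<^sup>+y. B * \<psi> (?u x y) \<partial>P)" for x
  proof -
    \<comment> \<open>With the other coordinates frozen in \<open>x\<close>, the sample function
      depends on \<open>y\<close> through the single value \<open>c = p y\<close>, as
      \<open>bound\<close> requires.\<close>
    define \<phi> where "\<phi> c = \<psi> (\<lambda>i\<in>{..<n}. if i = j then c else p (x i))" for c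
    have "(\<lambda>c. \<lambda>i\<in>{..<n}. if i = j then c else p (x i)) \<in> borel \<rightarrow>\<^sub>M (\<Pi>\<^sub>M i\<in>{..<n}. borel)" by measurable
    then have [measurable]: "\<phi> \<in> borel_measurable borel" unfolding \<phi>_def by measurable
    have "\<psi> (?u x y) = \<phi> (p y)" for y
      unfolding \<phi>_def by (rule arg_cong[of _ _ \<psi>]) auto
    then show ?thesis using bound[of \<phi>] by (simp add: nn_integral_cmult)
  qed
  have "(\<integral>\<^sup>+w. l (D j w) * \<psi> (\<lambda>i\<in>{..<n}. p (D i w)) \<partial>M) \<le> (\<integral>\<^sup>+w. B * \<psi> (\<lambda>i\<in>{..<n}. p (D i w)) \<partial>M)"
    unfolding transfer[OF l] transfer[of "\<lambda>_. B", OF borel_measurable_const] by (rule nn_integral_mono) (rule ineq)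
  also have "\<dots> = B * (\<integral>\<^sup>+w. \<psi> (\<lambda>i\<in>{..<n}. p (D i w)) \<partial>M)" by (rule nn_integral_cmult) measurable
  finally show ?thesis .
qed

lemma ennreal_scaled_sum:
  assumes "c \<ge> 0" "\<And>j. f j \<ge> 0" "\<And>j. g j \<ge> 0"
  shows "ennreal (c * (\<Sum>j\<in>J. f j * g j)) = ennreal c * (\<Sum>j\<in>J. ennreal (f j) * ennreal (g j))"
proof -
  have "(\<Sum>j\<in>J. ennreal (f j) * ennreal (g j)) = ennreal (\<Sum>j\<in>J. f j * g j)"
    using assms by (simp add: ennreal_mult[symmetric])
  then show ?thesis using assms by (simp add: ennreal_mult sum_nonneg)
qed

text \<open>The unweighted average is small only in probability and may have no finite mean, so it
  is truncated. On the event that it is at most \<open>\<eta>\<close>, the weighted average has mean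
  at most \<open>B * \<eta>\<close>; the complementary event has vanishing probability.\<close>

lemma (in prob_space) tends_in_prob_weighted_average:
  fixes D :: "nat \<Rightarrow> 'a \<Rightarrow> 'e::second_countable_topology" and p :: "'e \<Rightarrow> 'c::topological_space"
    and l :: "'e \<Rightarrow> real" and E :: "nat \<Rightarrow> nat \<Rightarrow> (nat \<Rightarrow> 'c) \<Rightarrow> real"
  assumes D_indep: "indep_vars (\<lambda>_. borel) D UNIV" and D_law: "\<And>i. distr M borel (D i) = P"
    and l [measurable]: "l \<in> borel_measurable borel" and l_nonneg: "\<And>x. l x \<ge> 0" and p [measurable]: "p \<in> borel_measurable borel"
    and bound: "\<And>\<phi>. \<phi> \<in> borel_measurable borel \<Longrightarrow> (\<integral>\<^sup>+x. ennreal (l x) * \<phi> (p x) \<partial>P) \<le> ennreal B * (\<integral>\<^sup>+x. \<phi> (p x) \<partial>P)"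
    and E [measurable]: "\<And>n j. j < n \<Longrightarrow> E n j \<in> borel_measurable (Pi\<^sub>M {..<n} (\<lambda>_. borel))"
    and E_nonneg: "\<And>n j c. E n j c \<ge> 0"
    and lim: "tends_in_prob M (\<lambda>n w. 1 / real n * (\<Sum>j<n. E n j (\<lambda>i\<in>{..<n}. p (D i w)))) 0"
  shows "tends_in_prob M (\<lambda>n w. 1 / real n * (\<Sum>j<n. l (D j w) * E n j (\<lambda>i\<in>{..<n}. p (D i w)))) 0"
proof (rule tends_in_probI)
  fix e :: real assume e: "e > 0"
  have D_meas [measurable]: "D i \<in> borel_measurable M" for i using D_indep unfolding indep_vars_def by simp
  define C where "C n w = (\<lambda>i\<in>{..<n}. p (D i w))" for n w
  have [measurable]: "C n \<in> M \<rightarrow>\<^sub>M Pi\<^sub>M {..<n} (\<lambda>_. borel)" for n unfolding C_def by measurable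
  define avg where "avg n c = 1 / real n * (\<Sum>j<n. E n j c)" for n c
  have avg_meas [measurable]: "avg n \<in> borel_measurable (Pi\<^sub>M {..<n} (\<lambda>_. borel))" for n unfolding avg_def by measurable
  define \<eta> where "\<eta> = e / (\<bar>B\<bar> + 1)"
  have \<eta>: "\<eta> > 0" "\<bar>B\<bar> * \<eta> \<le> e" using e by (auto simp: \<eta>_def field_simps add_nonneg_pos)
  \<comment> \<open>The truncation indicator depends only on the \<open>p\<close>-parts of the
    sample, so it can be absorbed into the function to which the coordinatewise bound is
    applied.\<close>
  define I where "I n c = (if avg n c \<le> \<eta> then 1 else 0 :: real)" for n c
  have I_meas [measurable]: "I n \<in> borel_measurable (Pi\<^sub>M {..<n} (\<lambda>_. borel))" for n unfolding I_def by measurable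
  define R where "R n w = 1 / real n * (\<Sum>j<n. l (D j w) * E n j (C n w))" for n w
  have [measurable]: "R n \<in> borel_measurable M" for n unfolding R_def by measurable
  have R_nonneg: "R n w \<ge> 0" for n w unfolding R_def by (intro mult_nonneg_nonneg sum_nonneg l_nonneg E_nonneg) simp
  define S where "S n w = R n w * (1 - I n (C n w))" for n w
  define T where "T n w = R n w * I n (C n w)" for n w
  have [measurable]: "S n \<in> borel_measurable M" "T n \<in> borel_measurable M" for n unfolding S_def T_def by measurable
  have "tends_in_prob M S 0"
    unfolding tends_in_prob_def
  proof (intro allI impI)
    fix d :: real assume d: "d > 0"
    have "(\<lambda>n. prob {w \<in> space M. \<bar>avg n (C n w) - 0\<bar> > \<eta>}) \<longlonglongrightarrow> 0"
      using tends_in_probD[OF lim \<eta>(1)] by (simp add: avg_def C_def)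
    moreover have "prob {w \<in> space M. \<bar>S n w - 0\<bar> > d} \<le> prob {w \<in> space M. \<bar>avg n (C n w) - 0\<bar> > \<eta>}" for n
      using d by (intro finite_measure_mono) (auto simp: S_def I_def)
    ultimately show "(\<lambda>n. prob {w \<in> space M. \<bar>S n w - 0\<bar> > d}) \<longlonglongrightarrow> 0"
      by (rule real_squeeze_0) simp
  qed
  moreover have "\<bar>R n w - 0\<bar> \<le> \<bar>S n w\<bar> + T n w" for n w
    using R_nonneg[of n w] by (simp add: S_def T_def I_def)
  moreover have "(\<integral>\<^sup>+w. ennreal (T n w) \<partial>M) \<le> ennreal e" for n
  proof -
    let ?G = "\<lambda>j w. E n j (C n w) * I n (C n w)"
    have T_eq: "ennreal (T n w) = ennreal (1 / real n) * (\<Sum>j<n. ennreal (l (D j w)) * ennreal (?G j w))" for w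
    proof -
      have "T n w = 1 / real n * (\<Sum>j<n. l (D j w) * (?G j w))"
        by (simp add: T_def R_def sum_distrib_right sum_distrib_left mult_ac)
      also have "ennreal \<dots> = ennreal (1 / real n) * (\<Sum>j<n. ennreal (l (D j w)) * ennreal (?G j w))"
        by (rule ennreal_scaled_sum) (use l_nonneg E_nonneg in \<open>simp_all add: I_def\<close>)
      finally show ?thesis .
    qed
    have "(\<integral>\<^sup>+w. ennreal (T n w) \<partial>M) = ennreal (1 / real n) * (\<Sum>j<n. \<integral>\<^sup>+w. ennreal (l (D j w)) * ennreal (?G j w) \<partial>M)"
      unfolding T_eq by (subst nn_integral_cmult, measurable, subst nn_integral_sum, measurable)
    also have "\<dots> \<le> ennreal (1 / real n) * (\<Sum>j<n. ennreal B * (\<integral>\<^sup>+w. ennreal (?G j w) \<partial>M))"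
    proof (intro mult_left_mono sum_mono)
      fix j assume "j \<in> {..<n}"
      then have j: "j < n" by simp
      show "(\<integral>\<^sup>+w. ennreal (l (D j w)) * ennreal (?G j w) \<partial>M) \<le>
          ennreal B * (\<integral>\<^sup>+w. ennreal (?G j w) \<partial>M)"
        unfolding C_def
      proof (rule nn_integral_sample_bound[OF D_indep D_law _ p _ _ j])
        show "(\<lambda>c. ennreal (E n j c * I n c)) \<in> borel_measurable (Pi\<^sub>M {..<n} (\<lambda>_. borel))"
          using E[OF j] by measurable
      qed (use bound in simp_all)
    qed simp
    also have "\<dots> = ennreal B * (\<integral>\<^sup>+w. ennreal (1 / real n) * (\<Sum>j<n. ennreal (?G j w)) \<partial>M)"
      by (subst nn_integral_cmult, measurable, subst nn_integral_sum, measurable) (simp add: sum_distrib_left[symmetric] mult_ac)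
    also have "\<dots> \<le> ennreal B * (\<integral>\<^sup>+w. ennreal \<eta> \<partial>M)"
    proof (intro mult_left_mono nn_integral_mono)
      fix w
      have "ennreal (1 / real n) * (\<Sum>j<n. ennreal (?G j w)) = ennreal (avg n (C n w) * I n (C n w))"
      proof -
        have "avg n (C n w) * I n (C n w) = 1 / real n * (\<Sum>j<n. 1 * (?G j w))"
          by (simp add: avg_def sum_distrib_right)
        also have "ennreal \<dots> = ennreal (1 / real n) * (\<Sum>j<n. ennreal 1 * ennreal (?G j w))"
          by (rule ennreal_scaled_sum) (use E_nonneg in \<open>simp_all add: I_def\<close>)
        finally show ?thesis by simp
      qed
      also have "\<dots> \<le> ennreal \<eta>" using \<eta> by (intro ennreal_leI) (simp add: I_def)
      finally show "ennreal (1 / real n) * (\<Sum>j<n. ennreal (?G j w)) \<le> ennreal \<eta>" .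
    qed simp
    also have "\<dots> \<le> ennreal (\<bar>B\<bar> * \<eta>)"
      using \<eta> by (simp add: emeasure_space_1 ennreal_mult mult_right_mono ennreal_leI)
    also have "\<dots> \<le> ennreal e" using \<eta> by (intro ennreal_leI) simp
    finally show ?thesis .
  qed
  ultimately show "nearly_bounded M (\<lambda>n w. 1 / real n * (\<Sum>j<n. l (D j w) * E n j (\<lambda>i\<in>{..<n}. p (D i w))) - 0) e"
    unfolding R_def C_def by (intro nearly_boundedI[of S M T]) simp_all
qed

lemma borel_measurable_fst_snd [measurable]:
  "fst \<in> borel_measurable (borel :: ('a::second_countable_topology \<times> 'b::second_countable_topology) measure)"
  "snd \<in> borel_measurable (borel :: ('a::second_countable_topology \<times> 'b::second_countable_topology) measure)"
  by (auto simp flip: borel_prod)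

lemma (in prob_space) tends_in_prob_AE_cong:
  assumes "\<And>n. AE w in M. R n w = S n w" and [measurable]: "\<And>n. R n \<in> borel_measurable M" "\<And>n. S n \<in> borel_measurable M"
    and S: "tends_in_prob M S c"
  shows "tends_in_prob M R c"
proof -
  have "measure M {w \<in> space M. \<bar>R n w - c\<bar> > e} = measure M {w \<in> space M. \<bar>S n w - c\<bar> > e}" for n e
  proof -
    have "emeasure M {w \<in> space M. \<bar>R n w - c\<bar> > e} = emeasure M {w \<in> space M. \<bar>S n w - c\<bar> > e}"
      by (rule emeasure_eq_AE) (use assms(1)[of n] in \<open>auto elim!: eventually_mono\<close>)
    then show ?thesis by (simp add: measure_def)
  qed
  then show ?thesis using S unfolding tends_in_prob_def by simp
qed

text \<open>The first n observations are a measurable function of the whole sequence, so they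
  generate a smaller sigma-algebra and independence is inherited.\<close>

lemma indep_seqs_data_sigma:
  fixes D :: "nat \<Rightarrow> 'a \<Rightarrow> 'b::topological_space" and W :: "nat \<Rightarrow> 'a \<Rightarrow> 'c::topological_space"
  assumes M: "prob_space M" and indep: "indep_seqs M D W" and D: "\<And>i. D i \<in> borel_measurable M"
  shows "prob_space.indep_set M
    (sets (vimage_algebra (space M) (\<lambda>w. \<lambda>i\<in>{..<n}. D i w) (Pi\<^sub>M {..<n} (\<lambda>_. borel))))
    (sets (vimage_algebra (space M) (\<lambda>w i. W i w) (Pi\<^sub>M UNIV (\<lambda>_. borel))))"
proof -
  interpret prob_space M by fact
  let ?A = "vimage_algebra (space M) (\<lambda>w. \<lambda>i\<in>{..<n}. D i w) (Pi\<^sub>M {..<n} (\<lambda>_. borel))"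
  let ?B = "vimage_algebra (space M) (\<lambda>w i. D i w) (Pi\<^sub>M UNIV (\<lambda>_. borel))"
  let ?C = "vimage_algebra (space M) (\<lambda>w i. W i w) (Pi\<^sub>M UNIV (\<lambda>_. borel))"
  have ind: "indep_set (sets ?B) (sets ?C)" using indep unfolding indep_seqs_def .
  have "sets ?A \<subseteq> sets ?B"
  proof
    fix E assume "E \<in> sets ?A"
    then obtain E' where E': "E' \<in> sets (Pi\<^sub>M {..<n} (\<lambda>_. borel :: 'b measure))"
      and E: "E = (\<lambda>w. \<lambda>i\<in>{..<n}. D i w) -` E' \<inter> space M"
      by (auto simp: sets_vimage_algebra2 space_PiM)
    have "(\<lambda>d. restrict d {..<n}) \<in> Pi\<^sub>M UNIV (\<lambda>_. borel :: 'b measure) \<rightarrow>\<^sub>M Pi\<^sub>M {..<n} (\<lambda>_. borel)"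
      by (rule measurable_restrict_subset) simp
    from measurable_sets[OF this E']
    have "(\<lambda>d. restrict d {..<n}) -` E' \<inter> UNIV \<in> sets (Pi\<^sub>M UNIV (\<lambda>_. borel :: 'b measure))"
      by (simp add: space_PiM)
    from in_vimage_algebra[OF this, of "\<lambda>w i. D i w" "space M"] show "E \<in> sets ?B" unfolding E by (simp add: vimage_def)
  qed
  then show ?thesis
    using indep_setD[OF ind] indep_setD_ev1[OF ind] indep_setD_ev2[OF ind]
    by (intro indep_setI) auto
qed

text \<open>\<open>p\<close> extracts the part of an observation seen by the estimator, and
  \<open>l\<close> will be the squared error of the other regression. The squared estimation error
  is a function of the \<open>p\<close>-sample alone, so the weighted average lemma applies; both
  regressions are instances.\<close>

lemma (in prob_space) estimation_error_negligible:
  fixes D :: "nat \<Rightarrow> 'a \<Rightarrow> 'e::second_countable_topology" and p :: "'e \<Rightarrow> real \<times> 'z::second_countable_topology"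
    and l :: "'e \<Rightarrow> real"
  assumes D_indep: "indep_vars (\<lambda>_. borel) D UNIV" and D_law: "\<And>i. distr M borel (D i) = P"
    and l [measurable]: "l \<in> borel_measurable borel" and l_nonneg: "\<And>x. l x \<ge> 0" and p [measurable]: "p \<in> borel_measurable borel"
    and bound: "\<And>\<phi>. \<phi> \<in> borel_measurable borel \<Longrightarrow> (\<integral>\<^sup>+x. ennreal (l x) * \<phi> (p x) \<partial>P) \<le> ennreal B * (\<integral>\<^sup>+x. \<phi> (p x) \<partial>P)"
    and est: "estimator est" and g [measurable]: "g \<in> borel_measurable borel"
  defines "\<delta> n j w \<equiv> g (snd (p (D j w))) - est n (\<lambda>i\<in>{..<n}. p (D i w)) (snd (p (D j w)))"
  assumes err: "small_o_p M (\<lambda>n w. 1 / real n * (\<Sum>j<n. (\<delta> n j w)^2)) (\<lambda>n. real n powr (- 1 / 2))"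
  shows "\<And>n j. j < n \<Longrightarrow> \<delta> n j \<in> borel_measurable M"
    and "tends_in_prob M (\<lambda>n w. 1 / real n * (\<Sum>j<n. l (D j w) * (\<delta> n j w)^2)) 0"
proof -
  have D_meas [measurable]: "D i \<in> borel_measurable M" for i using D_indep unfolding indep_vars_def by simp
  \<comment> \<open>The estimate is evaluated at a data point only, since measurability of an
    estimator is assumed only there.\<close>
  define E where "E n j c = (g (snd (c j)) - est n c (snd (c j)))^2" for n j and c :: "nat \<Rightarrow> real \<times> 'z"
  have est_meas [measurable]: "(\<lambda>c. est n c (snd (c j))) \<in> borel_measurable (Pi\<^sub>M {..<n} (\<lambda>_. borel))" if "j < n" for n j
    using est that unfolding estimator_def by simp
  have comp [measurable]: "(\<lambda>c. snd (c j)) \<in> borel_measurable (Pi\<^sub>M {..<n} (\<lambda>_. borel :: (real \<times> 'z) measure))" if "j < n" for n j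
    using that by (intro measurable_compose[OF measurable_component_singleton[of j "{..<n}" "\<lambda>_. borel"] borel_measurable_fst_snd(2)]) simp
  have sample [measurable]: "(\<lambda>w. \<lambda>i\<in>{..<n}. p (D i w)) \<in> M \<rightarrow>\<^sub>M Pi\<^sub>M {..<n} (\<lambda>_. borel)" for n by measurable
  have E_eq: "E n j (\<lambda>i\<in>{..<n}. p (D i w)) = (\<delta> n j w)^2" if "j < n" for n j w
    using that by (simp add: E_def \<delta>_def)
  have E_sum: "(\<Sum>j<n. b j * E n j (\<lambda>i\<in>{..<n}. p (D i w))) = (\<Sum>j<n. b j * (\<delta> n j w)^2)" for n w and b :: "nat \<Rightarrow> real"
    by (intro sum.cong refl) (simp only: E_eq lessThan_iff)
  show \<delta>_meas [measurable]: "\<delta> n j \<in> borel_measurable M" if "j < n" for n j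
  proof -
    have "(\<lambda>w. est n (\<lambda>i\<in>{..<n}. p (D i w)) (snd ((\<lambda>i\<in>{..<n}. p (D i w)) j))) \<in> borel_measurable M"
      by (rule measurable_compose[OF sample est_meas[OF that]])
    then show ?thesis unfolding \<delta>_def using that by simp
  qed
  define A where "A n w = 1 / real n * (\<Sum>j<n. (\<delta> n j w)^2)" for n w
  have A_meas [measurable]: "A n \<in> borel_measurable M" for n unfolding A_def by measurable
  have "tends_in_prob M A 0"
  proof (rule tends_in_prob_dominated)
    show "tends_in_prob M (\<lambda>n w. A n w / real n powr (- 1 / 2)) 0"
      using err unfolding small_o_p_def A_def .
    show "\<forall>\<^sub>F n in sequentially. \<forall>w\<in>space M. \<bar>A n w - 0\<bar> \<le> \<bar>A n w / real n powr (- 1 / 2)\<bar>"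
    proof (rule eventually_sequentiallyI[of 1], intro ballI)
      fix n :: nat and w assume "n \<ge> 1"
      then have pos: "real n powr (- 1 / 2) > 0" by simp
      \<comment> \<open>For positive n the rate is at most 1, so dividing by it can only enlarge the
        average.\<close>
      have le1: "real n powr (- 1 / 2) \<le> 1" using powr_mono[of "- 1 / 2" 0 "real n"] \<open>n \<ge> 1\<close> by simp
      have "\<bar>A n w\<bar> * real n powr (- 1 / 2) \<le> \<bar>A n w\<bar> * 1" by (intro mult_left_mono le1) simp
      then show "\<bar>A n w - 0\<bar> \<le> \<bar>A n w / real n powr (- 1 / 2)\<bar>" using pos by (simp add: pos_le_divide_eq)
    qed
  qed measurable
  then have "tends_in_prob M (\<lambda>n w. 1 / real n * (\<Sum>j<n. E n j (\<lambda>i\<in>{..<n}. p (D i w)))) 0"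
    using E_sum[of "\<lambda>_. 1"] unfolding A_def mult_1 by (simp only:)
  note lim = this
  have "E n j \<in> borel_measurable (Pi\<^sub>M {..<n} (\<lambda>_. borel))" if "j < n" for n j
    unfolding E_def using that by measurable
  moreover have "E n j c \<ge> 0" for n j c by (simp add: E_def)
  ultimately show "tends_in_prob M (\<lambda>n w. 1 / real n * (\<Sum>j<n. l (D j w) * (\<delta> n j w)^2)) 0"
    using tends_in_prob_weighted_average[OF D_indep D_law l l_nonneg p bound _ _ lim] unfolding E_sum by blast
qed

text \<open>Each \<open>b j\<close> is at most the total. For the two squared estimation errors this
  costs a factor n on the averages, for which the two rates n^(-1/2) pay together.\<close>

lemma sum_mult_le_mult_sum:
  fixes b c :: "'i \<Rightarrow> real"
  assumes "finite J" "\<And>j. b j \<ge> 0" "\<And>j. c j \<ge> 0"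
  shows "(\<Sum>j\<in>J. b j * c j) \<le> (\<Sum>j\<in>J. b j) * (\<Sum>j\<in>J. c j)"
proof -
  have "(\<Sum>j\<in>J. b j * c j) \<le> (\<Sum>j\<in>J. (\<Sum>j\<in>J. b j) * c j)"
    using assms by (intro sum_mono mult_right_mono member_le_sum) auto
  then show ?thesis by (simp add: sum_distrib_left)
qed

section \<open>The multiplier bootstrap\<close>

theorem theorem23:
  fixes P :: "(real \<times> real \<times> (real ^ 'd)) measure"
    and M :: "'a measure"
    and X Y W Q :: "nat \<Rightarrow> 'a \<Rightarrow> real"
    and Z :: "nat \<Rightarrow> 'a \<Rightarrow> real ^ 'd"
    and f g q :: "real ^ 'd \<Rightarrow> real"
    and uf vg :: "(real ^ 'd) \<times> real \<Rightarrow> ennreal"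
    and fest gest :: "nat \<Rightarrow> (nat \<Rightarrow> real \<times> (real ^ 'd)) \<Rightarrow> real ^ 'd \<Rightarrow> real"
    and fun_of :: "'h::{real_inner, complete_space, second_countable_topology} \<Rightarrow> real ^ 'd \<Rightarrow> real"
    and K :: "real ^ 'd \<Rightarrow> real ^ 'd \<Rightarrow> real"
    and lam :: "nat \<Rightarrow> real"
  assumes M: "prob_space M"
    and P: "prob_space P" "sets P = sets borel"
    and data_indep: "prob_space.indep_vars M (\<lambda>_. borel) (\<lambda>i \<omega>. (X i \<omega>, Y i \<omega>, Z i \<omega>)) UNIV"
    and data_law: "\<And>i. distr M borel (\<lambda>\<omega>. (X i \<omega>, Y i \<omega>, Z i \<omega>)) = P"
    and X_integrable: "integrable P (\<lambda>(x, y, z). x)"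
    and Y_integrable: "integrable P (\<lambda>(x, y, z). y)"
    and f: "cond_exp_fun P (\<lambda>(x, y, z). x) (\<lambda>(x, y, z). z) f"
    and g: "cond_exp_fun P (\<lambda>(x, y, z). y) (\<lambda>(x, y, z). z) g"
    and fest: "estimator fest"
    and gest: "estimator gest"
    and H: "rkhs fun_of K"
    and H_borel: "\<And>w. fun_of w \<in> borel_measurable borel"
    and A_f: "small_o_p M (avg_sq_error f fest X Z) (\<lambda>n. real n powr (- 1 / 2))"
    and A_g: "small_o_p M (avg_sq_error g gest Y Z) (\<lambda>n. real n powr (- 1 / 2))"
    and uf: "nn_cond_exp_fun P (\<lambda>(x, y, z). ennreal ((x - f z)\<^sup>2)) (\<lambda>(x, y, z). (z, y)) uf"
    and uf_bounded: "\<exists>B::real. \<forall>z y. uf (z, y) \<le> ennreal B"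
    and vg: "nn_cond_exp_fun P (\<lambda>(x, y, z). ennreal ((y - g z)\<^sup>2)) (\<lambda>(x, y, z). (z, x)) vg"
    and vg_bounded: "\<exists>B::real. \<forall>z x. vg (z, x) \<le> ennreal B"
    and pos: "0 < (\<integral>(x, y, z). (x - f z)\<^sup>2 * (y - g z)\<^sup>2 \<partial>P)"
    and K_bounded: "\<exists>C>0. \<forall>z z'. \<bar>K z z'\<bar> \<le> C"
    and W_indep: "prob_space.indep_vars M (\<lambda>_. borel) W UNIV"
    and W_law: "\<And>i. distr M borel (W i) = distr M borel (W 0)"
    and W_integrable: "integrable M (W 0)"
    and W_mean: "(\<integral>\<omega>. W 0 \<omega> \<partial>M) = 0"
    and W_var: "(\<integral>\<omega>. (W 0 \<omega>)\<^sup>2 \<partial>M) = 1"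
    and W_data: "indep_seqs M (\<lambda>i \<omega>. (X i \<omega>, Y i \<omega>, Z i \<omega>)) W"
    and Q_indep: "prob_space.indep_vars M (\<lambda>_. borel) Q UNIV"
    and Q_normal: "\<And>i. distributed M lborel (Q i) std_normal_density"
    and Q_data: "indep_seqs M (\<lambda>i \<omega>. (X i \<omega>, Y i \<omega>, Z i \<omega>)) Q"
    and q: "cond_exp_fun P (\<lambda>(x, y, z). (x - f z)\<^sup>2 * (y - g z)\<^sup>2) (\<lambda>(x, y, z). z) q"
    and lam: "lists_eigenvalues
        (T_op fun_of K (sigma_form (distr P borel (\<lambda>(x, y, z). z)) q)) lam"
  shows "conv_in_dist_given M (\<lambda>i \<omega>. (X i \<omega>, Y i \<omega>, Z i \<omega>))
           (Psi_stat fun_of fest gest X Y Z W)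
           (\<lambda>\<omega>. \<Sum>i. lam i * (Q i \<omega>)\<^sup>2)"
proof -
  interpret M: prob_space M by (rule M)
  interpret P: prob_space P by (rule P(1))
  note sets_P [measurable_cong] = P(2)
  have space_P: "space P = UNIV" using sets_eq_imp_space_eq[OF P(2)] by simp
  define D where "D i w = (X i w, Y i w, Z i w)" for i w
  have D_indep: "M.indep_vars (\<lambda>_. borel) D UNIV" using data_indep unfolding D_def .
  have D_law: "distr M borel (D i) = P" for i using data_law[of i] unfolding D_def .
  have D_meas [measurable]: "D i \<in> borel_measurable M" for i using D_indep unfolding M.indep_vars_def by simp
  have [measurable]: "f \<in> borel_measurable borel" "g \<in> borel_measurable borel" "q \<in> borel_measurable borel"
    using f g q unfolding cond_exp_fun_def by auto
  define zz where "zz d = snd (snd d)" for d :: "real \<times> real \<times> (real ^ 'd)"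
  define eX where "eX d = fst d - f (zz d)" for d :: "real \<times> real \<times> (real ^ 'd)"
  define eY where "eY d = fst (snd d) - g (zz d)" for d :: "real \<times> real \<times> (real ^ 'd)"
  have [measurable]: "zz \<in> borel_measurable borel" "eX \<in> borel_measurable borel" "eY \<in> borel_measurable borel"
    unfolding zz_def eX_def eY_def by measurable

  \<comment> \<open>Kernel sections as measurable vectors of bounded norm\<close>
  have "\<forall>z. \<exists>k. fun_of k = K z \<and> (\<forall>u. fun_of u z = u \<bullet> k)" using H unfolding rkhs_def by blast
  from choice[OF this] obtain k where k_fun: "\<And>z. fun_of (k z) = K z" and k: "\<And>u z. fun_of u z = u \<bullet> k z"
    by blast
  have inj: "inj fun_of" using H unfolding rkhs_def by simp
  have [measurable]: "k \<in> borel_measurable borel"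
  proof (rule borel_measurable_weakly)
    fix u
    have "(\<lambda>z. k z \<bullet> u) = fun_of u" by (rule ext) (simp add: k inner_commute)
    then show "(\<lambda>z. k z \<bullet> u) \<in> borel_measurable borel" using H_borel by simp
  qed
  obtain C where C: "C > 0" "\<And>z z'. \<bar>K z z'\<bar> \<le> C" using K_bounded by blast
  have k_norm: "(norm (k z))^2 \<le> C" for z
  proof -
    have "(norm (k z))^2 = K z z" using k[of "k z" z] by (simp add: k_fun dot_square_norm)
    then show ?thesis using C(2)[of z z] by simp
  qed

  \<comment> \<open>The limiting summands and their covariance form\<close>
  define a where "a d = (eX d * eY d) *\<^sub>R k (zz d)" for d
  have a_meas [measurable]: "a \<in> borel_measurable borel" unfolding a_def by measurable
  have a_P: "a \<in> borel_measurable P" by measurable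
  have V_eq: "(\<lambda>(x, y, z). (x - f z)^2 * (y - g z)^2) = (\<lambda>d. (eX d)^2 * (eY d)^2)"
    by (simp add: fun_eq_iff eX_def eY_def zz_def)
  have zz_eq: "(\<lambda>(x, y, z). z) = zz" by (simp add: fun_eq_iff zz_def)
  \<comment> \<open>A Bochner integral defaults to 0 for a nonintegrable function, so positivity of
    this one certifies a finite second moment of the product of errors.\<close>
  have V_int: "integrable P (\<lambda>d. (eX d)^2 * (eY d)^2)"
    using pos not_integrable_integral_eq[of P "\<lambda>d. (eX d)^2 * (eY d)^2"] unfolding V_eq by force
  have sq: "integrable P (\<lambda>d. (norm (a d))^2)"
  proof (rule Bochner_Integration.integrable_bound[OF integrable_mult_right[OF V_int, of C]])
    show "AE d in P. norm ((norm (a d))^2) \<le> norm (C * ((eX d)^2 * (eY d)^2))"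
    proof (rule AE_I2)
      fix d
      have "(norm (a d))^2 = ((eX d)^2 * (eY d)^2) * (norm (k (zz d)))^2"
        by (simp add: a_def power_mult_distrib)
      also have "\<dots> \<le> ((eX d)^2 * (eY d)^2) * C" by (intro mult_left_mono k_norm) simp
      finally show "norm ((norm (a d))^2) \<le> norm (C * ((eX d)^2 * (eY d)^2))"
        using C(1) by (simp add: mult.commute abs_mult)
    qed
  qed measurable

  \<comment> \<open>\<open>q\<close> is integrated only against functions of z, where it may be
    exchanged for the product of the squared errors. Hence the operator of the statement is the
    covariance operator of \<open>a\<close>.\<close>
  have form: "sigma_form (distr P borel (\<lambda>(x, y, z). z)) q (fun_of u) (fun_of v) = cov_form P a u v" for u v
  proof -
    define \<phi> where "\<phi> z = fun_of u z * fun_of v z" for z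
    have \<phi> [measurable]: "\<phi> \<in> borel_measurable borel" unfolding \<phi>_def using H_borel by measurable
    have eq: "(a d \<bullet> u) * (a d \<bullet> v) = \<phi> (zz d) * ((eX d)^2 * (eY d)^2)" for d
      by (simp add: a_def \<phi>_def k inner_commute power2_eq_square)
    have "sigma_form (distr P borel (\<lambda>(x, y, z). z)) q (fun_of u) (fun_of v) = (\<integral>d. \<phi> (zz d) * q (zz d) \<partial>P)"
      unfolding sigma_form_def zz_eq \<phi>_def[symmetric] by (subst integral_distr) auto
    also have "\<dots> = (\<integral>d. \<phi> (zz d) * ((eX d)^2 * (eY d)^2) \<partial>P)"
      using cov_form_integrable[OF a_P sq, of u v] q unfolding eq V_eq zz_eq
      by (intro P.cond_exp_fun_integral[symmetric]) measurable
    also have "\<dots> = cov_form P a u v" unfolding cov_form_def eq ..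
    finally show ?thesis .
  qed
  obtain T where T: "\<And>u v. cov_form P a u v = T u \<bullet> v" using cov_form_riesz[OF a_P sq] by blast
  have "T_op fun_of K (sigma_form (distr P borel (\<lambda>(x, y, z). z)) q) = T"
  proof
    fix u
    \<comment> \<open>The reproducing property turns values at z into inner products with
      \<open>k z\<close>, so \<open>T u\<close> meets the description defining \<open>T_op\<close>;
      injectivity of \<open>fun_of\<close> makes it the only candidate.\<close>
    have "sigma_form (distr P borel (\<lambda>(x, y, z). z)) q (fun_of u) (K z) = fun_of (T u) z" for z
      using form[of u "k z"] by (simp add: k_fun T k)
    then show "T_op fun_of K (sigma_form (distr P borel (\<lambda>(x, y, z). z)) q) u = T u"
      unfolding T_op_def using inj by (intro the_equality) (auto simp: inj_eq fun_eq_iff[symmetric])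
  qed
  then have lam_T: "lists_eigenvalues T lam" using lam by simp

  interpret iid_multipliers M "distr M borel (W 0)" W
  proof -
    have [measurable]: "W 0 \<in> borel_measurable M" using W_indep unfolding M.indep_vars_def by simp
    interpret real_distribution "distr M borel (W 0)" by (rule M.real_distribution_distr) simp
    \<comment> \<open>As before, a nonzero integral certifies integrability.\<close>
    have "integrable M (\<lambda>w. (W 0 w)^2)"
      using W_var not_integrable_integral_eq[of M "\<lambda>w. (W 0 w)^2"] by force
    then show "iid_multipliers M (distr M borel (W 0)) W"
      using W_integrable W_mean W_var W_indep W_law
      by unfold_locales (auto simp: integrable_distr_eq integral_distr)
  qed
  have Q_law: "distr M borel (Q i) = std_normal_distribution" for i
    using distributed_distr_eq_density[OF Q_normal[of i]] distr_cong[of M M borel lborel "Q i" "Q i"] by simp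
  have Q_meas [measurable]: "Q i \<in> borel_measurable M" for i using Q_indep unfolding M.indep_vars_def by simp

  \<comment> \<open>Replacing residuals by errors\<close>
  define df where "df n j w = f (Z j w) - fitted fest X Z n w (Z j w)" for n j w
  define dg where "dg n j w = g (Z j w) - fitted gest Y Z n w (Z j w)" for n j w
  \<comment> \<open>The parts of an observation seen by \<open>fest\<close> and by
    \<open>gest\<close>. The roles cross over: \<open>uf\<close> conditions \<open>eX\<close>
    squared on what \<open>gest\<close> sees, and \<open>vg\<close> conditions \<open>eY\<close>
    squared on what \<open>fest\<close> sees.\<close>
  define pX where "pX d = (fst d, zz d)" for d :: "real \<times> real \<times> (real ^ 'd)"
  define pY where "pY d = (fst (snd d), zz d)" for d :: "real \<times> real \<times> (real ^ 'd)"
  have [measurable]: "pX \<in> borel_measurable borel" "pY \<in> borel_measurable borel"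
    unfolding pX_def pY_def by measurable
  obtain Bu where Bu: "\<And>c. uf c \<le> ennreal Bu" using uf_bounded by auto
  obtain Bv where Bv: "\<And>c. vg c \<le> ennreal Bv" using vg_bounded by auto
  have bound_X: "(\<integral>\<^sup>+d. ennreal ((eX d)^2) * \<phi> (pY d) \<partial>P) \<le> ennreal Bu * (\<integral>\<^sup>+d. \<phi> (pY d) \<partial>P)"
    if [measurable]: "\<phi> \<in> borel_measurable borel" for \<phi>
  proof -
    have "nn_cond_exp_fun P (\<lambda>d. ennreal ((eX d)^2)) (\<lambda>d. (zz d, fst (snd d))) uf"
      using uf by (simp add: eX_def zz_def split_beta')
    \<comment> \<open>The components are swapped because the conditioning lists z first, while the
      sample given to an estimator lists it last.\<close>
    from P.nn_cond_exp_fun_bound[OF _ _ this Bu, of "\<lambda>c. \<phi> (snd c, fst c)"]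
    show ?thesis by (simp add: pY_def)
  qed
  have bound_Y: "(\<integral>\<^sup>+d. ennreal ((eY d)^2) * \<phi> (pX d) \<partial>P) \<le> ennreal Bv * (\<integral>\<^sup>+d. \<phi> (pX d) \<partial>P)"
    if [measurable]: "\<phi> \<in> borel_measurable borel" for \<phi>
  proof -
    have "nn_cond_exp_fun P (\<lambda>d. ennreal ((eY d)^2)) (\<lambda>d. (zz d, fst d)) vg"
      using vg by (simp add: eY_def zz_def split_beta')
    from P.nn_cond_exp_fun_bound[OF _ _ this Bv, of "\<lambda>c. \<phi> (snd c, fst c)"]
    show ?thesis by (simp add: pX_def)
  qed
  have dg_eq: "dg n j w = g (snd (pY (D j w))) - gest n (\<lambda>i\<in>{..<n}. pY (D i w)) (snd (pY (D j w)))" for n j w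
    by (simp add: dg_def fitted_def pY_def D_def zz_def)
  have df_eq: "df n j w = f (snd (pX (D j w))) - fest n (\<lambda>i\<in>{..<n}. pX (D i w)) (snd (pX (D j w)))" for n j w
    by (simp add: df_def fitted_def pX_def D_def zz_def)
  have err_g: "small_o_p M (\<lambda>n w. 1 / real n * (\<Sum>j<n. (dg n j w)^2)) (\<lambda>n. real n powr (- 1 / 2))"
    using A_g unfolding avg_sq_error_def dg_def .
  have err_f: "small_o_p M (\<lambda>n w. 1 / real n * (\<Sum>j<n. (df n j w)^2)) (\<lambda>n. real n powr (- 1 / 2))"
    using A_f unfolding avg_sq_error_def df_def .
  note negl_g = M.estimation_error_negligible[where l = "\<lambda>d. (eX d)^2" and p = pY and g = g,
      OF D_indep D_law _ _ _ bound_X gest _ err_g[unfolded dg_eq], folded dg_eq]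
  note negl_f = M.estimation_error_negligible[where l = "\<lambda>d. (eY d)^2" and p = pX and g = f,
      OF D_indep D_law _ _ _ bound_Y fest _ err_f[unfolded df_eq], folded df_eq]
  have [measurable]: "df n j \<in> borel_measurable M" "dg n j \<in> borel_measurable M" if "j < n" for n j
    using that by (auto intro!: negl_f(1) negl_g(1))
  have term_X: "tends_in_prob M (\<lambda>n w. 1 / real n * (\<Sum>j<n. (eX (D j w))^2 * (dg n j w)^2)) 0"
    by (rule negl_g(2)) simp_all
  have term_Y: "tends_in_prob M (\<lambda>n w. 1 / real n * (\<Sum>j<n. (eY (D j w))^2 * (df n j w)^2)) 0"
    by (rule negl_f(2)) simp_all
  define \<gamma> where "\<gamma> n = real n powr (- 1 / 2)" for n
  define Af where "Af n w = 1 / real n * (\<Sum>j<n. (df n j w)^2)" for n w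
  define Ag where "Ag n w = 1 / real n * (\<Sum>j<n. (dg n j w)^2)" for n w
  have [measurable]: "Af n \<in> borel_measurable M" "Ag n \<in> borel_measurable M" for n unfolding Af_def Ag_def by measurable
  have term_XY: "tends_in_prob M (\<lambda>n w. (Af n w / \<gamma> n) * (Ag n w / \<gamma> n)) 0"
  proof (rule M.tends_in_prob_mult)
    show "tends_in_prob M (\<lambda>n w. Af n w / \<gamma> n) 0" using err_f unfolding small_o_p_def Af_def \<gamma>_def .
    show "tends_in_prob M (\<lambda>n w. Ag n w / \<gamma> n) 0" using err_g unfolding small_o_p_def Ag_def \<gamma>_def .
  qed measurable
  \<comment> \<open>The square of the rate \<open>\<gamma> n\<close> is exactly 1 / n, so the right
    side is n times the product of the two averages; this is where both rates are used at
    once.\<close>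
  have cross: "1 / real n * (\<Sum>j<n. (df n j w)^2 * (dg n j w)^2) \<le> (Af n w / \<gamma> n) * (Ag n w / \<gamma> n)" if n: "n \<ge> 1" for n w
  proof -
    have "\<gamma> n * \<gamma> n = real n powr (- 1 / 2 + - 1 / 2)" unfolding \<gamma>_def by (rule powr_add[symmetric])
    also have "- 1 / 2 + - 1 / 2 = (- 1 :: real)" by simp
    also have "real n powr - 1 = 1 / real n" using n by (intro powr_neg_one) simp
    finally have gg: "\<gamma> n * \<gamma> n = 1 / real n" .
    have "(Af n w / \<gamma> n) * (Ag n w / \<gamma> n) = Af n w * Ag n w / (1 / real n)"
      unfolding times_divide_times_eq gg ..
    also have "\<dots> = 1 / real n * ((\<Sum>j<n. (df n j w)^2) * (\<Sum>j<n. (dg n j w)^2))"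
    proof -
      have "(1 / x * s) * (1 / x * t) / (1 / x) = 1 / x * (s * t)" if "x \<noteq> 0" for x s t :: real
        using that by (simp add: field_simps)
      then show ?thesis unfolding Af_def Ag_def using n by simp
    qed
    finally show ?thesis
      by (simp only:) (intro mult_left_mono sum_mult_le_mult_sum, simp_all)
  qed

  define r where "r n j w = (resid fest X Z n j w * resid gest Y Z n j w) *\<^sub>R k (Z j w)" for n j w
  have r_eq: "r n j w = ((eX (D j w) + df n j w) * (eY (D j w) + dg n j w)) *\<^sub>R k (zz (D j w))" for n j w
    by (simp add: r_def resid_def eX_def eY_def df_def dg_def D_def zz_def)
  have r_meas [measurable]: "r n j \<in> borel_measurable M" if "j < n" for n j
    unfolding r_eq using that by measurable
  \<comment> \<open>Expanding (eX + df) * (eY + dg) - eX * eY leaves three products, whence the 3 in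
    (x + y + z)^2 \<le> 3 * (x^2 + y^2 + z^2); \<open>C\<close> bounds the squared norm of the
    kernel section.\<close>
  have r_diff: "(norm (r n j w - a (D j w)))^2 \<le> 3 * C * ((eX (D j w))^2 * (dg n j w)^2 + (eY (D j w))^2 * (df n j w)^2 + (df n j w)^2 * (dg n j w)^2)" for n j w
  proof -
    have three: "(x + y + z)^2 \<le> 3 * (x^2 + y^2 + z^2)" for x y z :: real
      using zero_le_power2[of "x - y"] zero_le_power2[of "y - z"] zero_le_power2[of "x - z"]
      by (simp add: power2_eq_square algebra_simps)
    have "r n j w - a (D j w) = (eX (D j w) * dg n j w + eY (D j w) * df n j w + df n j w * dg n j w) *\<^sub>R k (zz (D j w))"
      unfolding r_eq a_def scaleR_diff_left[symmetric] by (simp add: algebra_simps)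
    then have "(norm (r n j w - a (D j w)))^2 = (eX (D j w) * dg n j w + eY (D j w) * df n j w + df n j w * dg n j w)^2 * (norm (k (zz (D j w))))^2"
      by (simp add: power_mult_distrib)
    also have "\<dots> \<le> (3 * ((eX (D j w) * dg n j w)^2 + (eY (D j w) * df n j w)^2 + (df n j w * dg n j w)^2)) * C"
      by (intro mult_mono three k_norm) auto
    finally show ?thesis by (simp add: power_mult_distrib mult_ac)
  qed
  have close: "tends_in_prob M (\<lambda>n w. 1 / real n * (\<Sum>j<n. (norm (r n j w - a (D j w)))^2)) 0"
  proof (rule M.tends_in_prob_dominated)
    define U where "U n w = 1 / real n * (\<Sum>j<n. (eX (D j w))^2 * (dg n j w)^2) +
      1 / real n * (\<Sum>j<n. (eY (D j w))^2 * (df n j w)^2) + (Af n w / \<gamma> n) * (Ag n w / \<gamma> n)" for n w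
    have U: "tends_in_prob M U 0"
      unfolding U_def by (intro M.tends_in_prob_add term_X term_Y term_XY) measurable
    show "tends_in_prob M (\<lambda>n w. 3 * C * (U n w - 0)) 0" by (rule tends_in_prob_cmult[OF U])
    show "(\<lambda>w. 3 * C * (U n w - 0)) \<in> borel_measurable M" for n unfolding U_def by measurable
    show "\<forall>\<^sub>F n in sequentially. \<forall>w\<in>space M.
        \<bar>1 / real n * (\<Sum>j<n. (norm (r n j w - a (D j w)))^2) - 0\<bar> \<le> \<bar>3 * C * (U n w - 0)\<bar>"
    proof (rule eventually_sequentiallyI[of 1], intro ballI)
      fix n :: nat and w assume n: "n \<ge> 1"
      let ?R = "\<Sum>j<n. (norm (r n j w - a (D j w)))^2"
      let ?X = "\<Sum>j<n. (eX (D j w))^2 * (dg n j w)^2" and ?Y = "\<Sum>j<n. (eY (D j w))^2 * (df n j w)^2"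
        and ?XY = "\<Sum>j<n. (df n j w)^2 * (dg n j w)^2"
      have "?R \<le>
          3 * C * (?X + ?Y + ?XY)"
        unfolding sum.distrib[symmetric] sum_distrib_left by (intro sum_mono order_trans[OF r_diff]) (simp add: sum_distrib_left)
      then have "1 / real n * ?R \<le>
          1 / real n * (3 * C * (?X + ?Y + ?XY))"
        by (rule mult_left_mono) simp
      also have "\<dots> = 3 * C * (1 / real n * ?X +
          1 / real n * ?Y + 1 / real n * ?XY)"
        by (simp only: distrib_left mult_ac)
      also have "\<dots> \<le> 3 * C * U n w" unfolding U_def using C(1) cross[OF n, of w] by (intro mult_left_mono) auto
      finally show "\<bar>1 / real n * ?R - 0\<bar> \<le> \<bar>3 * C * (U n w - 0)\<bar>"
        by (simp add: sum_nonneg)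
    qed
  qed

  \<comment> \<open>Separating data and multipliers\<close>
  define S where "S n w w' = (norm ((1 / sqrt (real n)) *\<^sub>R (\<Sum>j<n. W j w' *\<^sub>R r n j w)))^2" for n w w'
  define S' where "S' w = (\<Sum>i. lam i * (Q i w)^2)" for w
  \<comment> \<open>The statistic is the diagonal \<open>w' = w\<close> of the separated
    version.\<close>
  have Psi_eq: "Psi_stat fun_of fest gest X Y Z W n w = S n w w" for n w
    unfolding S_def r_def by (rule Psi_stat_eq_norm[OF k])
  have lam_nonneg: "lam i \<ge> 0" and lam_summable: "summable lam" for i
    by (rule covariance_eigenexpansion[OF a_P sq T lam_T]; blast)+
  have S'_meas [measurable]: "S' \<in> borel_measurable M" unfolding S'_def by measurable
  interpret rl: random_limit M S S'
  proof
    show "case_prod (S n) \<in> borel_measurable (M \<Otimes>\<^sub>M M)" for n unfolding S_def by measurable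
    show "S n w w' \<ge> 0" for n w w' by (simp add: S_def)
    show "AE w in M. S' w \<ge> 0"
      using weighted_chi_square_summable[OF Q_meas Q_law lam_nonneg lam_summable]
      by eventually_elim (auto simp: S'_def lam_nonneg intro!: suminf_nonneg)
    show "tends_in_prob M (\<lambda>n w. \<integral>w'. exp (- real k * S n w w') \<partial>M) (\<integral>w'. exp (- real k * S' w') \<partial>M)" for k
      unfolding S_def S'_def
      by (rule multiplier_laplace_limit[OF D_indep D_law Q_indep Q_law a_meas sq T lam_T r_meas close]) simp_all
  qed simp

  \<comment> \<open>Conditional expectation given the sample as an integral\<close>
  let ?N = "\<lambda>n. \<Pi>\<^sub>M i\<in>{..<n}. borel :: (real \<times> real \<times> (real ^ 'd)) measure"
  let ?N' = "\<lambda>n. \<Pi>\<^sub>M i\<in>{..<n}. borel :: (real \<times> (real ^ 'd)) measure"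
  \<comment> \<open>The residual vector as a fixed measurable function of the sample array: the
    freezing principle needs the statistic in the form of a function of the sample and the
    multiplier sequence.\<close>
  define \<rho> where "\<rho> n j d = ((fst (d j) - fest n (\<lambda>i\<in>{..<n}. pX (d i)) (zz (d j))) *
    (fst (snd (d j)) - gest n (\<lambda>i\<in>{..<n}. pY (d i)) (zz (d j)))) *\<^sub>R k (zz (d j))" for n j d
  have comp [measurable]: "(\<lambda>d. d j) \<in> ?N n \<rightarrow>\<^sub>M borel" if "j < n" for n j
    using that by (intro measurable_component_singleton) simp
  have \<rho>_meas [measurable]: "\<rho> n j \<in> borel_measurable (?N n)" if j: "j < n" for n j
  proof -
    have est: "(\<lambda>d. e n (\<lambda>i\<in>{..<n}. p (d i)) (snd (p (d j)))) \<in> borel_measurable (?N n)"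
      if e: "estimator e" and p: "p \<in> borel_measurable borel"
      for e and p :: "real \<times> real \<times> (real ^ 'd) \<Rightarrow> real \<times> (real ^ 'd)"
    proof -
      have "(\<lambda>d. \<lambda>i\<in>{..<n}. p (d i)) \<in> ?N n \<rightarrow>\<^sub>M ?N' n"
        by (intro measurable_restrict measurable_compose[OF comp p]) simp
      moreover have "(\<lambda>c. e n c (snd (c j))) \<in> borel_measurable (?N' n)"
        using e j unfolding estimator_def by simp
      ultimately have "(\<lambda>d. e n (\<lambda>i\<in>{..<n}. p (d i)) (snd ((\<lambda>i\<in>{..<n}. p (d i)) j))) \<in> borel_measurable (?N n)"
        by (rule measurable_compose)
      then show ?thesis using j by simp
    qed
    have [measurable]: "(\<lambda>d. fest n (\<lambda>i\<in>{..<n}. pX (d i)) (zz (d j))) \<in> borel_measurable (?N n)"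
      "(\<lambda>d. gest n (\<lambda>i\<in>{..<n}. pY (d i)) (zz (d j))) \<in> borel_measurable (?N n)"
      using est[OF fest, of pX] est[OF gest, of pY] by (simp_all add: pX_def pY_def)
    show ?thesis unfolding \<rho>_def using j by measurable
  qed
  define sample where "sample n w = (\<lambda>i\<in>{..<n}. D i w)" for n w
  have sample_meas: "sample n \<in> M \<rightarrow>\<^sub>M ?N n" for n unfolding sample_def by measurable
  have r_sample: "r n j w = \<rho> n j (sample n w)" if j: "j < n" for n j w
  proof -
    have "(\<lambda>i\<in>{..<n}. pX (sample n w i)) = (\<lambda>i\<in>{..<n}. (X i w, Z i w))"
      "(\<lambda>i\<in>{..<n}. pY (sample n w i)) = (\<lambda>i\<in>{..<n}. (Y i w, Z i w))"
      by (auto simp: sample_def pX_def pY_def D_def zz_def)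
    moreover have "sample n w j = (X j w, Y j w, Z j w)" using j by (simp add: sample_def D_def)
    ultimately show ?thesis unfolding r_def \<rho>_def by (simp add: resid_def fitted_def zz_def)
  qed
  have sigma: "data_sigma M (\<lambda>i w. (X i w, Y i w, Z i w)) n = vimage_algebra (space M) (sample n) (?N n)" for n
    unfolding data_sigma_def sample_def D_def ..

  show ?thesis
    unfolding conv_in_dist_given_def Psi_eq S'_def[symmetric]
  proof (intro conjI allI impI)
    show "(\<lambda>w. S n w w) \<in> borel_measurable M" for n unfolding S_def by measurable
    show "S' \<in> borel_measurable M" by (rule S'_meas)
    fix h :: "real \<Rightarrow> real"
    assume h: "bounded (range h) \<and> uniformly_continuous_on UNIV h"
    then have cont: "continuous_on UNIV h" by (simp add: uniformly_continuous_imp_continuous)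
    obtain B where B: "\<And>s. \<bar>h s\<bar> \<le> B" using h unfolding bounded_iff by auto
    have [measurable]: "h \<in> borel_measurable borel" by (rule borel_measurable_continuous_onI[OF cont])
    let ?E = "\<lambda>n. real_cond_exp M (data_sigma M (\<lambda>i w. (X i w, Y i w, Z i w)) n)"
    have seq_meas: "(\<lambda>w i. U i w) \<in> M \<rightarrow>\<^sub>M (\<Pi>\<^sub>M i\<in>UNIV. borel)" if "\<And>i. U i \<in> borel_measurable M" for U :: "nat \<Rightarrow> 'a \<Rightarrow> real"
      using that by (intro measurable_PiM_single') (auto simp: space_PiM)
    \<comment> \<open>Stated for an arbitrary sequence \<open>U\<close> independent of the data,
      since it serves the multipliers and the limiting Gaussian variables alike.\<close>
    have cond: "AE w in M. ?E n (\<lambda>w. h (\<phi> (sample n w) (\<lambda>i. U i w))) w = (\<integral>w'. h (\<phi> (sample n w) (\<lambda>i. U i w')) \<partial>M)"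
      if U: "\<And>i. U i \<in> borel_measurable M" "indep_seqs M D U"
        and [measurable]: "case_prod \<phi> \<in> borel_measurable (?N n \<Otimes>\<^sub>M (\<Pi>\<^sub>M i\<in>UNIV. borel))"
      for n and U :: "nat \<Rightarrow> 'a \<Rightarrow> real" and \<phi> :: "(nat \<Rightarrow> real \<times> real \<times> (real ^ 'd)) \<Rightarrow> (nat \<Rightarrow> real) \<Rightarrow> real"
      unfolding sigma
    proof (rule M.real_cond_exp_indep[where B = B, OF sample_meas seq_meas])
      show "M.indep_set (sets (vimage_algebra (space M) (sample n) (?N n)))
          (sets (vimage_algebra (space M) (\<lambda>w i. U i w) (\<Pi>\<^sub>M i\<in>UNIV. borel)))"
        using indep_seqs_data_sigma[OF M U(2) D_meas] unfolding sample_def .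
    qed (use U(1) B in simp_all)
    have 1: "AE w in M. ?E n (\<lambda>w. h (S n w w)) w = (\<integral>w'. h (S n w w') \<partial>M)" for n
    proof -
      define \<phi> where "\<phi> d y = (norm ((1 / sqrt (real n)) *\<^sub>R (\<Sum>j<n. y j *\<^sub>R \<rho> n j d)))^2" for d and y :: "nat \<Rightarrow> real"
      have "case_prod \<phi> \<in> borel_measurable (?N n \<Otimes>\<^sub>M (\<Pi>\<^sub>M i\<in>UNIV. borel))" unfolding \<phi>_def by measurable
      moreover have "S n w w' = \<phi> (sample n w) (\<lambda>i. W i w')" for w w' unfolding S_def \<phi>_def by (simp add: r_sample)
      ultimately show ?thesis using cond[OF W_measurable W_data[folded D_def]] by simp
    qed
    \<comment> \<open>The limit variable ignores the sample, so its conditional expectation is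
      almost surely the constant found by the Laplace transforms.\<close>
    have 2: "AE w in M. ?E n (\<lambda>w. h (S' w)) w = (\<integral>w'. h (S' w') \<partial>M)" for n
      unfolding S'_def by (rule cond[OF Q_meas Q_data[folded D_def]]) measurable
    show "tends_in_prob M (\<lambda>n w. \<bar>?E n (\<lambda>w. h (S n w w)) w -
        ?E n (\<lambda>w. h (S' w)) w\<bar>) 0"
    proof (rule M.tends_in_prob_AE_cong)
      show "tends_in_prob M (\<lambda>n w. \<bar>(\<integral>w'. h (S n w w') \<partial>M) - (\<integral>w'. h (S' w') \<partial>M)\<bar>) 0"
        using rl.bounded_continuous[OF cont B] by (simp add: tends_in_prob_def)
      show "AE w in M. \<bar>?E n (\<lambda>w. h (S n w w)) w -
          ?E n (\<lambda>w. h (S' w)) w\<bar> =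
          \<bar>(\<integral>w'. h (S n w w') \<partial>M) - (\<integral>w'. h (S' w') \<partial>M)\<bar>" for n
        using 1[of n] 2[of n] by eventually_elim simp
      show "(\<lambda>w. \<bar>?E n (\<lambda>w. h (S n w w)) w -
          ?E n (\<lambda>w. h (S' w)) w\<bar>) \<in> borel_measurable M" for n
        by (intro borel_measurable_abs borel_measurable_diff borel_measurable_cond_exp2)
      show "(\<lambda>w. \<bar>(\<integral>w'. h (S n w w') \<partial>M) - (\<integral>w'. h (S' w') \<partial>M)\<bar>) \<in> borel_measurable M" for n
        by (intro borel_measurable_abs borel_measurable_diff rl.integral_measurable) simp_all
    qed
  qed
qed

end
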